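(* Let $k$ be a field and let $\vec{m}=(m_1,\dots,m_n)$ be an $n$-tuple of positive integers such that the circulant ring $\mathcal{C}_{\vec{m}/k}=k[X_1,\dots,X_n]/(X_1^{m_1}-1,\dots,X_n^{m_n}-1)$ is semisimple. Let $S\subset \mathcal{V}(\mathfrak{a}_{\vec{m}})$ be a set of representatives of the orbits of the geometric group action $\alpha_{\vec{m}/k}$ of $\operatorname{Gal}(k_{\vec{m}}/k)$ on $\mathcal{V}(\mathfrak{a}_{\vec{m}})$ (exactly one element from each orbit). Then the map $$\mathcal{C}_{\vec{m}/k}\to \bigoplus_{\mathbf{x}\in S} k(\mathbf{x}),\qquad f\mapsto (f(\mathbf{x}))_{\mathbf{x}\in S},$$ is a (well-defined) ring isomorphism, and $[k(\mathbf{x}):k]=\#\operatorname{Orb}(\mathbf{x})$ for every $\mathbf{x}\in S$.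
   Context: Fix an algebraic closure $\overline{k}$ of $k$, and let $\mu_m\subset\overline{k}$ be the set of all $m$-th roots of unity. The ideal $\mathfrak{a}_{\vec{m}}=(X_1^{m_1}-1,\dots,X_n^{m_n}-1)\subset k[X_1,\dots,X_n]$ has vanishing set $\mathcal{V}(\mathfrak{a}_{\vec{m}})=\{\mathbf{x}\in\overline{k}^n : f(\mathbf{x})=0 \text{ for all } f\in\mathfrak{a}_{\vec{m}}\}$; thus elements of $\mathcal{C}_{\vec{m}/k}$ can be evaluated at points of $\mathcal{V}(\mathfrak{a}_{\vec{m}})$. A ring is semisimple if it is isomorphic to a finite direct sum of simple rings; for commutative rings, this means a finite direct sum of fields. $k_{\vec{m}}=k(\mu_{m_1},\dots,\mu_{m_n})\subset\overline{k}$ is the smallest extension of $k$ containing all $\mu_{m_i}$; it is Galois over $k$ when $\mathcal{C}_{\vec{m}/k}$ is semisimple. The geometric group action $\alpha_{\vec{m}/k}$ is $\operatorname{Gal}(k_{\vec{m}}/k)\times\mathcal{V}(\mathfrak{a}_{\vec{m}})\to\mathcal{V}(\mathfrak{a}_{\vec{m}})$, $(\sigma,(x_1,\dots,x_n))\mapsto(\sigma(x_1),\dots,\sigma(x_n))$, and $\operatorname{Orb}(\mathbf{x})$ is the orbit of $\mathbf{x}$. For $\mathbf{x}=(x_1,\dots,x_n)$, $k(\mathbf{x})=k(x_1,\dots,x_n)\subset\overline{k}$. *)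

theory Defs
  imports "HOL-Algebra.Algebraic_Closure" "HOL-Algebra.Generated_Fields" "HOL-Algebra.Group_Action"
begin

section \<open>Products of rings and semisimple rings\<close>

text \<open>The ring analogue of \<open>product_group\<close>. For a finite index set, the only case used
  below, it is the direct sum.\<close>

definition product_ring :: "'i set \<Rightarrow> ('i \<Rightarrow> ('a, 'b) ring_scheme) \<Rightarrow> ('i \<Rightarrow> 'a) ring"
  where "product_ring I R =
    \<lparr> carrier = (\<Pi>\<^sub>E i\<in>I. carrier (R i)),
      monoid.mult = (\<lambda>x y. \<lambda>i\<in>I. x i \<otimes>\<^bsub>R i\<^esub> y i),
      one = (\<lambda>i\<in>I. \<one>\<^bsub>R i\<^esub>),
      zero = (\<lambda>i\<in>I. \<zero>\<^bsub>R i\<^esub>),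
      add = (\<lambda>x y. \<lambda>i\<in>I. x i \<oplus>\<^bsub>R i\<^esub> y i) \<rparr>"

definition simple_ring :: "('a, 'b) ring_scheme \<Rightarrow> bool"
  where "simple_ring R \<longleftrightarrow>
    ring R \<and> \<one>\<^bsub>R\<^esub> \<noteq> \<zero>\<^bsub>R\<^esub> \<and> (\<forall>I. ideal I R \<longrightarrow> I = {\<zero>\<^bsub>R\<^esub>} \<or> I = carrier R)"

text \<open>Taking the summands with elements in the type of \<open>R\<close> is no restriction: each direct summand
  of a ring is isomorphic to a two-sided ideal of it (with its own identity element).\<close>

definition semisimple_ring :: "('a, 'b) ring_scheme \<Rightarrow> bool"
  where "semisimple_ring R \<longleftrightarrow>
    (\<exists>(r :: nat) (F :: nat \<Rightarrow> 'a ring).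
      (\<forall>j<r. simple_ring (F j)) \<and> R \<simeq> product_ring {..<r} F)"


section \<open>Polynomials in several variables\<close>

text \<open>\<^theory>\<open>HOL-Algebra.Indexed_Polynomials\<close> represents a polynomial as its coefficient function on
  monomials, a monomial being a multiset of variables, but only multiplies by a variable.\<close>

definition indexed_mult ::
    "('a, 'b) ring_scheme \<Rightarrow> ('c multiset \<Rightarrow> 'a) \<Rightarrow> ('c multiset \<Rightarrow> 'a) \<Rightarrow> ('c multiset \<Rightarrow> 'a)"
  where "indexed_mult R P Q = (\<lambda>w. \<Oplus>\<^bsub>R\<^esub>u\<in>{u. u \<subseteq># w}. P u \<otimes>\<^bsub>R\<^esub> Q (w - u))"

definition mpoly_ring :: "('a, 'b) ring_scheme \<Rightarrow> 'a set \<Rightarrow> 'c set \<Rightarrow> ('c multiset \<Rightarrow> 'a) ring"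
  where "mpoly_ring R K I =
    \<lparr> carrier = ring.indexed_pset R I K,
      monoid.mult = indexed_mult R,
      one = ring.indexed_const R \<one>\<^bsub>R\<^esub>,
      zero = ring.indexed_const R \<zero>\<^bsub>R\<^esub>,
      add = ring.indexed_padd R \<rparr>"

definition mpoly_eval :: "('a, 'b) ring_scheme \<Rightarrow> ('c multiset \<Rightarrow> 'a) \<Rightarrow> ('c \<Rightarrow> 'a) \<Rightarrow> 'a"
  where "mpoly_eval R P x =
    (\<Oplus>\<^bsub>R\<^esub>w\<in>{w. P w \<noteq> \<zero>\<^bsub>R\<^esub>}. P w \<otimes>\<^bsub>R\<^esub> (\<Otimes>\<^bsub>R\<^esub>i\<in>set_mset w. x i [^]\<^bsub>R\<^esub> count w i))"


section \<open>Circulant rings\<close>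

text \<open>Throughout, \<open>L\<close> is an algebraic closure of its subfield \<open>K\<close>. A tuple indexed by \<open>1, \<dots>, n\<close> of
  elements of \<open>L\<close> is an extensional function on \<open>{1..n}\<close>; only the values of \<open>m\<close> on \<open>{1..n}\<close> matter.\<close>

abbreviation poly_vars :: "('a, 'b) ring_scheme \<Rightarrow> 'a set \<Rightarrow> nat \<Rightarrow> (nat multiset \<Rightarrow> 'a) ring"
  where "poly_vars L K n \<equiv> mpoly_ring L K {1..n}"

definition circulant_ideal ::
    "('a, 'b) ring_scheme \<Rightarrow> 'a set \<Rightarrow> nat \<Rightarrow> (nat \<Rightarrow> nat) \<Rightarrow> (nat multiset \<Rightarrow> 'a) set"
  where "circulant_ideal L K n m =
    Idl\<^bsub>poly_vars L K n\<^esub>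
      ((\<lambda>i. ring.indexed_var L i [^]\<^bsub>poly_vars L K n\<^esub> m i \<ominus>\<^bsub>poly_vars L K n\<^esub> \<one>\<^bsub>poly_vars L K n\<^esub>) ` {1..n})"

definition circulant_ring ::
    "('a, 'b) ring_scheme \<Rightarrow> 'a set \<Rightarrow> nat \<Rightarrow> (nat \<Rightarrow> nat) \<Rightarrow> (nat multiset \<Rightarrow> 'a) set ring"
  where "circulant_ring L K n m = poly_vars L K n Quot circulant_ideal L K n m"

definition circulant_variety ::
    "('a, 'b) ring_scheme \<Rightarrow> 'a set \<Rightarrow> nat \<Rightarrow> (nat \<Rightarrow> nat) \<Rightarrow> (nat \<Rightarrow> 'a) set"
  where "circulant_variety L K n m =
    {x \<in> {1..n} \<rightarrow>\<^sub>E carrier L. \<forall>f\<in>circulant_ideal L K n m. mpoly_eval L f x = \<zero>\<^bsub>L\<^esub>}"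

text \<open>The common value at \<open>x\<close> of all polynomials in the residue class \<open>A\<close>; \<^const>\<open>the_elem\<close> is
  unspecified if there is no such common value.\<close>

definition class_eval ::
    "('a, 'b) ring_scheme \<Rightarrow> ('c multiset \<Rightarrow> 'a) set \<Rightarrow> ('c \<Rightarrow> 'a) \<Rightarrow> 'a"
  where "class_eval L A x = the_elem ((\<lambda>f. mpoly_eval L f x) ` A)"


section \<open>The geometric group action\<close>

definition adjoin_point :: "('a, 'b) ring_scheme \<Rightarrow> 'a set \<Rightarrow> nat \<Rightarrow> (nat \<Rightarrow> 'a) \<Rightarrow> 'a set"
  where "adjoin_point L K n x = generate_field L (K \<union> x ` {1..n})"

definition unity_roots :: "('a, 'b) ring_scheme \<Rightarrow> nat \<Rightarrow> 'a set"
  where "unity_roots L r = {z \<in> carrier L. z [^]\<^bsub>L\<^esub> r = \<one>\<^bsub>L\<^esub>}"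

definition adjoin_unity_roots :: "('a, 'b) ring_scheme \<Rightarrow> 'a set \<Rightarrow> nat \<Rightarrow> (nat \<Rightarrow> nat) \<Rightarrow> 'a set"
  where "adjoin_unity_roots L K n m = generate_field L (K \<union> (\<Union>i\<in>{1..n}. unity_roots L (m i)))"

text \<open>The group of automorphisms of the subfield \<open>E\<close> of \<open>L\<close> that fix \<open>K\<close> pointwise.\<close>

definition Gal :: "('a, 'b) ring_scheme \<Rightarrow> 'a set \<Rightarrow> 'a set \<Rightarrow> ('a \<Rightarrow> 'a) monoid"
  where "Gal L E K = (BijGroup E)
    \<lparr> carrier := {\<sigma> \<in> Bij E. \<sigma> \<in> ring_iso (L\<lparr>carrier := E\<rparr>) (L\<lparr>carrier := E\<rparr>) \<and> (\<forall>a\<in>K. \<sigma> a = a)} \<rparr>"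

abbreviation circulant_Gal :: "('a, 'b) ring_scheme \<Rightarrow> 'a set \<Rightarrow> nat \<Rightarrow> (nat \<Rightarrow> nat) \<Rightarrow> ('a \<Rightarrow> 'a) monoid"
  where "circulant_Gal L K n m \<equiv> Gal L (adjoin_unity_roots L K n m) K"

definition geometric_action ::
    "('a, 'b) ring_scheme \<Rightarrow> 'a set \<Rightarrow> nat \<Rightarrow> (nat \<Rightarrow> nat) \<Rightarrow> ('a \<Rightarrow> 'a) \<Rightarrow> (nat \<Rightarrow> 'a) \<Rightarrow> (nat \<Rightarrow> 'a)"
  where "geometric_action L K n m \<sigma> = (\<lambda>x\<in>circulant_variety L K n m. \<lambda>i\<in>{1..n}. \<sigma> (x i))"

end

theory Submission
  imports Defs "HOL-Computational_Algebra.Primes"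
begin

text \<open>
  Semisimplicity makes the circulant ring reduced. If the characteristic \<open>p\<close> divided an exponent \<open>d\<close>
  with \<open>X\<^sub>i\<^sup>d = 1\<close> in the circulant ring, then \<open>X\<^sub>i\<^bsup>d/p\<^esup> - 1\<close> would be nilpotent by Frobenius, hence zero; so
  the least such \<open>d\<close> is invertible in \<open>L\<close> and there are exactly \<open>d\<close> roots of unity of exponent \<open>d\<close>.
  Every polynomial is congruent to one whose exponents are below these bounds; its monomials are
  pairwise distinct characters of the group of points of the variety, so by linear independence of
  characters it vanishes on the variety only if it is zero. As evaluation commutes with the Galois
  action, vanishing at the representatives of the orbits suffices, and the map is injective.

  A finite group of roots of unity is cyclic, so every field in sight is \<open>F(\<zeta>)\<close> for a root of unity \<open>\<zeta>\<close>.
  All conjugates of \<open>\<zeta>\<close> are powers of \<open>\<zeta>\<close> and its minimal polynomial is separable, whence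
  \<open>|Gal(F(\<zeta>)/F)| = [F(\<zeta>):F]\<close>. Since the stabilizer of \<open>x\<close> is the Galois group over \<open>K(x)\<close>, the
  orbit-stabilizer theorem and the tower law give \<open>|Orb(x)| = [K(x):K]\<close>.

  For surjectivity let \<open>K(y) = K(\<eta>)\<close>. There are \<open>[K(y):K]\<close> points in the orbit of \<open>y\<close>, so they account for
  all conjugates of \<open>\<eta>\<close>; hence a point \<open>x\<close> at which all polynomials vanishing at \<open>y\<close> vanish is in the orbit
  of \<open>y\<close>. So points of different orbits are separated by polynomials over \<open>K\<close>, and interpolation in
  the manner of the Chinese remainder theorem yields a preimage.
\<close>

section \<open>Polynomials in several variables\<close>

text \<open>Separability and normality of \<open>F(\<zeta>)\<close> are both read off the powers of
  \<open>\<zeta>\<close>: the order of \<open>\<zeta>\<close> is used as exponent instead of a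
  prescribed one, so \<open>X^d - 1\<close> has \<open>d\<close> roots in every characteristic, and
  since conjugates are powers, each conjugate generates the same field. Hence the Galois theory
  works over any base field \<open>F\<close>, in particular over \<open>K\<close> and over
  \<open>K(x)\<close> with the same \<open>\<zeta>\<close>. Semisimplicity is what injectivity rests
  on.

  Surjectivity is not obtained by comparing dimensions, so no basis of the circulant ring is
  constructed. It needs the orbit size beforehand: a polynomial \<open>q\<close> with
  \<open>q(y) = \<eta>\<close> maps the orbit of \<open>y\<close> injectively into the roots of the
  minimal polynomial of \<open>\<eta>\<close>, and only the equality of the two cardinalities shows
  that every root is reached.

  Galois automorphisms are maps on the field \<open>E\<close> alone, not on \<open>L\<close>. This
  is why the lemmas on commuting with evaluation speak of homomorphisms defined on a subring that
  contains \<open>K\<close> and the coordinates.\<close>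

definition mpoly_monom :: "('a, 'b) ring_scheme \<Rightarrow> 'a \<Rightarrow> 'c multiset \<Rightarrow> ('c multiset \<Rightarrow> 'a)"
  where "mpoly_monom R k w = (\<lambda>u. if u = w then k else \<zero>\<^bsub>R\<^esub>)"

definition monom_eval :: "('a, 'b) ring_scheme \<Rightarrow> 'c multiset \<Rightarrow> ('c \<Rightarrow> 'a) \<Rightarrow> 'a"
  where "monom_eval R w x = (\<Otimes>\<^bsub>R\<^esub>i\<in>set_mset w. x i [^]\<^bsub>R\<^esub> count w i)"

lemma finite_subseteq_mset: "finite {u. u \<subseteq># w}"
proof -
  have "u \<in> mset ` {xs. set xs \<subseteq> set_mset w \<and> length xs \<le> size w}" if "u \<subseteq># w" for u
  proof -
    obtain xs where "mset xs = u" using ex_mset by blast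
    then show ?thesis
      using that set_mset_mono[OF that] size_mset_mono[OF that]
      by (metis (mono_tags, lifting) image_eqI mem_Collect_eq set_mset_mset size_mset)
  qed
  then have "{u. u \<subseteq># w} \<subseteq> mset ` {xs. set xs \<subseteq> set_mset w \<and> length xs \<le> size w}" by blast
  then show ?thesis
    by (rule finite_subset) (simp add: finite_lists_length_le)
qed

context cring
begin

section \<open>The convolution product and its ring laws\<close>

lemma indexed_mult_closed:
  assumes "carrier_coeff P" "carrier_coeff Q"
  shows "carrier_coeff (indexed_mult R P Q)"
  using assms unfolding carrier_coeff_def indexed_mult_def
  by (auto intro!: finsum_closed)

text \<open>With \<open>indexed_mult_padd\<close> and \<open>indexed_mult_pmult\<close> this
  computes a product whose left factor is any of the three constructors of
  \<open>indexed_pset\<close>. Later laws follow by induction on the left factor, without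
  manipulating double sums.\<close>

lemma indexed_mult_const:
  assumes "k \<in> carrier R" "carrier_coeff Q"
  shows "indexed_mult R (indexed_const k) Q = (\<lambda>w. k \<otimes> Q w)"
proof
  fix w
  have "indexed_mult R (indexed_const k) Q w
      = (\<Oplus>u\<in>{u. u \<subseteq># w}. if {#} = u then k \<otimes> Q (w - u) else \<zero>)"
    unfolding indexed_mult_def
    by (rule finsum_cong') (use assms in \<open>auto simp: indexed_const_def carrier_coeff_def\<close>)
  also have "\<dots> = k \<otimes> Q (w - {#})"
    by (rule finsum_singleton) (use assms in \<open>auto simp: finite_subseteq_mset carrier_coeff_def\<close>)
  finally show "indexed_mult R (indexed_const k) Q w = k \<otimes> Q w" by simp
qed

lemma indexed_mult_padd:
  assumes "carrier_coeff P" "carrier_coeff P'" "carrier_coeff Q"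
  shows "indexed_mult R (indexed_padd P P') Q
    = indexed_padd (indexed_mult R P Q) (indexed_mult R P' Q)"
proof
  fix w
  have "indexed_mult R (indexed_padd P P') Q w
      = (\<Oplus>u\<in>{u. u \<subseteq># w}. P u \<otimes> Q (w - u) \<oplus> P' u \<otimes> Q (w - u))"
    unfolding indexed_mult_def
    by (rule finsum_cong') (use assms in \<open>auto simp: indexed_padd_def carrier_coeff_def l_distr\<close>)
  also have "\<dots> = indexed_padd (indexed_mult R P Q) (indexed_mult R P' Q) w"
    unfolding indexed_mult_def indexed_padd_def
    by (rule finsum_addf) (use assms in \<open>auto simp: carrier_coeff_def\<close>)
  finally show "indexed_mult R (indexed_padd P P') Q w
    = indexed_padd (indexed_mult R P Q) (indexed_mult R P' Q) w" .
qed

text \<open>Sub-multisets of \<open>w\<close> that contain \<open>i\<close> correspond under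
  \<open>add_mset i\<close> to the sub-multisets of \<open>w - {#i#}\<close>; all others contribute
  zero.\<close>

lemma indexed_mult_pmult:
  assumes "carrier_coeff P" "carrier_coeff Q"
  shows "indexed_mult R (indexed_pmult P i) Q = indexed_pmult (indexed_mult R P Q) i"
proof
  fix w
  have c: "P u \<in> carrier R" "Q u \<in> carrier R" for u
    using assms by (auto simp: carrier_coeff_def)
  show "indexed_mult R (indexed_pmult P i) Q w = indexed_pmult (indexed_mult R P Q) i w"
  proof (cases "i \<in># w")
    case False
    have "indexed_mult R (indexed_pmult P i) Q w = (\<Oplus>u\<in>{u. u \<subseteq># w}. \<zero>)"
      unfolding indexed_mult_def
      by (rule finsum_cong')
         (use False c in \<open>auto simp: indexed_pmult_def dest: mset_subset_eqD\<close>)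
    then show ?thesis using False by (simp add: indexed_pmult_def)
  next
    case True
    then obtain w' where w: "w = add_mset i w'" by (meson multi_member_split)
    have im: "add_mset i ` {u. u \<subseteq># w'} \<subseteq> {u. u \<subseteq># w}" by (auto simp: w)
    have "indexed_mult R (indexed_pmult P i) Q w
        = (\<Oplus>u\<in>add_mset i ` {u. u \<subseteq># w'}. indexed_pmult P i u \<otimes> Q (w - u))"
      unfolding indexed_mult_def
    proof (rule add.finprod_mono_neutral_cong_right[OF finite_subseteq_mset im])
      fix u assume u: "u \<in> {u. u \<subseteq># w} - add_mset i ` {u. u \<subseteq># w'}"
      have "i \<notin># u"
      proof
        assume "i \<in># u"
        then obtain v where v: "u = add_mset i v" by (meson multi_member_split)
        with u have "v \<subseteq># w'" by (simp add: w)
        with u v show False by auto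
      qed
      then show "indexed_pmult P i u \<otimes> Q (w - u) = \<zero>"
        using c by (simp add: indexed_pmult_def)
    qed (use c in \<open>auto simp: indexed_pmult_def\<close>)
    also have "\<dots> = (\<Oplus>u\<in>{u. u \<subseteq># w'}. indexed_pmult P i (add_mset i u) \<otimes> Q (w - add_mset i u))"
      by (rule finsum_reindex) (use c in \<open>auto simp: indexed_pmult_def inj_on_def\<close>)
    also have "\<dots> = indexed_mult R P Q w'"
      unfolding indexed_mult_def
      by (rule finsum_cong') (use c in \<open>auto simp: indexed_pmult_def w\<close>)
    finally show ?thesis using True by (simp add: indexed_pmult_def w)
  qed
qed

text \<open>The involution \<open>u \<mapsto> w - u\<close> permutes the sub-multisets of
  \<open>w\<close> and exchanges the two arguments of the convolution.\<close>

lemma indexed_mult_comm: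
  fixes P Q :: "'c multiset \<Rightarrow> 'a"
  assumes "carrier_coeff P" "carrier_coeff Q"
  shows "indexed_mult R P Q = indexed_mult R Q P"
proof
  fix w :: "'c multiset"
  have c: "P u \<in> carrier R" "Q u \<in> carrier R" for u
    using assms by (auto simp: carrier_coeff_def)
  have inj: "inj_on (\<lambda>u. w - u) {u. u \<subseteq># w}"
    by (rule inj_on_inverseI[of _ "\<lambda>u. w - u"]) (auto simp: multiset_eq_iff subseteq_mset_def)
  have im: "(\<lambda>u. w - u) ` {u. u \<subseteq># w} = {u. u \<subseteq># w}"
  proof (intro subset_antisym subsetI)
    fix u assume "u \<in> {u. u \<subseteq># w}"
    then show "u \<in> (\<lambda>u. w - u) ` {u. u \<subseteq># w}"
      by (intro image_eqI[of _ _ "w - u"]) (auto simp: multiset_eq_iff subseteq_mset_def)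
  qed auto
  have "indexed_mult R P Q w = (\<Oplus>u\<in>(\<lambda>u. w - u) ` {u. u \<subseteq># w}. P u \<otimes> Q (w - u))"
    unfolding indexed_mult_def im ..
  also have "\<dots> = (\<Oplus>u\<in>{u. u \<subseteq># w}. P (w - u) \<otimes> Q (w - (w - u)))"
    by (rule finsum_reindex[OF _ inj]) (use c in auto)
  also have "\<dots> = indexed_mult R Q P w"
    unfolding indexed_mult_def
  proof (rule finsum_cong')
    fix u assume "u \<in> {u. u \<subseteq># w}"
    then have "w - (w - u) = u" by (auto simp: multiset_eq_iff subseteq_mset_def)
    then show "P (w - u) \<otimes> Q (w - (w - u)) = Q u \<otimes> P (w - u)"
      using c by (simp add: m_comm)
  qed (use c in auto)
  finally show "indexed_mult R P Q w = indexed_mult R Q P w" .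
qed

section \<open>Values of monomials\<close>

lemma monom_eval_superset:
  assumes "x \<in> set_mset w \<rightarrow> carrier R" "finite A" "set_mset w \<subseteq> A" "x \<in> A \<rightarrow> carrier R"
  shows "monom_eval R w x = (\<Otimes>i\<in>A. x i [^] count w i)"
  unfolding monom_eval_def
  by (rule finprod_mono_neutral_cong_left)
     (use assms in \<open>auto simp: not_in_iff\<close>)

lemma monom_eval_closed:
  assumes "x \<in> set_mset w \<rightarrow> carrier R"
  shows "monom_eval R w x \<in> carrier R"
  using assms unfolding monom_eval_def by (auto intro!: finprod_closed)

lemma monom_eval_add:
  assumes "x \<in> set_mset w \<rightarrow> carrier R" "x \<in> set_mset u \<rightarrow> carrier R"
  shows "monom_eval R (w + u) x = monom_eval R w x \<otimes> monom_eval R u x"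
proof -
  let ?A = "set_mset w \<union> set_mset u"
  have c: "x i \<in> carrier R" if "i \<in> ?A" for i using assms that by auto
  have "monom_eval R (w + u) x = (\<Otimes>i\<in>?A. x i [^] count w i \<otimes> x i [^] count u i)"
    unfolding monom_eval_def
    by (rule finprod_cong') (use c in \<open>auto simp: nat_pow_mult\<close>)
  also have "\<dots> = (\<Otimes>i\<in>?A. x i [^] count w i) \<otimes> (\<Otimes>i\<in>?A. x i [^] count u i)"
    by (rule finprod_multf) (use c in auto)
  also have "\<dots> = monom_eval R w x \<otimes> monom_eval R u x"
    using assms c by (subst (1 2) monom_eval_superset[of x _ ?A]) auto
  finally show ?thesis .
qed

lemma monom_eval_single:
  "x i \<in> carrier R \<Longrightarrow> monom_eval R {#i#} x = x i"
  unfolding monom_eval_def by simp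

lemma monom_eval_empty [simp]: "monom_eval R {#} x = \<one>"
  by (simp add: monom_eval_def)

lemma monom_eval_add_mset:
  assumes "x \<in> set_mset w \<rightarrow> carrier R" "x i \<in> carrier R"
  shows "monom_eval R (add_mset i w) x = x i \<otimes> monom_eval R w x"
  using monom_eval_add[of x w "{#i#}"] monom_eval_single[of x i] assms
    monom_eval_closed[of x w] by (simp add: m_comm)

text \<open>Multiplicativity in the point turns each monomial into a character for componentwise
  multiplication of points, as \<open>characters_independent\<close> requires.\<close>

lemma monom_eval_mult:
  assumes "set_mset w \<subseteq> I" "t \<in> I \<rightarrow> carrier R" "v \<in> I \<rightarrow> carrier R"
  shows "monom_eval R w (\<lambda>i\<in>I. t i \<otimes> v i) = monom_eval R w t \<otimes> monom_eval R w v"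
  using assms(1)
proof (induction w)
  case (add i w)
  let ?s = "\<lambda>i\<in>I. t i \<otimes> v i"
  have s: "?s \<in> I \<rightarrow> carrier R" using assms(2,3) by auto
  have c: "f \<in> set_mset w \<rightarrow> carrier R" "f i \<in> carrier R" "monom_eval R w f \<in> carrier R"
    if "f \<in> I \<rightarrow> carrier R" for f
    using that add.prems by (auto intro!: monom_eval_closed)
  show ?case
    using add monom_eval_add_mset[OF c(1,2)[OF s]] monom_eval_add_mset[OF c(1,2)[OF assms(2)]]
      monom_eval_add_mset[OF c(1,2)[OF assms(3)]] c(2,3)[OF assms(2)] c(2,3)[OF assms(3)]
    by (simp add: m_ac)
qed simp

context
  fixes K :: "'a set" assumes K: "subring K R"
begin

private lemma K_subset_carrier: "K \<subseteq> carrier R"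
  by (rule subringE(1)[OF K])

lemma indexed_pset_coeff: "P \<in> indexed_pset I K \<Longrightarrow> carrier_coeff P"
  using indexed_pset_in_carrier[OF K_subset_carrier] .

lemma indexed_pset_smult:
  fixes P :: "'c multiset \<Rightarrow> 'a"
  assumes "k \<in> K" "P \<in> indexed_pset I K"
  shows "(\<lambda>w. k \<otimes> P w) \<in> indexed_pset I K"
  using assms(2)
proof induction
  case (indexed_const l)
  have "(\<lambda>w :: 'c multiset. k \<otimes> indexed_const l w) = indexed_const (k \<otimes> l)"
    using assms(1) K_subset_carrier by (auto simp: indexed_const_def fun_eq_iff)
  then show ?case
    using subringE(6)[OF K] assms(1) indexed_const by (simp add: indexed_pset.indexed_const)
next
  case (indexed_padd P Q)
  have "(\<lambda>w. k \<otimes> (indexed_padd P Q) w) = indexed_padd (\<lambda>w. k \<otimes> P w) (\<lambda>w. k \<otimes> Q w)"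
    using indexed_padd assms(1) K_subset_carrier indexed_pset_coeff[of _ I]
    by (auto simp: indexed_padd_def fun_eq_iff carrier_coeff_def intro!: r_distr)
  then show ?case using indexed_pset.indexed_padd indexed_padd by simp
next
  case (indexed_pmult P i)
  have "(\<lambda>w. k \<otimes> (indexed_pmult P i) w) = indexed_pmult (\<lambda>w. k \<otimes> P w) i"
    using assms(1) K_subset_carrier by (auto simp: indexed_pmult_def fun_eq_iff)
  then show ?case using indexed_pset.indexed_pmult indexed_pmult by simp
qed

lemma indexed_mult_pset:
  assumes "P \<in> indexed_pset I K" "Q \<in> indexed_pset I K"
  shows "indexed_mult R P Q \<in> indexed_pset I K"
  using assms(1)
proof induction
  case (indexed_const k)
  then show ?case
    using indexed_mult_const[of k Q] indexed_pset_coeff[OF assms(2)] K_subset_carrier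
      indexed_pset_smult[OF _ assms(2)] by auto
next
  case (indexed_padd P P')
  then show ?case
    using indexed_mult_padd[of P P' Q] indexed_pset_coeff assms(2)
    by (metis indexed_pset.indexed_padd)
next
  case (indexed_pmult P i)
  then show ?case
    using indexed_mult_pmult[of P Q i] indexed_pset_coeff assms(2)
    by (metis indexed_pset.indexed_pmult)
qed

text \<open>Sums and multiplication by a variable in \<open>P\<close> pass through both sides, so
  only a constant left factor needs a computation: there it is pulled out of the convolution of
  \<open>Q\<close> and \<open>S\<close>.\<close>

lemma indexed_mult_assoc:
  assumes "P \<in> indexed_pset I K" "Q \<in> indexed_pset I K" "S \<in> indexed_pset I K"
  shows "indexed_mult R (indexed_mult R P Q) S = indexed_mult R P (indexed_mult R Q S)"
  using assms(1)
proof induction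
  note cc = indexed_pset_coeff[OF assms(2)] indexed_pset_coeff[OF assms(3)]
    indexed_mult_closed[OF indexed_pset_coeff[OF assms(2)] indexed_pset_coeff[OF assms(3)]]
  {
    case (indexed_const k)
    then have k: "k \<in> carrier R" using K_subset_carrier by auto
    have "indexed_mult R (\<lambda>w. k \<otimes> Q w) S = (\<lambda>w. k \<otimes> indexed_mult R Q S w)"
    proof
      fix w
      have "indexed_mult R (\<lambda>w. k \<otimes> Q w) S w
          = (\<Oplus>u\<in>{u. u \<subseteq># w}. k \<otimes> (Q u \<otimes> S (w - u)))"
        unfolding indexed_mult_def
        by (rule finsum_cong') (use k cc in \<open>auto simp: carrier_coeff_def m_assoc\<close>)
      also have "\<dots> = k \<otimes> indexed_mult R Q S w"
        unfolding indexed_mult_def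
        by (rule finsum_rdistr[symmetric])
           (use k cc in \<open>auto simp: carrier_coeff_def finite_subseteq_mset\<close>)
      finally show "indexed_mult R (\<lambda>w. k \<otimes> Q w) S w = k \<otimes> indexed_mult R Q S w" .
    qed
    then show ?case
      using k cc by (simp add: indexed_mult_const)
  next
    case (indexed_padd P P')
    then show ?case
      using cc indexed_pset_coeff[of _ I]
      by (simp add: indexed_mult_padd indexed_mult_closed)
  next
    case (indexed_pmult P i)
    then show ?case
      using cc indexed_pset_coeff[of _ I]
      by (simp add: indexed_mult_pmult indexed_mult_closed)
  }
qed

lemma mpoly_ring_cring: "cring (mpoly_ring R K I)"
proof (rule cringI)
  note cc = indexed_pset_coeff[of _ I, unfolded carrier_coeff_def, rule_format]
  show "abelian_group (mpoly_ring R K I)"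
  proof (rule abelian_groupI)
    fix P assume P: "P \<in> carrier (mpoly_ring R K I)"
    then have P': "P \<in> indexed_pset I K" by (simp add: mpoly_ring_def)
    \<comment> \<open>\<open>indexed_pset\<close> has no constructor for negation, so the additive
      inverse is taken as a scalar multiple.\<close>
    have "(\<lambda>w. \<ominus> \<one> \<otimes> P w) \<in> indexed_pset I K"
      using indexed_pset_smult[OF _ P', of "\<ominus> \<one>"] subringE(3,5)[OF K] by blast
    moreover have "indexed_padd (\<lambda>w. \<ominus> \<one> \<otimes> P w) P = indexed_const \<zero>"
      using cc[OF P'] by (auto simp: indexed_padd_def indexed_zero_def l_minus l_neg)
    ultimately show "\<exists>y\<in>carrier (mpoly_ring R K I). y \<oplus>\<^bsub>mpoly_ring R K I\<^esub> P = \<zero>\<^bsub>mpoly_ring R K I\<^esub>"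
      by (auto simp: mpoly_ring_def)
  next
    show "\<zero>\<^bsub>mpoly_ring R K I\<^esub> \<in> carrier (mpoly_ring R K I)"
      using indexed_pset.indexed_const[OF subringE(2)[OF K]] by (simp add: mpoly_ring_def)
  qed (use cc in \<open>auto simp: mpoly_ring_def indexed_padd_def fun_eq_iff a_ac indexed_zero_def
        intro: indexed_pset.indexed_padd[unfolded indexed_padd_def]\<close>)
  show "comm_monoid (mpoly_ring R K I)"
  proof (rule comm_monoidI)
    show "\<one>\<^bsub>mpoly_ring R K I\<^esub> \<in> carrier (mpoly_ring R K I)"
      using indexed_pset.indexed_const[OF subringE(3)[OF K]] by (simp add: mpoly_ring_def)
  next
    fix P assume "P \<in> carrier (mpoly_ring R K I)"
    then show "\<one>\<^bsub>mpoly_ring R K I\<^esub> \<otimes>\<^bsub>mpoly_ring R K I\<^esub> P = P"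
      using indexed_mult_const[OF one_closed indexed_pset_coeff] cc
      by (fastforce simp: mpoly_ring_def)
  qed (auto simp: mpoly_ring_def indexed_mult_pset indexed_mult_assoc
        intro: indexed_mult_comm indexed_pset_coeff)
  fix P Q S assume "P \<in> carrier (mpoly_ring R K I)" "Q \<in> carrier (mpoly_ring R K I)"
    "S \<in> carrier (mpoly_ring R K I)"
  then show "(P \<oplus>\<^bsub>mpoly_ring R K I\<^esub> Q) \<otimes>\<^bsub>mpoly_ring R K I\<^esub> S
     = P \<otimes>\<^bsub>mpoly_ring R K I\<^esub> S \<oplus>\<^bsub>mpoly_ring R K I\<^esub> Q \<otimes>\<^bsub>mpoly_ring R K I\<^esub> S"
    by (simp add: mpoly_ring_def indexed_mult_padd indexed_pset_coeff[of _ I])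
qed

text \<open>Finiteness of the support makes the \<open>finsum\<close> in \<open>mpoly_eval\<close> a
  genuine sum; over an infinite set it would be zero by convention.\<close>

lemma indexed_pset_support:
  assumes "P \<in> indexed_pset I K"
  shows "finite {w. P w \<noteq> \<zero>}" and "P w \<noteq> \<zero> \<Longrightarrow> set_mset w \<subseteq> I" and "P w \<in> K"
proof -
  have "finite {w. P w \<noteq> \<zero>} \<and> (\<forall>w. P w \<noteq> \<zero> \<longrightarrow> set_mset w \<subseteq> I) \<and> (\<forall>w. P w \<in> K)"
    using assms
  proof induction
    case (indexed_const k)
    have "{w. indexed_const k w \<noteq> \<zero>} \<subseteq> {{#}}" by (auto simp: indexed_const_def)
    then show ?case
      using finite_subset indexed_const subringE(2)[OF K] by (auto simp: indexed_const_def)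
  next
    case (indexed_padd P Q)
    have "{w. indexed_padd P Q w \<noteq> \<zero>} \<subseteq> {w. P w \<noteq> \<zero>} \<union> {w. Q w \<noteq> \<zero>}"
      by (auto simp: indexed_padd_def)
    moreover have "finite ({w. P w \<noteq> \<zero>} \<union> {w. Q w \<noteq> \<zero>})" using indexed_padd by simp
    ultimately have "finite {w. indexed_padd P Q w \<noteq> \<zero>}" by (rule finite_subset)
    moreover have "indexed_padd P Q w \<noteq> \<zero> \<Longrightarrow> P w \<noteq> \<zero> \<or> Q w \<noteq> \<zero>" for w
      by (auto simp: indexed_padd_def)
    moreover have "indexed_padd P Q w \<in> K" for w
      using indexed_padd subringE(7)[OF K] by (auto simp: indexed_padd_def)
    ultimately show ?case
      using indexed_padd by meson
  next
    case (indexed_pmult P i)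
    have sub: "{w. indexed_pmult P i w \<noteq> \<zero>} \<subseteq> add_mset i ` {w. P w \<noteq> \<zero>}"
    proof
      fix w assume "w \<in> {w. indexed_pmult P i w \<noteq> \<zero>}"
      then have "i \<in># w" "P (w - {#i#}) \<noteq> \<zero>" by (auto simp: indexed_pmult_def split: if_splits)
      then show "w \<in> add_mset i ` {w. P w \<noteq> \<zero>}"
        by (intro image_eqI[of _ _ "w - {#i#}"]) auto
    qed
    moreover have "finite (add_mset i ` {w. P w \<noteq> \<zero>})" using indexed_pmult by simp
    ultimately have "finite {w. indexed_pmult P i w \<noteq> \<zero>}" by (rule finite_subset)
    moreover have "set_mset w \<subseteq> I" if nz: "indexed_pmult P i w \<noteq> \<zero>" for w
    proof -
      obtain u where "w = add_mset i u" "P u \<noteq> \<zero>" using sub nz by blast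
      then show ?thesis using indexed_pmult by simp
    qed
    moreover have "indexed_pmult P i w \<in> K" for w
      using indexed_pmult subringE(2)[OF K] by (auto simp: indexed_pmult_def)
    ultimately show ?case by blast
  qed
  then show "finite {w. P w \<noteq> \<zero>}" and "P w \<noteq> \<zero> \<Longrightarrow> set_mset w \<subseteq> I" and "P w \<in> K" by auto
qed

lemma mpoly_monom_pmult: "indexed_pmult (mpoly_monom R k w) i = mpoly_monom R k (add_mset i w)"
  by (auto simp: mpoly_monom_def indexed_pmult_def fun_eq_iff)

lemma mpoly_monom_pset:
  assumes "k \<in> K" "set_mset w \<subseteq> I"
  shows "mpoly_monom R k w \<in> indexed_pset I K"
  using assms(2)
proof (induction w)
  case empty
  show ?case
    using indexed_pset.indexed_const[OF assms(1)] by (simp add: mpoly_monom_def indexed_const_def)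
next
  case (add i w)
  then show ?case
    using indexed_pset.indexed_pmult[of "mpoly_monom R k w" I K i] by (simp add: mpoly_monom_pmult)
qed

lemma indexed_pset_monom_induct [consumes 1, case_names monom add]:
  fixes P :: "'c multiset \<Rightarrow> 'a"
  assumes "P \<in> indexed_pset I K"
    and monom: "\<And>k w. k \<in> K \<Longrightarrow> set_mset w \<subseteq> I \<Longrightarrow> Q (mpoly_monom R k w)"
    and add: "\<And>P P'. P \<in> indexed_pset I K \<Longrightarrow> P' \<in> indexed_pset I K \<Longrightarrow> Q P \<Longrightarrow> Q P'
      \<Longrightarrow> Q (indexed_padd P P')"
  shows "Q P"
proof -
  \<comment> \<open>Multiplication by a variable is absorbed by proving the claim for all monomial multiples of \<open>P\<close>.\<close>
  have "\<forall>u. set_mset u \<subseteq> I \<longrightarrow> Q ((\<lambda>w. if u \<subseteq># w then P (w - u) else \<zero>))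
     \<and> (\<lambda>w. if u \<subseteq># w then P (w - u) else \<zero>) \<in> indexed_pset I K"
    using assms(1)
  proof induction
    case (indexed_const k)
    have "(\<lambda>w. if u \<subseteq># w then indexed_const k (w - u) else \<zero>) = mpoly_monom R k u" for u :: "'c multiset"
      by (auto simp: indexed_const_def mpoly_monom_def fun_eq_iff)
         (metis subset_mset.diff_add add.left_neutral subset_mset.add_diff_inverse add.right_neutral)+
    then show ?case using monom mpoly_monom_pset indexed_const by auto
  next
    case (indexed_padd P P')
    have "(\<lambda>w. if u \<subseteq># w then indexed_padd P P' (w - u) else \<zero>)
        = indexed_padd (\<lambda>w. if u \<subseteq># w then P (w - u) else \<zero>) (\<lambda>w. if u \<subseteq># w then P' (w - u) else \<zero>)" for u
      by (auto simp: indexed_padd_def)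
    then show ?case using add indexed_padd by (simp add: indexed_pset.indexed_padd)
  next
    case (indexed_pmult P i)
    have "(\<lambda>w. if u \<subseteq># w then indexed_pmult P i (w - u) else \<zero>)
        = (\<lambda>w. if add_mset i u \<subseteq># w then P (w - add_mset i u) else \<zero>)" for u
    proof
      fix w
      have "u \<subseteq># w \<and> i \<in># w - u \<longleftrightarrow> add_mset i u \<subseteq># w"
        by (metis add_mset_add_single mset_subset_eq_add_left single_subset_iff
            subset_mset.dual_order.trans subset_mset.le_diff_conv2 add.commute)
      moreover have "w - u - {#i#} = w - add_mset i u" by simp
      ultimately show "(if u \<subseteq># w then indexed_pmult P i (w - u) else \<zero>)
        = (if add_mset i u \<subseteq># w then P (w - add_mset i u) else \<zero>)"
        by (auto simp: indexed_pmult_def)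
    qed
    then show ?case using indexed_pmult by simp
  qed
  from this[rule_format, of "{#}"] show ?thesis by simp
qed

lemma indexed_mult_var:
  fixes P :: "'c multiset \<Rightarrow> 'a"
  assumes "P \<in> indexed_pset I K"
  shows "indexed_mult R P (indexed_var i) = indexed_pmult P i"
proof -
  have c1: "carrier_coeff (indexed_const \<one> :: 'c multiset \<Rightarrow> 'a)"
    by (simp add: carrier_coeff_def indexed_const_def)
  have "indexed_mult R (indexed_var i) P = indexed_pmult P i"
    using indexed_pset_coeff[OF assms]
    by (simp add: indexed_var_def indexed_mult_pmult indexed_mult_const c1)
       (simp add: carrier_coeff_def)
  then show ?thesis
    using indexed_mult_comm[of P "indexed_var i"] indexed_pset_coeff[OF assms]
      indexed_pmult_in_carrier[OF c1] by (simp add: indexed_var_def)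
qed

lemma indexed_var_pset: "i \<in> I \<Longrightarrow> indexed_var i \<in> indexed_pset I K"
  unfolding indexed_var_def
  by (intro indexed_pset.indexed_pmult indexed_pset.indexed_const subringE(3)[OF K])

text \<open>Used to write a monomial times \<open>X_i^d - 1\<close> as a difference of two
  monomials, which is what lowers exponents modulo the ideal.\<close>

lemma mpoly_monom_mult_var_pow:
  assumes "k \<in> K" "set_mset w \<subseteq> I" "i \<in> I"
  shows "mpoly_monom R k w \<otimes>\<^bsub>mpoly_ring R K I\<^esub> indexed_var i [^]\<^bsub>mpoly_ring R K I\<^esub> (d::nat)
    = mpoly_monom R k (w + replicate_mset d i)"
proof -
  interpret P: cring "mpoly_ring R K I" by (rule mpoly_ring_cring)
  have m: "mpoly_monom R k w \<in> carrier (mpoly_ring R K I)" "indexed_var i \<in> carrier (mpoly_ring R K I)"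
    using mpoly_monom_pset[OF assms(1,2)] indexed_var_pset[OF assms(3)] by (auto simp: mpoly_ring_def)
  show ?thesis
  proof (induction d)
    case 0
    then show ?case using m by simp
  next
    case (Suc d)
    have "mpoly_monom R k w \<otimes>\<^bsub>mpoly_ring R K I\<^esub> indexed_var i [^]\<^bsub>mpoly_ring R K I\<^esub> Suc d
      = mpoly_monom R k (w + replicate_mset d i) \<otimes>\<^bsub>mpoly_ring R K I\<^esub> indexed_var i"
      using m Suc by (simp flip: P.m_assoc)
    also have "\<dots> = indexed_mult R (mpoly_monom R k (w + replicate_mset d i)) (indexed_var i)"
      by (simp add: mpoly_ring_def)
    also have "\<dots> = mpoly_monom R k (w + replicate_mset (Suc d) i)"
      by (subst indexed_mult_var[of _ I])
         (use assms mpoly_monom_pset[of k "w + replicate_mset d i" I] in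
          \<open>auto simp: mpoly_monom_pmult split: if_splits\<close>)
    finally show ?case .
  qed
qed

section \<open>Evaluation as a ring homomorphism\<close>

lemma mpoly_eval_superset:
  assumes "P \<in> indexed_pset I K" "x \<in> I \<rightarrow> carrier R" "finite A" "{w. P w \<noteq> \<zero>} \<subseteq> A"
    "\<And>w. w \<in> A \<Longrightarrow> set_mset w \<subseteq> I"
  shows "mpoly_eval R P x = (\<Oplus>w\<in>A. P w \<otimes> monom_eval R w x)"
proof -
  have c: "P w \<in> carrier R" for w using indexed_pset_support(3)[OF assms(1)] K_subset_carrier by auto
  have m: "monom_eval R w x \<in> carrier R" if "w \<in> A" for w
    using assms(2,5) that by (intro monom_eval_closed) auto
  show ?thesis
    unfolding mpoly_eval_def monom_eval_def[symmetric]
    by (rule add.finprod_mono_neutral_cong_left)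
       (use assms c m in auto)
qed

lemma mpoly_eval_closed:
  assumes "P \<in> indexed_pset I K" "x \<in> I \<rightarrow> carrier R"
  shows "mpoly_eval R P x \<in> carrier R"
proof -
  have "P w \<in> carrier R" for w using indexed_pset_support(3)[OF assms(1)] K_subset_carrier by auto
  moreover have "monom_eval R w x \<in> carrier R" if "P w \<noteq> \<zero>" for w
    using assms(2) indexed_pset_support(2)[OF assms(1) that] by (intro monom_eval_closed) auto
  ultimately show ?thesis
    unfolding mpoly_eval_def monom_eval_def[symmetric] by (auto intro!: finsum_closed)
qed

lemma mpoly_eval_const:
  fixes x :: "'c \<Rightarrow> 'a"
  assumes "k \<in> K"
  shows "mpoly_eval R (indexed_const k) x = k"
proof -
  have k: "k \<in> carrier R" using assms K_subset_carrier by auto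
  have "{w :: 'c multiset. indexed_const k w \<noteq> \<zero>} = (if k = \<zero> then {} else {{#}})"
    by (auto simp: indexed_const_def)
  then show ?thesis
    using k by (simp add: mpoly_eval_def indexed_const_def)
qed

lemma mpoly_eval_padd:
  assumes "P \<in> indexed_pset I K" "Q \<in> indexed_pset I K" "x \<in> I \<rightarrow> carrier R"
  shows "mpoly_eval R (indexed_padd P Q) x = mpoly_eval R P x \<oplus> mpoly_eval R Q x"
proof -
  let ?A = "{w. P w \<noteq> \<zero>} \<union> {w. Q w \<noteq> \<zero>}"
  have c: "P w \<in> carrier R" "Q w \<in> carrier R" for w
    using indexed_pset_support(3)[OF assms(1)] indexed_pset_support(3)[OF assms(2)] K_subset_carrier by auto
  have A: "finite ?A" "\<And>w. w \<in> ?A \<Longrightarrow> set_mset w \<subseteq> I"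
    using indexed_pset_support[OF assms(1)] indexed_pset_support[OF assms(2)] by auto
  have m: "monom_eval R w x \<in> carrier R" if "w \<in> ?A" for w
    using A(2)[OF that] assms(3) by (intro monom_eval_closed) auto
  have "mpoly_eval R (indexed_padd P Q) x = (\<Oplus>w\<in>?A. indexed_padd P Q w \<otimes> monom_eval R w x)"
    using A by (intro mpoly_eval_superset[of _ I] indexed_pset.indexed_padd assms)
      (auto simp: indexed_padd_def)
  also have "\<dots> = (\<Oplus>w\<in>?A. P w \<otimes> monom_eval R w x \<oplus> Q w \<otimes> monom_eval R w x)"
    by (rule finsum_cong') (use c m in \<open>auto simp: indexed_padd_def l_distr\<close>)
  also have "\<dots> = (\<Oplus>w\<in>?A. P w \<otimes> monom_eval R w x) \<oplus> (\<Oplus>w\<in>?A. Q w \<otimes> monom_eval R w x)"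
    by (rule finsum_addf) (use c m in auto)
  also have "\<dots> = mpoly_eval R P x \<oplus> mpoly_eval R Q x"
    using A mpoly_eval_superset[OF assms(1,3), of ?A] mpoly_eval_superset[OF assms(2,3), of ?A] by auto
  finally show ?thesis .
qed

lemma mpoly_eval_pmult:
  assumes "P \<in> indexed_pset I K" "i \<in> I" "x \<in> I \<rightarrow> carrier R"
  shows "mpoly_eval R (indexed_pmult P i) x = mpoly_eval R P x \<otimes> x i"
proof -
  let ?A = "{w. P w \<noteq> \<zero>}"
  have c: "P w \<in> carrier R" for w using indexed_pset_support(3)[OF assms(1)] K_subset_carrier by auto
  have xi: "x i \<in> carrier R" using assms by auto
  have s: "set_mset w \<subseteq> I" if "w \<in> ?A" for w
    using indexed_pset_support(2)[OF assms(1)] that by auto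
  have m: "monom_eval R w x \<in> carrier R" if "w \<in> ?A" for w
    using s[OF that] assms(3) by (intro monom_eval_closed) auto
  have ma: "monom_eval R (add_mset i w) x = monom_eval R w x \<otimes> x i" if "w \<in> ?A" for w
    using monom_eval_add[of x w "{#i#}"] s[OF that] assms(3) xi monom_eval_single[of x i] by auto
  have "mpoly_eval R (indexed_pmult P i) x
      = (\<Oplus>w\<in>add_mset i ` ?A. indexed_pmult P i w \<otimes> monom_eval R w x)"
  proof (rule mpoly_eval_superset[of _ I])
    show "{w. indexed_pmult P i w \<noteq> \<zero>} \<subseteq> add_mset i ` ?A"
    proof
      fix w assume "w \<in> {w. indexed_pmult P i w \<noteq> \<zero>}"
      then have "i \<in># w" "P (w - {#i#}) \<noteq> \<zero>" by (auto simp: indexed_pmult_def split: if_splits)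
      then show "w \<in> add_mset i ` ?A"
        by (intro image_eqI[of _ _ "w - {#i#}"]) auto
    qed
  next
    fix w assume "w \<in> add_mset i ` ?A"
    then show "set_mset w \<subseteq> I" using s assms(2) by fastforce
  qed (use assms indexed_pset_support(1)[OF assms(1)] in \<open>auto intro: indexed_pset.indexed_pmult\<close>)
  also have "\<dots> = (\<Oplus>w\<in>?A. indexed_pmult P i (add_mset i w) \<otimes> monom_eval R (add_mset i w) x)"
    by (rule finsum_reindex) (use c m ma xi in \<open>auto simp: indexed_pmult_def inj_on_def\<close>)
  also have "\<dots> = (\<Oplus>w\<in>?A. (P w \<otimes> monom_eval R w x) \<otimes> x i)"
    by (rule finsum_cong') (use c m ma xi in \<open>auto simp: indexed_pmult_def m_assoc\<close>)
  also have "\<dots> = (\<Oplus>w\<in>?A. P w \<otimes> monom_eval R w x) \<otimes> x i"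
    by (rule finsum_ldistr[symmetric]) (use c m xi indexed_pset_support(1)[OF assms(1)] in auto)
  also have "(\<Oplus>w\<in>?A. P w \<otimes> monom_eval R w x) = mpoly_eval R P x"
    by (simp add: mpoly_eval_def monom_eval_def)
  finally show ?thesis .
qed

lemma mpoly_eval_mult:
  assumes "P \<in> indexed_pset I K" "Q \<in> indexed_pset I K" "x \<in> I \<rightarrow> carrier R"
  shows "mpoly_eval R (indexed_mult R P Q) x = mpoly_eval R P x \<otimes> mpoly_eval R Q x"
  using assms(1)
proof induction
  case (indexed_const k)
  have k: "k \<in> carrier R" using indexed_const K_subset_carrier by auto
  have Qc: "Q w \<in> carrier R" for w using indexed_pset_support(3)[OF assms(2)] K_subset_carrier by auto
  let ?A = "{w. Q w \<noteq> \<zero>}"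
  have s: "set_mset w \<subseteq> I" if "w \<in> ?A" for w
    using indexed_pset_support(2)[OF assms(2)] that by auto
  have m: "monom_eval R w x \<in> carrier R" if "w \<in> ?A" for w
    using s[OF that] assms(3) by (intro monom_eval_closed) auto
  have "mpoly_eval R (\<lambda>w. k \<otimes> Q w) x = (\<Oplus>w\<in>?A. (k \<otimes> Q w) \<otimes> monom_eval R w x)"
    by (rule mpoly_eval_superset[of _ I])
       (use assms k s indexed_pset_support(1)[OF assms(2)] indexed_pset_smult[OF indexed_const assms(2)] in auto)
  also have "\<dots> = (\<Oplus>w\<in>?A. k \<otimes> (Q w \<otimes> monom_eval R w x))"
    by (rule finsum_cong') (use k Qc m in \<open>auto simp: m_assoc\<close>)
  also have "\<dots> = k \<otimes> (\<Oplus>w\<in>?A. Q w \<otimes> monom_eval R w x)"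
    by (rule finsum_rdistr[symmetric]) (use k Qc m indexed_pset_support(1)[OF assms(2)] in auto)
  also have "\<dots> = k \<otimes> mpoly_eval R Q x"
    by (simp add: mpoly_eval_def monom_eval_def)
  finally show ?case
    using k indexed_pset_coeff[OF assms(2)]
    by (simp add: indexed_mult_const mpoly_eval_const[OF indexed_const])
next
  case (indexed_padd P P')
  then show ?case
    using assms(2,3)
    by (simp add: indexed_mult_padd indexed_pset_coeff[of _ I] mpoly_eval_padd[of _ I] indexed_mult_pset
        l_distr mpoly_eval_closed[of _ I])
next
  case (indexed_pmult P i)
  have "x i \<in> carrier R" using assms(3) indexed_pmult by auto
  then show ?case
    using assms(2,3) indexed_pmult
    by (simp add: indexed_mult_pmult indexed_pset_coeff[of _ I] mpoly_eval_pmult[of _ I] indexed_mult_pset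
        m_ac mpoly_eval_closed[of _ I])
qed

lemma mpoly_eval_ring_hom:
  assumes "x \<in> I \<rightarrow> carrier R"
  shows "ring_hom_cring (mpoly_ring R K I) R (\<lambda>P. mpoly_eval R P x)"
proof (intro ring_hom_cringI[OF mpoly_ring_cring is_cring] ring_hom_memI)
  show "mpoly_eval R \<one>\<^bsub>mpoly_ring R K I\<^esub> x = \<one>"
    using mpoly_eval_const[OF subringE(3)[OF K]] by (simp add: mpoly_ring_def)
qed (auto simp: mpoly_ring_def assms mpoly_eval_closed[of _ I] mpoly_eval_mult[of _ I] mpoly_eval_padd[of _ I])

lemma mpoly_eval_var:
  assumes "x \<in> I \<rightarrow> carrier R" "i \<in> I"
  shows "mpoly_eval R (indexed_var i) x = x i"
  unfolding indexed_var_def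
  using mpoly_eval_pmult[OF indexed_pset.indexed_const[OF subringE(3)[OF K]] assms(2,1)]
    mpoly_eval_const[OF subringE(3)[OF K], of x] assms by (auto simp: Pi_iff)

lemma mpoly_eval_in_subring:
  assumes "subring F R" "K \<subseteq> F" "x \<in> I \<rightarrow> F" "P \<in> indexed_pset I K"
  shows "mpoly_eval R P x \<in> F"
proof -
  have x: "x \<in> I \<rightarrow> carrier R" using assms(3) subringE(1)[OF assms(1)] by auto
  show ?thesis
    using assms(4)
  proof induction
    case (indexed_const k)
    then show ?case using assms(2) by (auto simp: mpoly_eval_const)
  next
    case (indexed_padd P Q)
    then show ?case using mpoly_eval_padd[OF _ _ x] subringE(7)[OF assms(1)] by metis
  next
    case (indexed_pmult P i)
    then show ?case using mpoly_eval_pmult[OF _ _ x] subringE(6)[OF assms(1)] assms(3) by (metis PiE)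
  qed
qed

text \<open>The coefficients are fixed by \<open>h\<close>, so only the coordinates move. The domain
  of \<open>h\<close> is a subring because a Galois automorphism is defined only on its field; the
  restriction to \<open>I\<close> keeps the image point extensional.\<close>

lemma mpoly_eval_hom_commute:
  assumes F: "subring F R" "K \<subseteq> F" and x: "x \<in> I \<rightarrow> F"
    and h: "h \<in> ring_hom (R\<lparr>carrier := F\<rparr>) R" "\<And>k. k \<in> K \<Longrightarrow> h k = k"
    and P: "P \<in> indexed_pset I K"
  shows "mpoly_eval R P (\<lambda>i\<in>I. h (x i)) = h (mpoly_eval R P x)"
proof -
  have xc: "x \<in> I \<rightarrow> carrier R" using x subringE(1)[OF F(1)] by auto
  define y where "y = (\<lambda>i\<in>I. h (x i))"
  have sc: "y \<in> I \<rightarrow> carrier R" using x ring_hom_closed[OF h(1)] by (auto simp: y_def)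
  have yi: "y i = h (x i)" if "i \<in> I" for i using that by (simp add: y_def)
  have "mpoly_eval R P y = h (mpoly_eval R P x)"
    using P
  proof induction
    case (indexed_const k)
    then show ?case by (simp add: mpoly_eval_const h(2))
  next
    case (indexed_padd P Q)
    then show ?case
      using mpoly_eval_in_subring[OF F x] ring_hom_add[OF h(1)]
      by (simp add: mpoly_eval_padd[OF _ _ xc] mpoly_eval_padd[OF _ _ sc])
  next
    case (indexed_pmult P i)
    then show ?case
      using mpoly_eval_in_subring[OF F x, of P] ring_hom_mult[OF h(1), of "mpoly_eval R P x" "x i"]
        funcset_mem[OF x]
      by (auto simp add: mpoly_eval_pmult[OF _ _ xc] mpoly_eval_pmult[OF _ _ sc] yi)
  qed
  then show ?thesis by (simp add: y_def)
qed

end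

end

lemma (in domain) monom_eval_nonzero:
  assumes "set_mset w \<subseteq> I" "v \<in> I \<rightarrow> carrier R - {\<zero>}"
  shows "monom_eval R w v \<in> carrier R - {\<zero>}"
  using assms(1)
proof (induction w)
  case (add i w)
  have "v \<in> set_mset w \<rightarrow> carrier R" "v i \<in> carrier R - {\<zero>}" using add.prems assms(2) by auto
  then show ?case using add monom_eval_add_mset[of v w i] by (auto simp: integral_iff)
qed simp

section \<open>Roots of unity and their automorphisms\<close>

lemma (in cring) binomial_expansion:
  assumes "x \<in> carrier R" "y \<in> carrier R"
  shows "(x \<oplus> y) [^] (n::nat) = (\<Oplus>k\<in>{..n}. [(n choose k)] \<cdot> (x [^] k \<otimes> y [^] (n - k)))"
proof (induction n)
  case 0
  show ?case using assms by simp
next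
  case (Suc n)
  let ?t = "\<lambda>i j. x [^] (i::nat) \<otimes> y [^] (j::nat)"
  have t: "?t i j \<in> carrier R" "[c] \<cdot> ?t i j \<in> carrier R" for i j c :: nat using assms by auto
  \<comment> \<open>The binomial coefficient vanishes at \<open>k = n + 1\<close>, so the sum may be
    extended by that index before its term at \<open>k = 0\<close> is split off. Pascal's rule then
    matches the result with \<open>head\<close>.\<close>
  have shift: "(\<Oplus>k\<in>{..n}. [(n choose k)] \<cdot> ?t k (n - k)) \<otimes> y
      = (\<Oplus>k\<in>{..n}. [(n choose Suc k)] \<cdot> ?t (Suc k) (n - k)) \<oplus> ?t 0 (Suc n)"
  proof -
    have "(\<Oplus>k\<in>{..n}. [(n choose k)] \<cdot> ?t k (n - k)) \<otimes> y
        = (\<Oplus>k\<in>{..n}. [(n choose k)] \<cdot> ?t k (n - k) \<otimes> y)"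
      by (rule finsum_ldistr) (use assms t in auto)
    also have "\<dots> = (\<Oplus>k\<in>{..n}. [(n choose k)] \<cdot> ?t k (Suc n - k))"
    proof (rule finsum_cong')
      fix k assume "k \<in> {..n}"
      then have e: "Suc n - k = Suc (n - k)" by auto
      show "[(n choose k)] \<cdot> ?t k (n - k) \<otimes> y = [(n choose k)] \<cdot> ?t k (Suc n - k)"
        unfolding e using assms by (simp add: add_pow_ldistr m_assoc)
    qed (use t in auto)
    also have "\<dots> = (\<Oplus>k\<in>{..Suc n}. [(n choose k)] \<cdot> ?t k (Suc n - k))"
      using assms t by (subst finsum_Suc) (auto simp: binomial_eq_0)
    also have "\<dots> = (\<Oplus>k\<in>{..n}. [(n choose Suc k)] \<cdot> ?t (Suc k) (Suc n - Suc k)) \<oplus> [(n choose 0)] \<cdot> ?t 0 (Suc n - 0)"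
      by (rule finsum_Suc2) (use t in auto)
    finally show ?thesis using assms by simp
  qed
  have head: "(\<Oplus>k\<in>{..n}. [(n choose k)] \<cdot> ?t k (n - k)) \<otimes> x
        = (\<Oplus>k\<in>{..n}. [(n choose k)] \<cdot> ?t (Suc k) (n - k))"
  proof -
    have "(\<Oplus>k\<in>{..n}. [(n choose k)] \<cdot> ?t k (n - k)) \<otimes> x
        = (\<Oplus>k\<in>{..n}. [(n choose k)] \<cdot> ?t k (n - k) \<otimes> x)"
      by (rule finsum_ldistr) (use assms t in auto)
    also have "\<dots> = (\<Oplus>k\<in>{..n}. [(n choose k)] \<cdot> ?t (Suc k) (n - k))"
      by (rule finsum_cong') (use assms in \<open>auto simp: add_pow_ldistr add_pow_rdistr m_ac\<close>)
    finally show ?thesis .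
  qed
  have "(x \<oplus> y) [^] Suc n = (\<Oplus>k\<in>{..n}. [(n choose k)] \<cdot> ?t k (n - k)) \<otimes> (x \<oplus> y)"
    using Suc by simp
  also have "\<dots> = (\<Oplus>k\<in>{..n}. [(n choose k)] \<cdot> ?t (Suc k) (n - k))
      \<oplus> ((\<Oplus>k\<in>{..n}. [(n choose Suc k)] \<cdot> ?t (Suc k) (n - k)) \<oplus> ?t 0 (Suc n))"
    using assms by (simp add: r_distr shift head finsum_closed)
  also have "\<dots> = (\<Oplus>k\<in>{..n}. [(n choose k)] \<cdot> ?t (Suc k) (n - k))
      \<oplus> (\<Oplus>k\<in>{..n}. [(n choose Suc k)] \<cdot> ?t (Suc k) (n - k)) \<oplus> ?t 0 (Suc n)"
    by (rule a_assoc[symmetric]) (use assms in \<open>auto intro!: finsum_closed simp del: nat_pow_Suc\<close>)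
  also have "\<dots> = (\<Oplus>k\<in>{..n}. [(n choose k)] \<cdot> ?t (Suc k) (n - k) \<oplus> [(n choose Suc k)] \<cdot> ?t (Suc k) (n - k))
      \<oplus> ?t 0 (Suc n)"
    by (subst finsum_addf) (use assms in \<open>auto simp del: nat_pow_Suc\<close>)
  also have "\<dots> = (\<Oplus>k\<in>{..n}. [(Suc n choose Suc k)] \<cdot> ?t (Suc k) (Suc n - Suc k)) \<oplus> [(Suc n choose 0)] \<cdot> ?t 0 (Suc n - 0)"
    using assms by (simp add: add.nat_pow_mult)
  also have "\<dots> = (\<Oplus>k\<in>{..Suc n}. [(Suc n choose k)] \<cdot> ?t k (Suc n - k))"
    by (rule finsum_Suc2[symmetric]) (use assms in auto)
  finally show ?case .
qed

lemma (in cring) add_pow_dvd_zero: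
  assumes "[(p::nat)] \<cdot> \<one> = \<zero>" "p dvd c" "x \<in> carrier R"
  shows "[c] \<cdot> x = \<zero>"
proof -
  obtain q where c: "c = p * q" using assms(2) by auto
  have "[c] \<cdot> \<one> = [q] \<cdot> ([p] \<cdot> \<one>)" unfolding c by (simp add: add.nat_pow_pow mult.commute)
  then have "[c] \<cdot> \<one> = \<zero>" by (simp add: assms(1))
  moreover have "[c] \<cdot> x = [c] \<cdot> \<one> \<otimes> x" using assms(3) by (simp add: add_pow_ldistr)
  ultimately show ?thesis using assms(3) by simp
qed

lemma (in cring) frobenius_add:
  assumes "x \<in> carrier R" "y \<in> carrier R" "Factorial_Ring.prime p" "[(p::nat)] \<cdot> \<one> = \<zero>"
  shows "(x \<oplus> y) [^] p = x [^] p \<oplus> y [^] p"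
proof -
  let ?t = "\<lambda>k. [(p choose k)] \<cdot> (x [^] k \<otimes> y [^] (p - k))"
  have p: "p > 1" using assms(3) prime_gt_1_nat by auto
  have t: "?t k \<in> carrier R" for k using assms by auto
  have "(x \<oplus> y) [^] p = (\<Oplus>k\<in>{..p}. ?t k)"
    by (rule binomial_expansion[OF assms(1,2)])
  also have "\<dots> = (\<Oplus>k\<in>{0, p}. ?t k)"
  proof (rule add.finprod_mono_neutral_cong_right)
    fix k assume "k \<in> {..p} - {0, p}"
    then have "p dvd (p choose k)"
      by (intro dvd_choose_prime) (use assms in auto)
    then show "?t k = \<zero>"
      using add_pow_dvd_zero[OF assms(4)] assms by simp
  qed (use t in auto)
  also have "\<dots> = x [^] p \<oplus> y [^] p"
    using p assms by (simp add: a_comm)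
  finally show ?thesis .
qed

section \<open>Finite groups of roots of unity\<close>

lemma (in comm_group) ord_mult_coprime:
  assumes "a \<in> carrier G" "b \<in> carrier G" "coprime (ord a) (ord b)"
  shows "ord (a \<otimes> b) = ord a * ord b"
proof (rule dvd_antisym)
  show "ord (a \<otimes> b) dvd ord a * ord b" by (rule abelian_ord_mul_divides[OF assms(1,2)])
  let ?n = "ord (a \<otimes> b)"
  have e: "a [^] ?n \<otimes> b [^] ?n = \<one>"
    using pow_ord_eq_1[OF m_closed[OF assms(1,2)]] assms
    by (metis m_comm pow_mult_distrib)
  \<comment> \<open>Raising \<open>e\<close> to the power \<open>ord b\<close> kills the factor from
    \<open>b\<close>, so \<open>ord a\<close> divides \<open>?n * ord b\<close>; coprimality then
    removes \<open>ord b\<close>. The argument for \<open>b\<close> is symmetric.\<close>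
  have "a [^] (?n * ord b) = (a [^] ?n \<otimes> b [^] ?n) [^] ord b"
    using assms by (subst pow_mult_distrib) (auto simp: m_comm nat_pow_pow mult.commute pow_eq_id)
  then have "ord a dvd ?n * ord b" using e assms by (simp add: pow_eq_id)
  moreover have "b [^] (?n * ord a) = (a [^] ?n \<otimes> b [^] ?n) [^] ord a"
    using assms by (subst pow_mult_distrib) (auto simp: m_comm nat_pow_pow mult.commute pow_eq_id)
  then have "ord b dvd ?n * ord a" using e assms by (simp add: pow_eq_id)
  ultimately have "ord a dvd ?n" "ord b dvd ?n"
    using coprime_dvd_mult_left_iff[OF assms(3)] coprime_dvd_mult_left_iff[of "ord b" "ord a"] assms(3)
    by (auto simp: coprime_commute[of "ord b" "ord a"])
  then show "ord a * ord b dvd ?n" using assms(3) by (rule divides_mult)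
qed

context field
begin

lemma card_eval_roots_le:
  assumes "p \<in> carrier (poly_ring R)" "p \<noteq> []"
  shows "finite {x \<in> carrier R. eval p x = \<zero>}" "card {x \<in> carrier R. eval p x = \<zero>} \<le> degree p"
proof -
  have "{x \<in> carrier R. eval p x = \<zero>} = set_mset (roots p)"
    using roots_mem_iff_is_root[OF assms(1)] assms(2) unfolding is_root_def by auto
  moreover have "card (set_mset (roots p)) \<le> size (roots p)"
    by (simp add: size_multiset_overloaded_eq sum_mono[of _ "\<lambda>_. 1" "count (roots p)", simplified] Suc_le_eq)
  ultimately show "finite {x \<in> carrier R. eval p x = \<zero>}" "card {x \<in> carrier R. eval p x = \<zero>} \<le> degree p"
    using size_roots_le_degree[OF assms(1)] by auto
qed

context
  fixes K assumes K: "subfield K R"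
begin

definition unity_poly :: "nat \<Rightarrow> 'a list"
  where "unity_poly d = X [^]\<^bsub>K[X]\<^esub> d \<ominus>\<^bsub>K[X]\<^esub> \<one>\<^bsub>K[X]\<^esub>"

lemma unity_poly:
  assumes "d > 0"
  shows "unity_poly d \<in> carrier (K[X])" "degree (unity_poly d) = d" "unity_poly d \<noteq> []"
    "\<And>x. x \<in> carrier R \<Longrightarrow> eval (unity_poly d) x = x [^] d \<ominus> \<one>"
proof -
  interpret P: domain "K[X]" using univ_poly_is_domain[OF subfieldE(1)[OF K]] .
  have X: "X \<in> carrier (K[X])" using var_closed(1)[OF subfieldE(1)[OF K]] .
  show c: "unity_poly d \<in> carrier (K[X])" using X by (simp add: unity_poly_def)
  have "degree (X [^]\<^bsub>K[X]\<^esub> d) = d"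
    using subring_polynomial_pow_degree[OF subfieldE(1)[OF K] X] by (simp add: var_def)
  moreover have "degree (\<ominus>\<^bsub>K[X]\<^esub> \<one>\<^bsub>K[X]\<^esub>) = 0"
    using univ_poly_a_inv_degree[OF subfieldE(1)[OF K] P.one_closed] by (simp add: univ_poly_one)
  moreover have "polynomial K (X [^]\<^bsub>K[X]\<^esub> d)" "polynomial K (\<ominus>\<^bsub>K[X]\<^esub> \<one>\<^bsub>K[X]\<^esub>)"
    using X by (auto simp: univ_poly_carrier)
  ultimately show deg: "degree (unity_poly d) = d"
    using poly_add_degree_eq[OF subfieldE(1)[OF K], of "X [^]\<^bsub>K[X]\<^esub> d" "\<ominus>\<^bsub>K[X]\<^esub> \<one>\<^bsub>K[X]\<^esub>"] assms
    by (simp add: unity_poly_def a_minus_def univ_poly_add)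
  show "unity_poly d \<noteq> []" using deg assms by auto
  fix x assume x: "x \<in> carrier R"
  interpret E: ring_hom_cring "K[X]" R "\<lambda>p. eval p x"
    using eval_cring_hom[OF subfieldE(1)[OF K] x] .
  show "eval (unity_poly d) x = x [^] d \<ominus> \<one>"
    using X eval_var[OF x] by (simp add: unity_poly_def a_minus_def E.hom_pow)
qed

end

lemma card_unity_roots_le:
  assumes "d > 0"
  shows "finite {z \<in> carrier R. z [^] (d::nat) = \<one>}" "card {z \<in> carrier R. z [^] d = \<one>} \<le> d"
proof -
  note u = unity_poly[OF carrier_is_subfield assms]
  have "{z \<in> carrier R. z [^] d = \<one>} = {z \<in> carrier R. eval (unity_poly (carrier R) d) z = \<zero>}"
    using u(4) by auto
  then show "finite {z \<in> carrier R. z [^] (d::nat) = \<one>}" "card {z \<in> carrier R. z [^] d = \<one>} \<le> d"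
    using card_eval_roots_le[OF u(1) u(3)] u(2) by auto
qed

text \<open>The rewrites express powers, products and the unit in \<open>R\<close> itself, so that
  only orders of elements still refer to the multiplicative group.\<close>

interpretation unit: comm_group "Multiplicative_Group.mult_of R"
  rewrites "([^]\<^bsub>Multiplicative_Group.mult_of R\<^esub>) = (([^]) :: _ \<Rightarrow> nat \<Rightarrow> _)" and "\<one>\<^bsub>Multiplicative_Group.mult_of R\<^esub> = \<one>"
    and "monoid.mult (Multiplicative_Group.mult_of R) = monoid.mult R" and "carrier (Multiplicative_Group.mult_of R) = carrier R - {\<zero>}"
proof -
  interpret group "Multiplicative_Group.mult_of R" by (rule field_mult_group)
  show "comm_group (Multiplicative_Group.mult_of R)" by (rule group_comm_groupI) (auto simp: m_comm)
qed (simp_all add: Multiplicative_Group.nat_pow_mult_of)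

lemma root_of_unity_nonzero:
  assumes "z \<in> carrier R" "z [^] (N::nat) = \<one>" "N > 0"
  shows "z \<in> carrier R - {\<zero>}"
  using assms by (auto simp: nat_pow_zero)

text \<open>The \<open>d\<close> powers of \<open>z\<close> are distinct roots of
  \<open>X^d - 1\<close>, which has at most \<open>d\<close> roots. Taking \<open>d\<close> to be
  the order of \<open>z\<close>, and not \<open>N\<close>, makes this true in every
  characteristic.\<close>

lemma unity_roots_eq_powers:
  assumes "z \<in> carrier R" "z [^] (N::nat) = \<one>" "N > 0"
  defines "d \<equiv> group.ord (Multiplicative_Group.mult_of R) z"
  shows "d > 0" "z [^] d = \<one>" "{x \<in> carrier R. x [^] d = \<one>} = (\<lambda>k. z [^] k) ` {..<d}"
    "card {x \<in> carrier R. x [^] d = \<one>} = d"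
proof -
  have z: "z \<in> carrier R - {\<zero>}" using root_of_unity_nonzero[OF assms(1-3)] .
  show d: "d > 0" using unit.ord_eq_0[OF z] assms(2,3) by (auto simp: d_def)
  show zd: "z [^] d = \<one>" using unit.pow_ord_eq_1[OF z] by (simp add: d_def)
  have sub: "(\<lambda>k. z [^] k) ` {..<d} \<subseteq> {x \<in> carrier R. x [^] d = \<one>}"
  proof clarify
    fix k :: nat
    have "(z [^] k) [^] d = (z [^] d) [^] k" using assms(1) by (simp add: nat_pow_pow mult.commute)
    then show "z [^] k \<in> carrier R \<and> (z [^] k) [^] d = \<one>" using assms(1) zd by simp
  qed
  have "{..<d} = {0..d - 1}" using d by auto
  then have inj: "inj_on (\<lambda>k. z [^] k) {..<d}"
    using unit.ord_inj[OF z] by (simp add: d_def)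
  show eq: "{x \<in> carrier R. x [^] d = \<one>} = (\<lambda>k. z [^] k) ` {..<d}"
    using card_seteq[OF card_unity_roots_le(1)[OF d] sub] card_unity_roots_le(2)[OF d]
    by (simp add: card_image[OF inj])
  show "card {x \<in> carrier R. x [^] d = \<one>} = d"
    unfolding eq by (simp add: card_image[OF inj])
qed

text \<open>The generator is an element \<open>a\<close> of maximal order: if a prime had a higher power in the order of
  some \<open>b\<close> than in that of \<open>a\<close>, a product of a power of \<open>a\<close> and one of \<open>b\<close> would have larger order.\<close>

lemma unity_subgroup_cyclic:
  assumes H: "H \<subseteq> {z \<in> carrier R. z [^] (N::nat) = \<one>}" "N > 0" "\<one> \<in> H"
    and mult: "\<And>x y. x \<in> H \<Longrightarrow> y \<in> H \<Longrightarrow> x \<otimes> y \<in> H"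
  obtains a where "a \<in> H" "\<And>b. b \<in> H \<Longrightarrow> \<exists>k::nat. b = a [^] k"
proof -
  let ?ord = "group.ord (Multiplicative_Group.mult_of R)"
  have fin: "finite H" using finite_subset[OF H(1) card_unity_roots_le(1)[OF H(2)]] .
  have Hc: "x \<in> carrier R" "x [^] N = \<one>" "x \<in> carrier R - {\<zero>}" if "x \<in> H" for x
    using H(1,2) that root_of_unity_nonzero by blast+
  have pow: "x [^] (k::nat) \<in> H" if "x \<in> H" for x k
    by (induction k) (use H(3) mult that in auto)
  have ord_pos: "?ord x > 0" if "x \<in> H" for x
    using unity_roots_eq_powers(1)[OF Hc(1,2)[OF that] H(2)] .
  obtain a where a: "a \<in> H" "\<And>x. x \<in> H \<Longrightarrow> ?ord x \<le> ?ord a"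
    using obtains_MAX[OF fin, of ?ord] H(3) Max_ge[of "?ord ` H"] fin by (metis empty_iff finite_imageI imageI)
  have "?ord b dvd ?ord a" if b: "b \<in> H" for b
  proof (rule multiplicity_le_imp_dvd)
    show "?ord b \<noteq> 0" using ord_pos[OF b] by simp
    fix p :: nat assume p: "Factorial_Ring.prime p"
    let ?s = "multiplicity p (?ord b)" and ?t = "multiplicity p (?ord a)"
    show "?s \<le> ?t"
    proof (rule ccontr)
      assume "\<not> ?s \<le> ?t"
      then have lt: "?t < ?s" by simp
      have da: "p ^ ?t dvd ?ord a" and db: "p ^ ?s dvd ?ord b" by (rule multiplicity_dvd)+
      obtain r where r: "?ord a = p ^ ?t * r" "\<not> p dvd r"
        using multiplicity_decompose'[of "?ord a" p] ord_pos[OF a(1)] p by (metis not_prime_unit gr_implies_not0)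
      obtain q where q: "?ord b = p ^ ?s * q" using db by auto
      have p0: "p > 0" using p prime_gt_0_nat by auto
      \<comment> \<open>\<open>a'\<close> has order \<open>r\<close>, which is prime to
        \<open>p\<close>, and \<open>b'\<close> has order \<open>p ^ ?s\<close>. Hence the order of
        the product is \<open>r * p ^ ?s\<close>, larger than
        \<open>r * p ^ ?t = ?ord a\<close>.\<close>
      define a' where "a' = a [^] (p ^ ?t)"
      define b' where "b' = b [^] q"
      have q0: "q \<noteq> 0" using q ord_pos[OF b] by (intro notI) simp
      have oa: "?ord a' = r"
        using unit.ord_pow[OF Hc(3)[OF a(1)] da] p0
        by (metis a'_def r(1) nonzero_mult_div_cancel_left power_not_zero not_gr0)
      have ob: "?ord b' = p ^ ?s"
        using unit.ord_pow[OF Hc(3)[OF b], of q] q q0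
        by (metis b'_def dvd_triv_right nonzero_mult_div_cancel_right)
      have ab: "a' \<in> H" "b' \<in> H" unfolding a'_def b'_def using pow a b by auto
      have cop: "coprime (?ord a') (?ord b')"
        using r(2) p unfolding oa ob by (simp add: coprime_commute prime_imp_coprime)
      have "?ord (a' \<otimes> b') = r * p ^ ?s"
        using unit.ord_mult_coprime[OF Hc(3)[OF ab(1)] Hc(3)[OF ab(2)] cop] oa ob by simp
      moreover have "r * p ^ ?t < r * p ^ ?s"
        using lt prime_gt_1_nat[OF p] r(2)
        by (intro mult_strict_left_mono power_strict_increasing) (auto intro!: Nat.gr0I)
      ultimately have "?ord a < ?ord (a' \<otimes> b')" using r(1) by (metis mult.commute)
      then show False using a(2)[OF mult[OF ab]] by simp
    qed
  qed
  \<comment> \<open>Every \<open>b\<close> in \<open>H\<close> is thus a root of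
    \<open>X^d - 1\<close> for \<open>d\<close> the order of \<open>a\<close>, and these roots are
    the powers of \<open>a\<close>.\<close>
  then have "b [^] ?ord a = \<one>" if "b \<in> H" for b
    using unit.pow_eq_id[OF Hc(3)[OF that]] that by blast
  then have "\<exists>k::nat. b = a [^] k" if "b \<in> H" for b
    using unity_roots_eq_powers(3)[OF Hc(1,2)[OF a(1)] H(2)] Hc(1)[OF that] that by blast
  then show ?thesis using that a(1) by blast
qed

section \<open>Minimal polynomials, conjugates and automorphisms for roots of unity\<close>

context
  fixes K assumes K: "subfield K R"
begin

private lemma K_subring: "subring K R" using subfieldE(1)[OF K] .

private lemma K_subset_carrier: "K \<subseteq> carrier R" using subfieldE(3)[OF K] .

lemma root_of_unity_algebraic:
  assumes "z \<in> carrier R" "z [^] (N::nat) = \<one>" "N > 0"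
  shows "(algebraic over K) z"
proof -
  note u = unity_poly[OF K assms(3)]
  show ?thesis
    by (rule algebraicI[OF u(1,3)]) (use u(4) assms in auto)
qed

lemma Irr_eqI:
  assumes "x \<in> carrier R" "(algebraic over K) x" "p \<in> carrier (K[X])" "pirreducible K p"
    "lead_coeff p = \<one>" "eval p x = \<zero>"
  shows "p = Irr K x"
  using minimal_polynomial_is_unique[OF K assms(1,2)] IrrE[OF K assms(1,2)] assms(3-) by blast

text \<open>The minimal polynomial divides \<open>p\<close>: every algebraic relation over
  \<open>K\<close> passes from \<open>x\<close> to its conjugates.\<close>

lemma Irr_dvd_eval:
  assumes "x \<in> carrier R" "(algebraic over K) x" "p \<in> carrier (K[X])" "eval p x = \<zero>"
    "y \<in> carrier R" "eval (Irr K x) y = \<zero>"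
  shows "eval p y = \<zero>"
  using pdivides_imp_root_sharing[OF _ Irr_minimal[OF K assms(1-4)] assms(5,6)]
    carrier_polynomial_shell[OF K_subring IrrE(1)[OF K assms(1,2)]] by blast

lemma Irr_conjugate:
  assumes "x \<in> carrier R" "(algebraic over K) x" "y \<in> carrier R" "eval (Irr K x) y = \<zero>"
  shows "(algebraic over K) y" "Irr K y = Irr K x"
proof -
  note I = IrrE[OF K assms(1,2)]
  have ne: "Irr K x \<noteq> []" using I(2) pirreducibleE(1)[OF K_subring I(1)] by blast
  show a: "(algebraic over K) y"
    using algebraicI[OF I(1) ne assms(4)] .
  show "Irr K y = Irr K x"
    using Irr_eqI[OF assms(3) a I(1-3) assms(4)] by simp
qed

text \<open>For \<open>d\<close> the order of \<open>z\<close> the polynomial \<open>X\<^sup>d - 1\<close> has the \<open>d\<close> powers of \<open>z\<close> as roots, so its factors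
  have as many roots as their degree; this needs no assumption on the characteristic.\<close>

lemma card_roots_Irr_unity:
  assumes z: "z \<in> carrier R" "z [^] (N::nat) = \<one>" "N > 0"
  shows "card {y \<in> carrier R. eval (Irr K z) y = \<zero>} = degree (Irr K z)"
    "\<And>y. y \<in> carrier R \<Longrightarrow> eval (Irr K z) y = \<zero> \<Longrightarrow> \<exists>k::nat. y = z [^] k"
    "\<And>y. y \<in> carrier R \<Longrightarrow> eval (Irr K z) y = \<zero> \<Longrightarrow> y [^] N = \<one>"
proof -
  define d where "d = group.ord (Multiplicative_Group.mult_of R) z"
  note d = unity_roots_eq_powers[OF z, folded d_def]
  note alg = root_of_unity_algebraic[OF z]
  note I = IrrE[OF K z(1) alg]
  note u = unity_poly[OF K d(1)]
  show N: "y [^] N = \<one>" if "y \<in> carrier R" "eval (Irr K z) y = \<zero>" for y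
  proof -
    note v = unity_poly[OF K z(3)]
    have "eval (unity_poly K N) y = \<zero>"
      using Irr_dvd_eval[OF z(1) alg v(1) _ that] v(4)[OF z(1)] z(2) by simp
    then show ?thesis using v(4)[OF that(1)] that(1) by simp
  qed
  have uz: "eval (unity_poly K d) z = \<zero>" using u(4)[OF z(1)] d(2) by simp
  show "\<exists>k::nat. y = z [^] k" if "y \<in> carrier R" "eval (Irr K z) y = \<zero>" for y
  proof -
    have "eval (unity_poly K d) y = \<zero>"
      using Irr_dvd_eval[OF z(1) alg u(1) uz that] .
    then have "y [^] d = \<one>" using u(4)[OF that(1)] that(1) by simp
    then show ?thesis using d(3) that(1) by blast
  qed
  have "Irr K z divides\<^bsub>K[X]\<^esub> unity_poly K d"
    using Irr_minimal[OF K z(1) alg u(1) uz] pdivides_iff_shell[OF K I(1) u(1)] by blast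
  then obtain q where q: "q \<in> carrier (K[X])" "unity_poly K d = Irr K z \<otimes>\<^bsub>K[X]\<^esub> q"
    unfolding factor_def by blast
  have ne: "Irr K z \<noteq> []" using I(2) pirreducibleE(1)[OF K_subring I(1)] by blast
  have qe: "q \<noteq> []"
    using q(2) u(3) ring.ring_simprules(25)[OF univ_poly_is_ring[OF K_subring] I(1)] univ_poly_zero by metis
  have deg: "d = degree (Irr K z) + degree q"
    using poly_mult_degree_eq[OF K_subring, of "Irr K z" q] u(2) q I(1) ne qe
    by (simp add: univ_poly_mult univ_poly_carrier)
  \<comment> \<open>The \<open>d\<close> roots are shared between two factors whose degrees add up
    to \<open>d\<close>, so neither factor can have fewer roots than its degree.\<close>
  have sub: "{x \<in> carrier R. x [^] d = \<one>}
      \<subseteq> {y \<in> carrier R. eval (Irr K z) y = \<zero>} \<union> {y \<in> carrier R. eval q y = \<zero>}"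
  proof
    fix y assume "y \<in> {x \<in> carrier R. x [^] d = \<one>}"
    then have y: "y \<in> carrier R" "y [^] d = \<one>" by auto
    interpret E: ring_hom_cring "K[X]" R "\<lambda>p. eval p y"
      using eval_cring_hom[OF K_subring y(1)] .
    have "eval (Irr K z) y \<otimes> eval q y = \<zero>"
      using u(4)[OF y(1)] y(2) q I(1) by simp
    then show "y \<in> {y \<in> carrier R. eval (Irr K z) y = \<zero>} \<union> {y \<in> carrier R. eval q y = \<zero>}"
      using integral[of "eval (Irr K z) y" "eval q y"] y(1) q(1) I(1) by auto
  qed
  note c1 = card_eval_roots_le[OF carrier_polynomial_shell[OF K_subring I(1)] ne]
  note c2 = card_eval_roots_le[OF carrier_polynomial_shell[OF K_subring q(1)] qe]
  have "d \<le> card ({y \<in> carrier R. eval (Irr K z) y = \<zero>} \<union> {y \<in> carrier R. eval q y = \<zero>})"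
    using card_mono[OF _ sub] c1(1) c2(1) d(4) by simp
  also have "\<dots> \<le> card {y \<in> carrier R. eval (Irr K z) y = \<zero>} + card {y \<in> carrier R. eval q y = \<zero>}"
    by (rule card_Un_le)
  finally show "card {y \<in> carrier R. eval (Irr K z) y = \<zero>} = degree (Irr K z)"
    using c1(2) c2(2) deg by linarith
qed

lemma eval_hom_commute:
  assumes E: "subring E R" "K \<subseteq> E" and h: "h \<in> ring_hom (R\<lparr>carrier := E\<rparr>) R" "\<And>k. k \<in> K \<Longrightarrow> h k = k"
    and "x \<in> E" "set p \<subseteq> K"
  shows "eval p x \<in> E" "h (eval p x) = eval p (h x)"
proof -
  have pw: "x [^] (k::nat) \<in> E \<and> h (x [^] k) = h x [^] k" for k
  proof (induction k)
    case 0
    then show ?case using subringE(3)[OF E(1)] ring_hom_one[OF h(1)] by simp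
  next
    case (Suc k)
    then show ?case
      using subringE(6)[OF E(1)] ring_hom_mult[OF h(1), of "x [^] k" x] assms(5) by simp
  qed
  have "eval p x \<in> E \<and> h (eval p x) = eval p (h x)"
    using assms(6)
  proof (induction p)
    case Nil
    have "h \<zero> = \<zero>"
      using h(2)[OF subringE(2)[OF K_subring]] .
    then show ?case using subringE(2)[OF E(1)] by simp
  next
    case (Cons a p)
    have aE: "a \<in> E" using Cons.prems E(2) by auto
    have "a \<otimes> x [^] length p \<in> E" using aE pw subringE(6)[OF E(1)] by auto
    moreover have "h (a \<otimes> x [^] length p) = a \<otimes> h x [^] length p"
      using ring_hom_mult[OF h(1), of a "x [^] length p"] aE pw h(2)[of a] Cons.prems by auto
    ultimately show ?case
      using Cons subringE(7)[OF E(1)] ring_hom_add[OF h(1), of "a \<otimes> x [^] length p" "eval p x"]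
      by auto
  qed
  then show "eval p x \<in> E" "h (eval p x) = eval p (h x)" by auto
qed

text \<open>A conjugate is a power of \<open>z\<close>, and since conjugacy is symmetric,
  \<open>z\<close> is also a power of the conjugate. This is the normality of \<open>K(z)\<close>
  over \<open>K\<close>.\<close>

lemma unity_conjugate_simple_extension:
  assumes z: "z \<in> carrier R" "z [^] (N::nat) = \<one>" "N > 0"
    and y: "y \<in> carrier R" "eval (Irr K z) y = \<zero>"
  shows "simple_extension K y = simple_extension K z"
proof -
  have sub: "simple_extension K b \<subseteq> simple_extension K a"
    if "a \<in> carrier R" "b = a [^] (k::nat)" for a b k
  proof -
    note S = simple_extension_is_subring[OF K_subring that(1)]
    have "b \<in> simple_extension K a"
      unfolding that(2) by (induction k) (use subringE(3,6)[OF S] simple_extension_mem[OF K_subring that(1)] in auto)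
    then show ?thesis
      using simple_extension_subring_incl[OF S simple_extension_incl[OF K_subset_carrier that(1)]] by blast
  qed
  note alg = root_of_unity_algebraic[OF z]
  note y' = Irr_conjugate[OF z(1) alg y]
  obtain k :: nat where k: "y = z [^] k" using card_roots_Irr_unity(2)[OF z y] by blast
  have yN: "y [^] N = \<one>" using card_roots_Irr_unity(3)[OF z y] .
  have "eval (Irr K y) z = \<zero>" using y'(2) IrrE(4)[OF K z(1) alg] by simp
  then obtain j :: nat where j: "z = y [^] j"
    using card_roots_Irr_unity(2)[OF y(1) yN z(3) z(1)] by blast
  show ?thesis using sub[OF z(1) k] sub[OF y(1) j] by blast
qed

text \<open>Since \<open>z\<close> and \<open>y\<close> have the same minimal polynomial,
  \<open>p(z) \<mapsto> p(y)\<close> is well defined and injective on \<open>K(z)\<close>; it maps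
  onto the same field because \<open>K(y) = K(z)\<close>.\<close>

lemma exists_Gal_unity_conjugate:
  assumes z: "z \<in> carrier R" "z [^] (N::nat) = \<one>" "N > 0"
    and y: "y \<in> carrier R" "eval (Irr K z) y = \<zero>"
  shows "\<exists>s \<in> carrier (Gal R (simple_extension K z) K). s z = y"
proof -
  let ?E = "simple_extension K z"
  note alg = root_of_unity_algebraic[OF z]
  note y' = Irr_conjugate[OF z(1) alg y]
  have zy: "eval (Irr K y) z = \<zero>" using y'(2) IrrE(4)[OF K z(1) alg] by simp
  have Ez: "?E = (\<lambda>p. eval p z) ` carrier (K[X])"
    using simple_extension_as_eval_img[OF K_subset_carrier z(1)] .
  have Ey: "?E = (\<lambda>p. eval p y) ` carrier (K[X])"
    using simple_extension_as_eval_img[OF K_subset_carrier y(1)] unity_conjugate_simple_extension[OF z y] by simp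
  interpret P: ring "K[X]" using univ_poly_is_ring[OF K_subring] .
  interpret Z: ring_hom_ring "K[X]" R "\<lambda>p. eval p z" using eval_ring_hom[OF K_subring z(1)] .
  interpret Y: ring_hom_ring "K[X]" R "\<lambda>p. eval p y" using eval_ring_hom[OF K_subring y(1)] .
  \<comment> \<open>\<open>g a\<close> is an arbitrary polynomial with value \<open>a\<close> at
    \<open>z\<close>; by \<open>eq_iff\<close> below its value at \<open>y\<close> does not depend
    on the choice.\<close>
  define g where "g a = (SOME p. p \<in> carrier (K[X]) \<and> eval p z = a)" for a
  define s where "s = (\<lambda>a\<in>?E. eval (g a) y)"
  have g: "g a \<in> carrier (K[X])" "eval (g a) z = a" if "a \<in> ?E" for a
    using someI_ex[of "\<lambda>p. p \<in> carrier (K[X]) \<and> eval p z = a"] that unfolding g_def Ez by blast+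
  have eq_iff: "eval p z = eval q z \<longleftrightarrow> eval p y = eval q y"
    if pq: "p \<in> carrier (K[X])" "q \<in> carrier (K[X])" for p q
  proof -
    let ?d = "p \<ominus>\<^bsub>K[X]\<^esub> q"
    have d: "?d \<in> carrier (K[X])" using pq by simp
    have e: "eval ?d z = eval p z \<ominus> eval q z" "eval ?d y = eval p y \<ominus> eval q y"
      using pq by (auto simp: a_minus_def)
    have "eval ?d z = \<zero> \<longleftrightarrow> eval ?d y = \<zero>"
      using Irr_dvd_eval[OF z(1) alg d _ y] Irr_dvd_eval[OF y(1) y'(1) d _ z(1) zy] by blast
    then show ?thesis unfolding e using pq by simp
  qed
  have s_eval: "s (eval p z) = eval p y" if "p \<in> carrier (K[X])" for p
  proof -
    have mem: "eval p z \<in> ?E" using that Ez by auto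
    then show ?thesis using eq_iff[OF that g(1)[OF mem]] g(2)[OF mem] by (auto simp: s_def)
  qed
  have "s \<in> Bij ?E"
    unfolding Bij_def bij_betw_def
  proof (intro IntI CollectI conjI)
    show "s \<in> extensional ?E" by (simp add: s_def)
    show "inj_on s ?E"
    proof (rule inj_onI)
      fix a b assume "a \<in> ?E" "b \<in> ?E" "s a = s b"
      moreover then obtain p q where "p \<in> carrier (K[X])" "q \<in> carrier (K[X])" "a = eval p z" "b = eval q z"
        unfolding Ez by blast
      ultimately show "a = b" using eq_iff s_eval by simp
    qed
    have "s ` ?E = (\<lambda>p. s (eval p z)) ` carrier (K[X])" by (subst Ez) (simp only: image_image)
    also have "\<dots> = (\<lambda>p. eval p y) ` carrier (K[X])" using s_eval by (intro image_cong) auto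
    finally show "s ` ?E = ?E" using Ey by simp
  qed
  moreover have "s \<in> ring_hom (R\<lparr>carrier := ?E\<rparr>) (R\<lparr>carrier := ?E\<rparr>)"
  proof (rule ring_hom_memI)
    show "s a \<in> carrier (R\<lparr>carrier := ?E\<rparr>)" if "a \<in> carrier (R\<lparr>carrier := ?E\<rparr>)" for a
      using that g(1)[of a] Ey by (auto simp: s_def)
  next
    fix a b assume "a \<in> carrier (R\<lparr>carrier := ?E\<rparr>)" "b \<in> carrier (R\<lparr>carrier := ?E\<rparr>)"
    then obtain p q where pq: "p \<in> carrier (K[X])" "q \<in> carrier (K[X])" "a = eval p z" "b = eval q z"
      using Ez by auto
    show "s (a \<otimes>\<^bsub>R\<lparr>carrier := ?E\<rparr>\<^esub> b) = s a \<otimes>\<^bsub>R\<lparr>carrier := ?E\<rparr>\<^esub> s b"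
      using s_eval[of "p \<otimes>\<^bsub>K[X]\<^esub> q"] s_eval[of p] s_eval[of q] pq by simp
    show "s (a \<oplus>\<^bsub>R\<lparr>carrier := ?E\<rparr>\<^esub> b) = s a \<oplus>\<^bsub>R\<lparr>carrier := ?E\<rparr>\<^esub> s b"
      using s_eval[of "p \<oplus>\<^bsub>K[X]\<^esub> q"] s_eval[of p] s_eval[of q] pq by simp
  next
    show "s \<one>\<^bsub>R\<lparr>carrier := ?E\<rparr>\<^esub> = \<one>\<^bsub>R\<lparr>carrier := ?E\<rparr>\<^esub>"
      using s_eval[OF P.one_closed] by simp
  qed
  moreover have "s a = a" if "a \<in> K" for a
  proof -
    have "poly_of_const a \<in> carrier (K[X])"
      using ring_hom_closed[OF canonical_embedding_is_hom[OF K_subring]] that by simp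
    moreover have "eval (poly_of_const a) x = a" if "x \<in> carrier R" for x
      using \<open>a \<in> K\<close> K_subset_carrier that by (auto simp: poly_of_const_def)
    ultimately show ?thesis using s_eval[of "poly_of_const a"] z(1) y(1) by simp
  qed
  moreover have "s z = y"
    using s_eval[OF var_closed(1)[OF K_subring]] eval_var z(1) y(1) by simp
  ultimately show ?thesis
    by (intro bexI[of _ s]) (auto simp: Gal_def ring_iso_def Bij_def)
qed

text \<open>An automorphism is determined by its value at \<open>z\<close>, and every root of the
  minimal polynomial occurs as such a value. The root count \<open>card_roots_Irr_unity\<close>
  turns this bijection into the degree.\<close>

lemma card_Gal_unity:
  assumes z: "z \<in> carrier R" "z [^] (N::nat) = \<one>" "N > 0"
  shows "card (carrier (Gal R (simple_extension K z) K)) = degree (Irr K z)"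
    "finite (carrier (Gal R (simple_extension K z) K))"
proof -
  let ?E = "simple_extension K z" and ?rt = "{y \<in> carrier R. eval (Irr K z) y = \<zero>}"
  note alg = root_of_unity_algebraic[OF z]
  note I = IrrE[OF K z(1) alg]
  note S = simple_extension_is_subring[OF K_subring z(1)]
  have KE: "K \<subseteq> ?E" using simple_extension_incl[OF K_subset_carrier z(1)] .
  have zE: "z \<in> ?E" using simple_extension_mem[OF K_subring z(1)] .
  have Ec: "?E \<subseteq> carrier R" using subringE(1)[OF S] .
  have h: "s \<in> ring_hom (R\<lparr>carrier := ?E\<rparr>) R" "\<And>k. k \<in> K \<Longrightarrow> s k = k" "s \<in> extensional ?E"
    if "s \<in> carrier (Gal R ?E K)" for s
    using that Ec by (auto simp: Gal_def ring_iso_def ring_hom_def Bij_def)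
  have ev: "s (eval p z) = eval p (s z)" if "s \<in> carrier (Gal R ?E K)" "p \<in> carrier (K[X])" for s p
  proof -
    have "set p \<subseteq> K" using that(2) polynomial_incl univ_poly_carrier by blast
    then show ?thesis using eval_hom_commute(2)[OF S KE h(1,2)[OF that(1)] zE] by simp
  qed
  have "bij_betw (\<lambda>s. s z) (carrier (Gal R ?E K)) ?rt"
    unfolding bij_betw_def
  proof (intro conjI subset_antisym)
    show "inj_on (\<lambda>s. s z) (carrier (Gal R ?E K))"
    proof (rule inj_onI)
      fix s t assume st: "s \<in> carrier (Gal R ?E K)" "t \<in> carrier (Gal R ?E K)" "s z = t z"
      show "s = t"
      proof (rule extensionalityI[OF h(3)[OF st(1)] h(3)[OF st(2)]])
        fix a assume "a \<in> ?E"
        then obtain p where "p \<in> carrier (K[X])" "a = eval p z"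
          using simple_extension_as_eval_img[OF K_subset_carrier z(1)] by auto
        then show "s a = t a" using ev[OF st(1)] ev[OF st(2)] st(3) by metis
      qed
    qed
    show "(\<lambda>s. s z) ` carrier (Gal R ?E K) \<subseteq> ?rt"
    proof clarify
      fix s assume s: "s \<in> carrier (Gal R ?E K)"
      have "s z \<in> carrier R" using ring_hom_closed[OF h(1)[OF s], of z] zE by simp
      moreover have "s \<zero> = \<zero>" using h(2)[OF s subringE(2)[OF K_subring]] .
      ultimately show "s z \<in> carrier R \<and> eval (Irr K z) (s z) = \<zero>"
        using ev[OF s I(1)] I(4) by simp
    qed
    show "?rt \<subseteq> (\<lambda>s. s z) ` carrier (Gal R ?E K)"
      using exists_Gal_unity_conjugate[OF z] by blast
  qed
  then show "card (carrier (Gal R ?E K)) = degree (Irr K z)" "finite (carrier (Gal R ?E K))"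
    using bij_betw_same_card bij_betw_finite card_roots_Irr_unity(1)[OF z]
      card_eval_roots_le(1)[OF carrier_polynomial_shell[OF K_subring I(1)]] pirreducibleE(1)[OF K_subring I(1,2)]
    by fastforce+
qed

lemma generate_field_unity_simple:
  assumes A: "A \<subseteq> {z \<in> carrier R. z [^] (N::nat) = \<one>}" "N > 0"
  obtains y where "y \<in> carrier R" "y [^] N = \<one>" "generate_field R (K \<union> A) = simple_extension K y"
proof -
  let ?F = "generate_field R (K \<union> A)"
  have KA: "K \<union> A \<subseteq> carrier R" using A K_subset_carrier by auto
  have F: "subfield ?F R" using generate_field_is_subfield[OF KA] .
  note Fr = subringE[OF subfieldE(1)[OF F]]
  \<comment> \<open>All roots of unity of exponent \<open>N\<close> in the field are taken, not only
    those in \<open>A\<close>, so that \<open>H\<close> is closed under multiplication and hence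
    cyclic. The powers of its generator include \<open>A\<close>.\<close>
  define H where "H = ?F \<inter> {z \<in> carrier R. z [^] N = \<one>}"
  obtain y where y: "y \<in> H" "\<And>b. b \<in> H \<Longrightarrow> \<exists>k::nat. b = y [^] k"
  proof (rule unity_subgroup_cyclic[of H N])
    show "\<one> \<in> H" using Fr(3) by (simp add: H_def)
    show "a \<otimes> b \<in> H" if "a \<in> H" "b \<in> H" for a b
      using that Fr(6) by (auto simp: H_def pow_mult_distrib m_comm nat_pow_distrib)
  qed (use A in \<open>auto simp: H_def\<close>)
  have yc: "y \<in> carrier R" "y [^] N = \<one>" "y \<in> ?F" using y(1) by (auto simp: H_def)
  note S = simple_extension_is_subring[OF K_subring yc(1)]
  have Sf: "subfield (simple_extension K y) R"
    using simple_extension_is_subfield[OF K yc(1)] root_of_unity_algebraic[OF yc(1,2) A(2)] by blast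
  have pw: "y [^] (k::nat) \<in> simple_extension K y" for k
    by (induction k) (use subringE(3,6)[OF S] simple_extension_mem[OF K_subring yc(1)] in auto)
  have "A \<subseteq> H" using A generate_field.incl[of _ "K \<union> A" R] by (auto simp: H_def)
  then have "A \<subseteq> simple_extension K y" using y(2) pw by blast
  then have "?F \<subseteq> simple_extension K y"
    using generate_field_min_subfield1[OF KA Sf] simple_extension_incl[OF K_subset_carrier yc(1)] by blast
  moreover have "K \<subseteq> ?F" using generate_field.incl[of _ "K \<union> A" R] by blast
  then have "simple_extension K y \<subseteq> ?F"
    using simple_extension_subring_incl[OF subfieldE(1)[OF F] _ yc(3)] by blast
  ultimately show ?thesis using that yc by blast
qed

end

section \<open>The group structure of \<open>Gal\<close> and its fixed elements\<close>

lemma Gal_carrierD: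
  assumes "s \<in> carrier (Gal R E K)" "subring E R"
  shows "s \<in> ring_hom (R\<lparr>carrier := E\<rparr>) R" "s \<in> ring_hom (R\<lparr>carrier := E\<rparr>) (R\<lparr>carrier := E\<rparr>)"
    "\<And>k. k \<in> K \<Longrightarrow> s k = k" "s \<in> Bij E" "\<And>x. x \<in> E \<Longrightarrow> s x \<in> E"
  using assms(1) subringE(1)[OF assms(2)] by (auto simp: Gal_def ring_iso_def ring_hom_def)

lemma Gal_group:
  assumes "subring E R" "K \<subseteq> E"
  shows "group (Gal R E K)"
proof -
  have "subgroup (carrier (Gal R E K)) (BijGroup E)"
  proof (rule group.subgroupI[OF group_BijGroup])
    show "carrier (Gal R E K) \<subseteq> carrier (BijGroup E)" by (auto simp: Gal_def BijGroup_def)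
    have "(\<lambda>x\<in>E. x) \<in> carrier (Gal R E K)"
      using assms subringE(3,6,7)[OF assms(1)]
      by (auto simp: Gal_def id_Bij ring_iso_def intro!: ring_hom_memI) (simp add: bij_betw_def)
    then show "carrier (Gal R E K) \<noteq> {}" by blast
  next
    fix s assume s: "s \<in> carrier (Gal R E K)"
    note sD = Gal_carrierD[OF s assms(1)]
    have b: "bij_betw s E E" using sD(4) by (simp add: Bij_def)
    define t where "t = (\<lambda>x\<in>E. inv_into E s x)"
    have tB: "t \<in> Bij E" using restrict_inv_into_Bij[OF sD(4)] by (simp add: t_def)
    have tE: "t a \<in> E" and st: "s (t a) = a" if "a \<in> E" for a
      using that b by (auto simp: bij_betw_def inv_into_into f_inv_into_f t_def)
    \<comment> \<open>The inverse map \<open>t\<close> is evaluated by exhibiting a preimage under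
      \<open>s\<close>, which derives each homomorphism law of \<open>t\<close> from the one of
      \<open>s\<close>.\<close>
    have u: "t c = a" if "a \<in> E" "s a = c" for a c
      using that b sD(5)[OF that(1)] by (auto simp: bij_betw_def t_def)
    have "t \<in> ring_hom (R\<lparr>carrier := E\<rparr>) (R\<lparr>carrier := E\<rparr>)"
    proof (rule ring_hom_memI)
      fix a c assume "a \<in> carrier (R\<lparr>carrier := E\<rparr>)" "c \<in> carrier (R\<lparr>carrier := E\<rparr>)"
      then have ac: "a \<in> E" "c \<in> E" by auto
      have e: "s (t a \<otimes> t c) = a \<otimes> c" "s (t a \<oplus> t c) = a \<oplus> c"
        using ring_hom_mult[OF sD(1), of "t a" "t c"] ring_hom_add[OF sD(1), of "t a" "t c"]
          tE[OF ac(1)] tE[OF ac(2)] st[OF ac(1)] st[OF ac(2)] by simp_all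
      show "t (a \<otimes>\<^bsub>R\<lparr>carrier := E\<rparr>\<^esub> c) = t a \<otimes>\<^bsub>R\<lparr>carrier := E\<rparr>\<^esub> t c"
        "t (a \<oplus>\<^bsub>R\<lparr>carrier := E\<rparr>\<^esub> c) = t a \<oplus>\<^bsub>R\<lparr>carrier := E\<rparr>\<^esub> t c"
        using u[OF subringE(6)[OF assms(1) tE[OF ac(1)] tE[OF ac(2)]] e(1)]
          u[OF subringE(7)[OF assms(1) tE[OF ac(1)] tE[OF ac(2)]] e(2)] by simp_all
    next
      show "t \<one>\<^bsub>R\<lparr>carrier := E\<rparr>\<^esub> = \<one>\<^bsub>R\<lparr>carrier := E\<rparr>\<^esub>"
        using u[OF subringE(3)[OF assms(1)], of \<one>] ring_hom_one[OF sD(1)] by simp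
    qed (simp add: tE)
    moreover have "t k = k" if "k \<in> K" for k
      by (rule u) (use that assms(2) sD(3) in auto)
    ultimately have "t \<in> carrier (Gal R E K)"
      using tB unfolding Gal_def ring_iso_def by (auto simp: Bij_def)
    then show "inv\<^bsub>BijGroup E\<^esub> s \<in> carrier (Gal R E K)"
      using inv_BijGroup[OF sD(4)] by (simp add: t_def)
  next
    fix s t assume s: "s \<in> carrier (Gal R E K)" and t: "t \<in> carrier (Gal R E K)"
    note sD = Gal_carrierD[OF s assms(1)] and tD = Gal_carrierD[OF t assms(1)]
    have "compose E s t \<in> ring_hom (R\<lparr>carrier := E\<rparr>) (R\<lparr>carrier := E\<rparr>)"
    proof (rule ring_hom_memI)
      fix a b assume "a \<in> carrier (R\<lparr>carrier := E\<rparr>)" "b \<in> carrier (R\<lparr>carrier := E\<rparr>)"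
      then have ab: "a \<in> E" "b \<in> E" by auto
      show "compose E s t (a \<otimes>\<^bsub>R\<lparr>carrier := E\<rparr>\<^esub> b) = compose E s t a \<otimes>\<^bsub>R\<lparr>carrier := E\<rparr>\<^esub> compose E s t b"
        using ab subringE(6)[OF assms(1) ab] tD(5) ring_hom_mult[OF tD(1), of a b] ring_hom_mult[OF sD(1), of "t a" "t b"]
        by (simp add: compose_def)
      show "compose E s t (a \<oplus>\<^bsub>R\<lparr>carrier := E\<rparr>\<^esub> b) = compose E s t a \<oplus>\<^bsub>R\<lparr>carrier := E\<rparr>\<^esub> compose E s t b"
        using ab subringE(7)[OF assms(1) ab] tD(5) ring_hom_add[OF tD(1), of a b] ring_hom_add[OF sD(1), of "t a" "t b"]
        by (simp add: compose_def)
    next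
      show "compose E s t \<one>\<^bsub>R\<lparr>carrier := E\<rparr>\<^esub> = \<one>\<^bsub>R\<lparr>carrier := E\<rparr>\<^esub>"
        using subringE(3)[OF assms(1)] ring_hom_one[OF tD(1)] ring_hom_one[OF sD(1)]
        by (simp add: compose_def)
    qed (use sD(5) tD(5) in \<open>auto simp: compose_def\<close>)
    moreover have "compose E s t k = k" if "k \<in> K" for k
      using that assms(2) sD(3) tD(3) by (auto simp: compose_def)
    ultimately have "compose E s t \<in> carrier (Gal R E K)"
      using compose_Bij[OF sD(4) tD(4)] unfolding Gal_def ring_iso_def by (auto simp: Bij_def)
    then show "s \<otimes>\<^bsub>BijGroup E\<^esub> t \<in> carrier (Gal R E K)"
      using sD(4) tD(4) by (simp add: BijGroup_def)
  qed
  then have "group ((BijGroup E)\<lparr>carrier := carrier (Gal R E K)\<rparr>)"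
    by (rule subgroup.subgroup_is_group[OF _ group_BijGroup])
  moreover have "(BijGroup E)\<lparr>carrier := carrier (Gal R E K)\<rparr> = Gal R E K"
    by (simp add: Gal_def)
  ultimately show ?thesis by simp
qed

lemma Gal_mult:
  assumes "s \<in> carrier (Gal R E K)" "t \<in> carrier (Gal R E K)"
  shows "s \<otimes>\<^bsub>Gal R E K\<^esub> t = compose E s t"
  using assms by (simp add: Gal_def BijGroup_def)

text \<open>The elements fixed by \<open>s\<close> are closed under the field operations, so
  induction over the generation of the field applies; for the two kinds of inverses the reason is
  their uniqueness.\<close>

lemma Gal_fixes_generate_field:
  assumes "subfield E R" "s \<in> carrier (Gal R E K)" "H \<subseteq> E" "\<And>a. a \<in> H \<Longrightarrow> s a = a"
    and "b \<in> generate_field R H"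
  shows "s b = b"
proof -
  note E_subring = subfieldE(1)[OF assms(1)]
  note D = Gal_carrierD[OF assms(2) E_subring]
  have Hc: "H \<subseteq> carrier R" using assms(3) subfieldE(3)[OF assms(1)] by auto
  have sub: "generate_field R H \<subseteq> E"
    using generate_field_min_subfield1[OF Hc assms(1,3)] .
  interpret S: ring_hom_ring "R\<lparr>carrier := E\<rparr>" R s
    using D(1) subring_is_ring[OF E_subring] ring_axioms
    by (auto simp: ring_hom_ring_def ring_hom_ring_axioms_def)
  have mult: "s (a \<otimes> c) = s a \<otimes> s c" if "a \<in> E" "c \<in> E" for a c using S.hom_mult that by simp
  have add: "s (a \<oplus> c) = s a \<oplus> s c" if "a \<in> E" "c \<in> E" for a c using S.hom_add that by simp
  show ?thesis using assms(5)
  proof induction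
    case one
    then show ?case using S.hom_one by simp
  next
    case (incl h)
    then show ?case using assms(4) by simp
  next
    case (a_inv h)
    then have hE: "h \<in> E" "\<ominus> h \<in> E" "h \<in> carrier R" using sub subringE(1,5)[OF E_subring] by auto
    have "s (h \<oplus> \<ominus> h) = s \<zero>" using hE by (simp add: r_neg)
    then have "h \<oplus> s (\<ominus> h) = \<zero>" using add[OF hE(1,2)] a_inv.IH S.hom_zero by simp
    moreover have sc: "s (\<ominus> h) \<in> carrier R" using ring_hom_closed[OF D(1), of "\<ominus> h"] hE by simp
    ultimately have "s (\<ominus> h) \<oplus> h = \<zero>" using hE(3) by (simp add: a_comm)
    then show ?case using minus_equality[OF _ hE(3) sc] by simp
  next
    case (m_inv h)
    then have hE: "h \<in> E - {\<zero>}" "h \<in> carrier R" using sub subringE(1)[OF E_subring] by auto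
    note i = subfield_m_inv[OF assms(1) hE(1)]
    have ic: "inv h \<in> E" "s (inv h) \<in> carrier R" "inv h \<in> carrier R"
      using i(1) ring_hom_closed[OF D(1), of "inv h"] subringE(1)[OF E_subring] by auto
    have "h \<otimes> s (inv h) = \<one>"
      using mult[of h "inv h"] hE ic(1) i(2) m_inv.IH S.hom_one by auto
    then show ?case
      using comm_inv_char[OF hE(2) ic(2)] by simp
  next
    case (eng_add h1 h2)
    then show ?case using add[of h1 h2] sub by (simp add: subset_iff)
  next
    case (eng_mult h1 h2)
    then show ?case using mult[of h1 h2] sub by (simp add: subset_iff)
  qed
qed

end

section \<open>Separability and semisimplicity\<close>

text \<open>The induction step for splitting \<open>x - c\<close> off \<open>x^d - c^d\<close>, with
  \<open>u = x^d\<close> and \<open>v = c^d\<close>. It comes from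
  \<open>u x - v c = x (u - v) + (x - c) v\<close>.\<close>

lemma (in cring) geometric_step:
  assumes "x \<in> carrier R" "c \<in> carrier R" "s \<in> carrier R" "u \<in> carrier R" "v \<in> carrier R"
    and "u \<ominus> v = (x \<ominus> c) \<otimes> s"
  shows "u \<otimes> x \<ominus> v \<otimes> c = (x \<ominus> c) \<otimes> (x \<otimes> s \<oplus> v)"
proof -
  have "(x \<ominus> c) \<otimes> (x \<otimes> s \<oplus> v) = x \<otimes> ((x \<ominus> c) \<otimes> s) \<oplus> (x \<ominus> c) \<otimes> v"
    using assms(1-5) by algebra
  also have "\<dots> = x \<otimes> (u \<ominus> v) \<oplus> (x \<ominus> c) \<otimes> v" by (simp add: assms(6))
  also have "\<dots> = u \<otimes> x \<ominus> v \<otimes> c" using assms(1-5) by algebra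
  finally show ?thesis by simp
qed

text \<open>For a prime factor \<open>p\<close> of \<open>d = p * e\<close>, the product of the
  images of \<open>p\<close> and \<open>e\<close> is zero in a domain; either \<open>p\<close> is
  the prime sought or the search continues in \<open>e\<close>.\<close>

lemma (in domain) add_pow_zero_imp_prime:
  assumes "[(d::nat)] \<cdot> \<one> = \<zero>" "d > 0"
  shows "\<exists>p. Factorial_Ring.prime p \<and> p dvd d \<and> [p] \<cdot> \<one> = \<zero>"
  using assms
proof (induction d rule: less_induct)
  case (less d)
  have "d \<noteq> 1" using less.prems by auto
  then obtain p where p: "Factorial_Ring.prime p" "p dvd d" using prime_factor_nat by blast
  then obtain e where e: "d = p * e" by blast
  have "[p] \<cdot> \<one> \<otimes> [e] \<cdot> \<one> = [d] \<cdot> \<one>"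
    by (simp add: e add_pow_ldistr add.nat_pow_pow mult.commute)
  then have "[p] \<cdot> \<one> = \<zero> \<or> [e] \<cdot> \<one> = \<zero>"
    using less.prems(1) integral by auto
  moreover have "e < d" "e > 0" using e less.prems(2) prime_gt_1_nat[OF p(1)] by auto
  ultimately show ?case using less.IH[of e] p e by (metis dvd_mult)
qed

context field
begin

text \<open>The last equation says that \<open>s(a)\<close> is the derivative of \<open>X\<^sup>d\<close> at \<open>a\<close>, multiplied by \<open>a\<close> so that
  no exponent \<open>d - 1\<close> occurs.\<close>

lemma unity_poly_factor:
  assumes a: "a \<in> carrier R"
  shows "\<exists>s \<in> carrier (poly_ring R). X [^]\<^bsub>poly_ring R\<^esub> (d::nat) \<ominus>\<^bsub>poly_ring R\<^esub> poly_of_const a [^]\<^bsub>poly_ring R\<^esub> d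
      = (X \<ominus>\<^bsub>poly_ring R\<^esub> poly_of_const a) \<otimes>\<^bsub>poly_ring R\<^esub> s \<and> a \<otimes> eval s a = [d] \<cdot> (a [^] d)"
proof -
  interpret P: domain "poly_ring R" using univ_poly_is_domain[OF carrier_is_subring] .
  have X: "X \<in> carrier (poly_ring R)" using var_closed(1)[OF carrier_is_subring] .
  have c: "poly_of_const a \<in> carrier (poly_ring R)"
    using ring_hom_closed[OF canonical_embedding_is_hom[OF carrier_is_subring]] a by simp
  have ec: "eval (poly_of_const a) a = a" using a by (auto simp: poly_of_const_def)
  interpret E: ring_hom_cring "poly_ring R" R "\<lambda>p. eval p a"
    using eval_cring_hom[OF carrier_is_subring a] .
  show ?thesis
  proof (induction d)
    case 0
    have "X [^]\<^bsub>poly_ring R\<^esub> (0::nat) \<ominus>\<^bsub>poly_ring R\<^esub> poly_of_const a [^]\<^bsub>poly_ring R\<^esub> (0::nat)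
      = (X \<ominus>\<^bsub>poly_ring R\<^esub> poly_of_const a) \<otimes>\<^bsub>poly_ring R\<^esub> \<zero>\<^bsub>poly_ring R\<^esub>"
      using X c by (simp add: a_minus_def P.r_neg)
    then show ?case using a by (intro bexI[of _ "\<zero>\<^bsub>poly_ring R\<^esub>"]) auto
  next
    case (Suc d)
    then obtain s where s: "s \<in> carrier (poly_ring R)"
      "X [^]\<^bsub>poly_ring R\<^esub> d \<ominus>\<^bsub>poly_ring R\<^esub> poly_of_const a [^]\<^bsub>poly_ring R\<^esub> d
      = (X \<ominus>\<^bsub>poly_ring R\<^esub> poly_of_const a) \<otimes>\<^bsub>poly_ring R\<^esub> s" "a \<otimes> eval s a = [d] \<cdot> (a [^] d)" by blast
    let ?s = "X \<otimes>\<^bsub>poly_ring R\<^esub> s \<oplus>\<^bsub>poly_ring R\<^esub> poly_of_const a [^]\<^bsub>poly_ring R\<^esub> d"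
    have "X [^]\<^bsub>poly_ring R\<^esub> Suc d \<ominus>\<^bsub>poly_ring R\<^esub> poly_of_const a [^]\<^bsub>poly_ring R\<^esub> Suc d
      = (X \<ominus>\<^bsub>poly_ring R\<^esub> poly_of_const a) \<otimes>\<^bsub>poly_ring R\<^esub> ?s"
      using P.geometric_step[OF X c s(1) _ _ s(2)] X c by simp
    moreover have "a \<otimes> eval ?s a = [Suc d] \<cdot> (a [^] Suc d)"
    proof -
      have "eval ?s a = a \<otimes> eval s a \<oplus> a [^] d"
        using X c s(1) ec eval_var[OF a] by (simp add: E.hom_pow)
      then have "a \<otimes> eval ?s a = a \<otimes> ([d] \<cdot> (a [^] d) \<oplus> a [^] d)" using s(3) by simp
      also have "\<dots> = a \<otimes> ([Suc d] \<cdot> (a [^] d))" by simp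
      also have "\<dots> = [Suc d] \<cdot> (a \<otimes> a [^] d)" using a by (subst add_pow_rdistr) auto
      finally show ?thesis using a by (simp add: m_comm)
    qed
    ultimately show ?case using X c s(1) by (intro bexI[of _ ?s]) auto
  qed
qed

text \<open>At a double root \<open>a\<close> the cofactor \<open>s\<close> of
  \<open>unity_poly_factor\<close> would vanish, although \<open>a s(a) = d a^d = d\<close> is
  nonzero. So all roots are simple, and splitting gives as many as the degree.\<close>

lemma card_unity_roots_eq:
  assumes d: "d > 0" "[(d::nat)] \<cdot> \<one> \<noteq> \<zero>" and split: "splitted (unity_poly (carrier R) d)"
  shows "card {z \<in> carrier R. z [^] d = \<one>} = d"
proof -
  let ?u = "unity_poly (carrier R) d"
  note u = unity_poly[OF carrier_is_subfield d(1)]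
  interpret P: domain "poly_ring R" using univ_poly_is_domain[OF carrier_is_subring] .
  have X: "X \<in> carrier (poly_ring R)" using var_closed(1)[OF carrier_is_subring] .
  have rt: "set_mset (roots ?u) = {z \<in> carrier R. z [^] d = \<one>}"
    using roots_mem_iff_is_root[OF u(1)] u(3,4) unfolding is_root_def by auto
  have "count (roots ?u) a = 1" if aroot: "a \<in># roots ?u" for a
  proof (rule ccontr)
    assume "count (roots ?u) a \<noteq> 1"
    moreover have "count (roots ?u) a > 0" using aroot by simp
    ultimately have "count (roots ?u) a \<ge> 2" by linarith
    then have c2: "2 \<le> alg_mult ?u a" using alg_mult_eq_count_roots[OF u(1)] by simp
    have a: "a \<in> carrier R" "a [^] d = \<one>" using aroot rt by auto
    let ?t = "[\<one>, \<ominus> a]"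
    have t: "?t \<in> carrier (poly_ring R)"
      using a unfolding univ_poly_carrier[symmetric] polynomial_def by simp
    have "(?t [^]\<^bsub>poly_ring R\<^esub> (2::nat)) pdivides ?u"
      using le_alg_mult_imp_pdivides[OF a(1) u(1) c2] .
    then obtain q where q: "q \<in> carrier (poly_ring R)" "?u = (?t [^]\<^bsub>poly_ring R\<^esub> (2::nat)) \<otimes>\<^bsub>poly_ring R\<^esub> q"
      unfolding pdivides_def factor_def by blast
    have c: "poly_of_const a \<in> carrier (poly_ring R)"
      using ring_hom_closed[OF canonical_embedding_is_hom[OF carrier_is_subring]] a by simp
    have a0: "a \<noteq> \<zero>" using root_of_unity_nonzero[OF a d(1)] by simp
    have "poly_of_const (\<ominus> a) \<oplus>\<^bsub>poly_ring R\<^esub> poly_of_const a = \<zero>\<^bsub>poly_ring R\<^esub>"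
      using ring_hom_add[OF canonical_embedding_is_hom[OF carrier_is_subring], of "\<ominus> a" a] a
      by (simp add: l_neg poly_of_const_def univ_poly_zero)
    then have nc: "\<ominus>\<^bsub>poly_ring R\<^esub> poly_of_const a = poly_of_const (\<ominus> a)"
      using P.minus_equality c ring_hom_closed[OF canonical_embedding_is_hom[OF carrier_is_subring], of "\<ominus> a"] a
      by simp
    have Xt: "X \<ominus>\<^bsub>poly_ring R\<^esub> poly_of_const a = ?t"
      unfolding a_minus_def nc using a a0
      by (auto simp: univ_poly_add poly_of_const_def var_def)
    have c1: "poly_of_const a [^]\<^bsub>poly_ring R\<^esub> d = \<one>\<^bsub>poly_ring R\<^esub>"
    proof -
      interpret C: ring_hom_cring R "poly_ring R" poly_of_const
        using canonical_embedding_is_hom[OF carrier_is_subring] is_cring P.is_cring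
        by (auto simp: ring_hom_cring_def ring_hom_cring_axioms_def)
      show ?thesis using C.hom_pow[OF a(1), of d] a(2) by simp
    qed
    obtain s where s: "s \<in> carrier (poly_ring R)" "?u = ?t \<otimes>\<^bsub>poly_ring R\<^esub> s" "a \<otimes> eval s a = [d] \<cdot> (a [^] d)"
      using unity_poly_factor[OF a(1), of d] unfolding Xt c1 unity_poly_def[OF carrier_is_subfield] by blast
    \<comment> \<open>Two factorizations of \<open>?u\<close> are compared; cancelling one linear
      factor shows that \<open>s\<close> still contains another.\<close>
    have "?t \<otimes>\<^bsub>poly_ring R\<^esub> s = ?t \<otimes>\<^bsub>poly_ring R\<^esub> (?t \<otimes>\<^bsub>poly_ring R\<^esub> q)"
      using s(2) q t by (simp add: P.m_assoc numeral_2_eq_2)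
    then have "s = ?t \<otimes>\<^bsub>poly_ring R\<^esub> q"
      using P.m_lcancel[OF _ t s(1)] t q(1) by (simp add: univ_poly_zero)
    moreover have "eval ?t a = \<zero>" using a by (simp add: r_neg)
    ultimately have "eval s a = \<zero>"
      using eval_is_hom[OF carrier_is_subring a(1)] t q(1) ring_hom_mult[of "\<lambda>p. eval p a" "poly_ring R" R ?t q]
        ring_hom_closed[of "\<lambda>p. eval p a" "poly_ring R" R q]
      by (simp del: eval.simps)
    then show False using s(3) a d(2) by simp
  qed
  then have "size (roots ?u) = card (set_mset (roots ?u))"
    by (simp add: size_multiset_overloaded_eq)
  then show ?thesis using split rt u(2) unfolding splitted_def by simp
qed

end

section \<open>Commutative semisimple rings are reduced\<close>

lemma (in domain) nat_pow_zero_imp_zero: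
  "x \<in> carrier R \<Longrightarrow> x [^] (k::nat) = \<zero> \<Longrightarrow> x = \<zero>"
  by (induction k) (auto simp: integral_iff)

text \<open>Each summand is a quotient of the commutative ring \<open>R\<close>, hence commutative,
  and a simple commutative ring is a field. So all components of a nilpotent element vanish.\<close>

lemma semisimple_ring_reduced:
  assumes "cring R" "semisimple_ring R" "a \<in> carrier R" "a [^]\<^bsub>R\<^esub> (k::nat) = \<zero>\<^bsub>R\<^esub>"
  shows "a = \<zero>\<^bsub>R\<^esub>"
proof -
  interpret R: cring R by fact
  obtain r and F :: "nat \<Rightarrow> 'a ring" and h
    where F: "\<And>j. j < r \<Longrightarrow> simple_ring (F j)" and h: "h \<in> ring_iso R (product_ring {..<r} F)"
    using assms(2) unfolding semisimple_ring_def is_ring_iso_def by blast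
  have hh: "h \<in> ring_hom R (product_ring {..<r} F)" and hb: "bij_betw h (carrier R) (carrier (product_ring {..<r} F))"
    using h by (auto simp: ring_iso_def)
  have hc: "h x \<in> (\<Pi>\<^sub>E j\<in>{..<r}. carrier (F j))" if "x \<in> carrier R" for x
    using ring_hom_closed[OF hh that] by (simp add: product_ring_def)
  have comp: "h a j = h \<zero>\<^bsub>R\<^esub> j" if j: "j < r" for j
  proof -
    interpret F: ring "F j" using F[OF j] by (simp add: simple_ring_def)
    interpret H: ring_hom_ring R "F j" "\<lambda>x. h x j"
    proof (intro ring_hom_ringI R.ring_axioms F.ring_axioms)
      fix x y assume xy: "x \<in> carrier R" "y \<in> carrier R"
      show "h (x \<otimes>\<^bsub>R\<^esub> y) j = h x j \<otimes>\<^bsub>F j\<^esub> h y j" "h (x \<oplus>\<^bsub>R\<^esub> y) j = h x j \<oplus>\<^bsub>F j\<^esub> h y j"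
        using ring_hom_mult[OF hh xy] ring_hom_add[OF hh xy] j by (simp_all add: product_ring_def)
    next
      show "h \<one>\<^bsub>R\<^esub> j = \<one>\<^bsub>F j\<^esub>" using ring_hom_one[OF hh] j by (simp add: product_ring_def)
    qed (use hc j in auto)
    have surj: "\<exists>x \<in> carrier R. h x j = b" if b: "b \<in> carrier (F j)" for b
    proof -
      \<comment> \<open>Extending \<open>b\<close> by zeros gives an element of the whole product;
        surjectivity of \<open>h\<close> thereby passes to each component.\<close>
      define y where "y = (\<lambda>i\<in>{..<r}. if i = j then b else \<zero>\<^bsub>F i\<^esub>)"
      have "\<zero>\<^bsub>F i\<^esub> \<in> carrier (F i)" if "i < r" for i
        using F[OF that] ring.ring_simprules(2) by (auto simp: simple_ring_def)
      then have "y \<in> carrier (product_ring {..<r} F)" using b by (auto simp: product_ring_def y_def)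
      then have "y \<in> h ` carrier R" using hb by (simp add: bij_betw_def)
      moreover have "y j = b" using j by (simp add: y_def)
      ultimately show ?thesis by auto
    qed
    interpret F: cring "F j"
    proof (intro cring.intro F.ring_axioms F.monoid_comm_monoidI)
      fix x y assume "x \<in> carrier (F j)" "y \<in> carrier (F j)"
      then obtain u v where uv: "u \<in> carrier R" "v \<in> carrier R" "x = h u j" "y = h v j"
        using surj by metis
      then show "x \<otimes>\<^bsub>F j\<^esub> y = y \<otimes>\<^bsub>F j\<^esub> x" using H.hom_mult[of u v] H.hom_mult[of v u] R.m_comm[of u v] by simp
    qed
    have "field (F j)"
    proof (rule F.trivialideals_fieldI)
      show "carrier (F j) \<noteq> {\<zero>\<^bsub>F j\<^esub>}" using F[OF j] F.one_closed by (auto simp: simple_ring_def)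
      show "{I. ideal I (F j)} = {{\<zero>\<^bsub>F j\<^esub>}, carrier (F j)}"
        using F[OF j] F.zeroideal F.oneideal by (auto simp: simple_ring_def)
    qed
    then interpret F: field "F j" .
    have "h a j [^]\<^bsub>F j\<^esub> k = \<zero>\<^bsub>F j\<^esub>"
      using H.hom_nat_pow[OF assms(3), of k] assms(4) H.hom_zero by simp
    then have "h a j = \<zero>\<^bsub>F j\<^esub>"
      using F.nat_pow_zero_imp_zero H.hom_closed[OF assms(3)] by blast
    then show ?thesis using H.hom_zero by simp
  qed
  have "h a = h \<zero>\<^bsub>R\<^esub>"
    by (rule PiE_ext[OF hc[OF assms(3)] hc[OF R.zero_closed]]) (simp add: comp)
  then show ?thesis using hb assms(3) by (meson bij_betw_def inj_on_def R.zero_closed)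
qed

text \<open>Dedekind's argument, by induction on the number of characters. Subtracting
  \<open>chi u t\<close> times the relation at \<open>v\<close> from the relation at
  \<open>mul t v\<close> eliminates \<open>u\<close> and leaves the coefficients
  \<open>c w \<otimes> (chi w t \<ominus> chi u t)\<close>. Here \<open>t\<close> is chosen for one
  \<open>w\<close> at a time, so that the second factor is nonzero for this
  \<open>w\<close>.\<close>

lemma (in field) characters_independent:
  assumes "finite F" and "V \<noteq> {}"
    and closed: "\<And>t v. t \<in> V \<Longrightarrow> v \<in> V \<Longrightarrow> mul t v \<in> V"
    and chi: "\<And>w v. w \<in> F \<Longrightarrow> v \<in> V \<Longrightarrow> chi w v \<in> carrier R - {\<zero>}"
    and mult: "\<And>w t v. w \<in> F \<Longrightarrow> t \<in> V \<Longrightarrow> v \<in> V \<Longrightarrow> chi w (mul t v) = chi w t \<otimes> chi w v"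
    and sep: "\<And>w u. w \<in> F \<Longrightarrow> u \<in> F \<Longrightarrow> w \<noteq> u \<Longrightarrow> \<exists>t\<in>V. chi w t \<noteq> chi u t"
    and c: "\<And>w. w \<in> F \<Longrightarrow> c w \<in> carrier R"
    and zero: "\<And>v. v \<in> V \<Longrightarrow> (\<Oplus>w\<in>F. c w \<otimes> chi w v) = \<zero>"
    and w: "w \<in> F"
  shows "c w = \<zero>"
  using assms
proof (induction F arbitrary: c w rule: finite_induct)
  case empty
  then show ?case by simp
next
  case (insert u F)
  have cc: "c w \<in> carrier R" if "w \<in> insert u F" for w using insert.prems(6) that by simp
  have ch: "chi w v \<in> carrier R" if "w \<in> insert u F" "v \<in> V" for w v using insert.prems(3) that by blast
  have split: "(\<Oplus>w\<in>F. c w \<otimes> chi w v) = \<ominus> (c u \<otimes> chi u v)" if v: "v \<in> V" for v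
  proof -
    have "c u \<otimes> chi u v \<oplus> (\<Oplus>w\<in>F. c w \<otimes> chi w v) = \<zero>"
      using insert.prems(7)[OF v] insert.hyps cc ch[OF _ v] by (subst (asm) finsum_insert) auto
    moreover have "(\<Oplus>w\<in>F. c w \<otimes> chi w v) \<in> carrier R"
      using cc ch[OF _ v] by (intro finsum_closed) auto
    ultimately show ?thesis
      using cc[of u] ch[OF _ v, of u] by (metis a_comm insertI1 m_closed minus_equality minus_minus a_inv_closed)
  qed
  have F0: "c w = \<zero>" if wF: "w \<in> F" for w
  proof -
    obtain t where t: "t \<in> V" "chi w t \<noteq> chi u t" using insert.prems(5)[of w u] wF insert.hyps by blast
    have "c w \<otimes> (chi w t \<ominus> chi u t) = \<zero>"
    proof (rule insert.IH[of "\<lambda>w. c w \<otimes> (chi w t \<ominus> chi u t)"])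
      fix v assume v: "v \<in> V"
      have "(\<Oplus>w\<in>F. c w \<otimes> (chi w t \<ominus> chi u t) \<otimes> chi w v)
          = (\<Oplus>w\<in>F. c w \<otimes> chi w (mul t v) \<oplus> (\<ominus> chi u t) \<otimes> (c w \<otimes> chi w v))"
      proof (rule finsum_cong')
        fix w assume "w \<in> F"
        then have "c w \<in> carrier R" "chi w t \<in> carrier R" "chi w v \<in> carrier R" "chi u t \<in> carrier R"
          "chi w (mul t v) = chi w t \<otimes> chi w v"
          using cc ch t(1) v insert.prems(4) by auto
        then show "c w \<otimes> (chi w t \<ominus> chi u t) \<otimes> chi w v
          = c w \<otimes> chi w (mul t v) \<oplus> (\<ominus> chi u t) \<otimes> (c w \<otimes> chi w v)"
          by (simp only:) algebra
      qed (use cc ch t(1) v insert.prems(2) in auto)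
      also have "\<dots> = (\<Oplus>w\<in>F. c w \<otimes> chi w (mul t v)) \<oplus> (\<Oplus>w\<in>F. (\<ominus> chi u t) \<otimes> (c w \<otimes> chi w v))"
        by (rule finsum_addf) (use cc ch t(1) v insert.prems(2) in auto)
      also have "(\<Oplus>w\<in>F. (\<ominus> chi u t) \<otimes> (c w \<otimes> chi w v)) = (\<ominus> chi u t) \<otimes> (\<Oplus>w\<in>F. c w \<otimes> chi w v)"
        by (rule finsum_rdistr[symmetric]) (use cc ch t(1) v insert.hyps in auto)
      also have "(\<Oplus>w\<in>F. c w \<otimes> chi w (mul t v)) = \<ominus> (c u \<otimes> (chi u t \<otimes> chi u v))"
        using split[OF insert.prems(2)[OF t(1) v]] insert.prems(4)[of u, OF _ t(1) v] by simp
      also have "(\<Oplus>w\<in>F. c w \<otimes> chi w v) = \<ominus> (c u \<otimes> chi u v)"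
        using split[OF v] .
      also have "\<ominus> (c u \<otimes> (chi u t \<otimes> chi u v)) \<oplus> \<ominus> chi u t \<otimes> \<ominus> (c u \<otimes> chi u v) = \<zero>"
        using cc[of u] ch[of u t] ch[of u v] t(1) v by simp algebra
      finally show "(\<Oplus>w\<in>F. c w \<otimes> (chi w t \<ominus> chi u t) \<otimes> chi w v) = \<zero>" .
    qed (use insert.prems(1-5) cc ch t(1) wF in auto)
    then show ?thesis
      using integral[of "c w" "chi w t \<ominus> chi u t"] cc[of w] ch[of w t] ch[of u t] t wF by auto
  qed
  moreover have "c u = \<zero>"
  proof -
    obtain v where v: "v \<in> V" using insert.prems(1) by blast
    have "(\<Oplus>w\<in>F. c w \<otimes> chi w v) = (\<Oplus>w\<in>F. \<zero>)"
      by (rule finsum_cong') (use F0 ch v in auto)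
    then have "c u \<otimes> chi u v = \<zero>"
      using split[OF v] cc[of u] ch[of u v] v by (metis finsum_zero insertI1 m_closed minus_minus minus_zero)
    then show ?thesis
      using integral cc[of u] insert.prems(3)[of u v] v by auto
  qed
  ultimately show ?case using insert.prems(8) by auto
qed

section \<open>Evaluation on the circulant variety\<close>

text \<open>Otherwise all \<open>d\<close> roots of \<open>X^d - 1\<close> would also be roots of
  \<open>X^(b - a) - 1\<close>, whose degree is smaller than \<open>d\<close>.\<close>

lemma (in field) exists_unity_root_separating:
  assumes "card {z \<in> carrier R. z [^] (d::nat) = \<one>} = d" "a < b" "(b::nat) < d"
  shows "\<exists>z \<in> carrier R. z [^] d = \<one> \<and> z [^] a \<noteq> z [^] b"
proof (rule ccontr)
  assume neg: "\<not> ?thesis"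
  have sub: "{z \<in> carrier R. z [^] d = \<one>} \<subseteq> {z \<in> carrier R. z [^] (b - a) = \<one>}"
  proof
    fix z assume "z \<in> {z \<in> carrier R. z [^] d = \<one>}"
    then have z: "z \<in> carrier R" "z [^] d = \<one>" by auto
    have "z [^] a \<otimes> z [^] (b - a) = z [^] b"
      using z(1) assms(2) by (simp add: nat_pow_mult)
    also have "\<dots> = z [^] a \<otimes> \<one>" using neg z by auto
    finally have "z [^] a \<otimes> z [^] (b - a) = z [^] a \<otimes> \<one>" .
    moreover have "z [^] a \<noteq> \<zero>"
      using nat_pow_zero_imp_zero[OF z(1)] root_of_unity_nonzero[OF z] assms(3) by auto
    ultimately show "z \<in> {z \<in> carrier R. z [^] (b - a) = \<one>}"
      using z(1) m_lcancel[of "z [^] a" "z [^] (b - a)" \<one>] by simp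
  qed
  have "d \<le> card {z \<in> carrier R. z [^] (b - a) = \<one>}"
    using card_mono[OF card_unity_roots_le(1)[of "b - a"] sub] assms(1,2) by simp
  also have "\<dots> \<le> b - a" using card_unity_roots_le(2)[of "b - a"] assms(2) by simp
  finally show False using assms(3) by simp
qed

section \<open>The circulant ideal, its variety and separable exponents\<close>

locale circulant = algebraic_closure L K for L :: "('a, 'b) ring_scheme" (structure) and K +
  fixes n :: nat and m :: "nat \<Rightarrow> nat"
  assumes pos: "i \<in> {1..n} \<Longrightarrow> m i > 0"
    and semisimple: "semisimple_ring (circulant_ring L K n m)"
begin

\<comment> \<open>Rewriting \<open>{1..n}\<close> to \<open>{Suc 0..n}\<close> would keep the ring rules for \<open>P\<close> below from applying.\<close>
declare One_nat_def [simp del]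

abbreviation "P \<equiv> poly_vars L K n"
abbreviation "J \<equiv> circulant_ideal L K n m"
abbreviation "V \<equiv> circulant_variety L K n m"
abbreviation "E \<equiv> adjoin_unity_roots L K n m"
abbreviation "G \<equiv> circulant_Gal L K n m"
abbreviation "act \<equiv> geometric_action L K n m"

abbreviation var_pow_minus_one :: "nat \<Rightarrow> nat \<Rightarrow> (nat multiset \<Rightarrow> 'a)"
  where "var_pow_minus_one i d \<equiv> indexed_var i [^]\<^bsub>P\<^esub> d \<ominus>\<^bsub>P\<^esub> \<one>\<^bsub>P\<^esub>"

lemma K_subring: "subring K L"
  using subfieldE(1)[OF subfield_axioms] .

lemma K_subset_carrier: "K \<subseteq> carrier L"
  using subringE(1)[OF K_subring] .

sublocale P: cring P
  by (rule mpoly_ring_cring[OF K_subring])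

lemma P_carrier: "carrier P = indexed_pset {1..n} K"
  by (simp add: mpoly_ring_def)

lemma P_ops: "\<one>\<^bsub>P\<^esub> = indexed_const \<one>" "\<zero>\<^bsub>P\<^esub> = indexed_const \<zero>" "f \<oplus>\<^bsub>P\<^esub> g = indexed_padd f g"
  by (simp_all add: mpoly_ring_def)

lemma var_in_P: "i \<in> {1..n} \<Longrightarrow> indexed_var i \<in> carrier P"
  by (simp add: P_carrier indexed_var_pset[OF K_subring])

sublocale J: ideal J P
  unfolding circulant_ideal_def by (rule P.genideal_ideal) (use var_in_P in auto)

lemma generator_in_J: "i \<in> {1..n} \<Longrightarrow> var_pow_minus_one i (m i) \<in> J"
  unfolding circulant_ideal_def
proof (rule subsetD[OF P.genideal_self imageI])
  show "(\<lambda>i. var_pow_minus_one i (m i)) ` {1..n} \<subseteq> carrier P" using var_in_P by auto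
qed

lemma J_minimal:
  assumes "ideal I P" "\<And>i. i \<in> {1..n} \<Longrightarrow> var_pow_minus_one i (m i) \<in> I"
  shows "J \<subseteq> I"
  unfolding circulant_ideal_def by (rule P.genideal_minimal) (use assms in auto)

lemma eval_hom: "x \<in> {1..n} \<rightarrow> carrier L \<Longrightarrow> ring_hom_cring P L (\<lambda>f. mpoly_eval L f x)"
  by (rule mpoly_eval_ring_hom[OF K_subring])

lemma eval_var_pow_minus_one:
  assumes "x \<in> {1..n} \<rightarrow> carrier L" "i \<in> {1..n}"
  shows "mpoly_eval L (var_pow_minus_one i d) x = x i [^] d \<ominus> \<one>"
proof -
  interpret ev: ring_hom_cring P L "\<lambda>f. mpoly_eval L f x" by (rule eval_hom[OF assms(1)])
  show ?thesis
    using var_in_P[OF assms(2)] mpoly_eval_var[OF K_subring assms] by (simp add: a_minus_def ev.hom_pow)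
qed

text \<open>The polynomials vanishing at \<open>x\<close> form an ideal, the kernel of evaluation,
  so it is enough to test the generators.\<close>

lemma V_iff: "x \<in> V \<longleftrightarrow> x \<in> {1..n} \<rightarrow>\<^sub>E carrier L \<and> (\<forall>i\<in>{1..n}. x i [^] m i = \<one>)"
proof
  assume x: "x \<in> V"
  then have xc: "x \<in> {1..n} \<rightarrow>\<^sub>E carrier L" by (simp add: circulant_variety_def)
  have "x i [^] m i = \<one>" if i: "i \<in> {1..n}" for i
  proof -
    have "x \<in> {1..n} \<rightarrow> carrier L" using xc by auto
    moreover have "mpoly_eval L (var_pow_minus_one i (m i)) x = \<zero>"
      using x generator_in_J[OF i] by (auto simp: circulant_variety_def)
    ultimately have "x i [^] m i \<ominus> \<one> = \<zero>" "x i \<in> carrier L"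
      using eval_var_pow_minus_one[of x i "m i"] i by (simp, blast)
    then show ?thesis using r_right_minus_eq[of "x i [^] m i" \<one>] by simp
  qed
  with xc show "x \<in> {1..n} \<rightarrow>\<^sub>E carrier L \<and> (\<forall>i\<in>{1..n}. x i [^] m i = \<one>)" by blast
next
  assume x: "x \<in> {1..n} \<rightarrow>\<^sub>E carrier L \<and> (\<forall>i\<in>{1..n}. x i [^] m i = \<one>)"
  then have xc: "x \<in> {1..n} \<rightarrow> carrier L" by auto
  interpret ev: ring_hom_cring P L "\<lambda>f. mpoly_eval L f x" by (rule eval_hom[OF xc])
  have "J \<subseteq> a_kernel P L (\<lambda>f. mpoly_eval L f x)"
  proof (rule J_minimal[OF ev.ring.kernel_is_ideal])
    fix i assume i: "i \<in> {1..n}"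
    have "x i \<in> carrier L" "x i [^] m i = \<one>" using x i by auto
    then have "mpoly_eval L (var_pow_minus_one i (m i)) x = \<zero>"
      using eval_var_pow_minus_one[OF xc i, of "m i"] by simp
    moreover have "var_pow_minus_one i (m i) \<in> carrier P" using var_in_P[OF i] by simp
    ultimately show "var_pow_minus_one i (m i) \<in> a_kernel P L (\<lambda>f. mpoly_eval L f x)"
      unfolding a_kernel_def' by blast
  qed
  then show "x \<in> V" using x unfolding circulant_variety_def a_kernel_def' by blast
qed

lemma V_carrier: "x \<in> V \<Longrightarrow> x \<in> {1..n} \<rightarrow> carrier L"
  by (simp add: V_iff PiE_iff Pi_iff)

lemma finite_V: "finite V"
proof (rule finite_subset)
  show "V \<subseteq> (\<Pi>\<^sub>E i\<in>{1..n}. unity_roots L (m i))"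
    by (rule subsetI) (simp only: V_iff PiE_iff unity_roots_def mem_Collect_eq, blast)
  show "finite (\<Pi>\<^sub>E i\<in>{1..n}. unity_roots L (m i))"
    by (rule finite_PiE) (use card_unity_roots_le(1) pos in \<open>auto simp: unity_roots_def\<close>)
qed

lemma eval_J: "f \<in> J \<Longrightarrow> x \<in> V \<Longrightarrow> mpoly_eval L f x = \<zero>"
  by (simp add: circulant_variety_def)

text \<open>This is where semisimplicity enters: the residue class of \<open>f\<close> is nilpotent
  in a reduced ring.\<close>

lemma J_radical:
  assumes "f \<in> carrier P" "f [^]\<^bsub>P\<^esub> (k::nat) \<in> J"
  shows "f \<in> J"
proof -
  interpret Q: cring "P Quot J" by (rule J.quotient_is_cring[OF P.is_cring])
  interpret q: ring_hom_ring P "P Quot J" "(+>\<^bsub>P\<^esub>) J"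
    by (rule J.rcos_ring_hom_ring)
  have "(J +>\<^bsub>P\<^esub> f) [^]\<^bsub>P Quot J\<^esub> k = J +>\<^bsub>P\<^esub> (f [^]\<^bsub>P\<^esub> k)"
    using q.hom_nat_pow[OF assms(1)] by simp
  also have "\<dots> = J" by (rule J.a_rcos_const[OF assms(2)])
  also have zero: "J = \<zero>\<^bsub>P Quot J\<^esub>" by (simp only: FactRing_def ring.select_convs)
  finally have "J +>\<^bsub>P\<^esub> f = \<zero>\<^bsub>P Quot J\<^esub>"
    using semisimple_ring_reduced[OF Q.is_cring _ q.hom_closed[OF assms(1)]] semisimple
    unfolding circulant_ring_def by blast
  then show ?thesis using J.a_rcos_self[OF assms(1)] zero by simp
qed

lemma P_add_pow_one:
  assumes "[(p::nat)] \<cdot> \<one> = \<zero>"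
  shows "[p] \<cdot>\<^bsub>P\<^esub> \<one>\<^bsub>P\<^esub> = \<zero>\<^bsub>P\<^esub>"
proof -
  have "[q] \<cdot>\<^bsub>P\<^esub> \<one>\<^bsub>P\<^esub> = indexed_const ([q] \<cdot> \<one>)" for q :: nat
  proof (induction q)
    case 0
    show ?case using P_ops(2) by simp
  next
    case (Suc q)
    have "[Suc q] \<cdot>\<^bsub>P\<^esub> \<one>\<^bsub>P\<^esub> = [q] \<cdot>\<^bsub>P\<^esub> \<one>\<^bsub>P\<^esub> \<oplus>\<^bsub>P\<^esub> \<one>\<^bsub>P\<^esub>" by simp
    then show ?case unfolding Suc by (simp add: P_ops indexed_padd_const)
  qed
  then show ?thesis using assms by (simp add: P_ops(2))
qed

lemma exists_separable_exponent:
  assumes i: "i \<in> {1..n}"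
  shows "\<exists>d > 0. d dvd m i \<and> var_pow_minus_one i d \<in> J \<and> card {z \<in> carrier L. z [^] d = \<one>} = d"
proof -
  \<comment> \<open>Divisors of \<open>m i\<close> are required so that roots of unity of exponent
    \<open>d\<close> still occur as coordinates of points of \<open>V\<close>.\<close>
  let ?Q = "\<lambda>d. d > 0 \<and> d dvd m i \<and> var_pow_minus_one i d \<in> J"
  define d where "d = (LEAST d. ?Q d)"
  have d: "?Q d"
    unfolding d_def by (rule LeastI[of ?Q "m i"]) (use pos[OF i] generator_in_J[OF i] in simp)
  have d_min: "d \<le> e" if "?Q e" for e unfolding d_def using that by (rule Least_le)
  have "[d] \<cdot> \<one> \<noteq> \<zero>"
  proof
    assume "[d] \<cdot> \<one> = \<zero>"
    then obtain p where p: "Factorial_Ring.prime p" "p dvd d" "[p] \<cdot> \<one> = \<zero>"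
      using add_pow_zero_imp_prime d by blast
    then obtain e where e: "d = e * p" by (metis dvdE mult.commute)
    have v: "indexed_var i \<in> carrier P" using var_in_P[OF i] .
    let ?f = "var_pow_minus_one i e"
    have f: "?f \<in> carrier P" using v by simp
    have fe: "?f \<oplus>\<^bsub>P\<^esub> \<one>\<^bsub>P\<^esub> = indexed_var i [^]\<^bsub>P\<^esub> e"
      using v by (simp add: a_minus_def P.a_assoc P.l_neg)
    have "(?f \<oplus>\<^bsub>P\<^esub> \<one>\<^bsub>P\<^esub>) [^]\<^bsub>P\<^esub> p = ?f [^]\<^bsub>P\<^esub> p \<oplus>\<^bsub>P\<^esub> \<one>\<^bsub>P\<^esub> [^]\<^bsub>P\<^esub> p"
      by (rule P.frobenius_add[OF f P.one_closed p(1) P_add_pow_one[OF p(3)]])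
    then have "indexed_var i [^]\<^bsub>P\<^esub> d = ?f [^]\<^bsub>P\<^esub> p \<oplus>\<^bsub>P\<^esub> \<one>\<^bsub>P\<^esub>"
      unfolding fe e using v by (simp add: P.nat_pow_pow)
    then have "var_pow_minus_one i d = ?f [^]\<^bsub>P\<^esub> p"
      using f by (simp add: a_minus_def P.a_assoc P.r_neg)
    then have "?f \<in> J" using J_radical[OF f, of p] d by simp
    then have "d \<le> e" using d_min[of e] d e by (auto intro: dvd_mult_left)
    then show False using e d prime_gt_1_nat[OF p(1)] by auto
  qed
  then have "card {z \<in> carrier L. z [^] d = \<one>} = d"
    using card_unity_roots_eq d roots_over_carrier unity_poly(1)[OF carrier_is_subfield] by blast
  with d show ?thesis by blast
qed

text \<open>In fact \<open>sep_exp i = m i\<close>, but the proof does not depend on it.\<close>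

definition sep_exp :: "nat \<Rightarrow> nat"
  where "sep_exp i = (SOME d. d > 0 \<and> d dvd m i \<and> var_pow_minus_one i d \<in> J \<and> card {z \<in> carrier L. z [^] d = \<one>} = d)"

lemma sep_exp:
  assumes "i \<in> {1..n}"
  shows "sep_exp i > 0" "sep_exp i dvd m i" "var_pow_minus_one i (sep_exp i) \<in> J"
    "card {z \<in> carrier L. z [^] sep_exp i = \<one>} = sep_exp i"
proof -
  have "sep_exp i > 0 \<and> sep_exp i dvd m i \<and> var_pow_minus_one i (sep_exp i) \<in> J
      \<and> card {z \<in> carrier L. z [^] sep_exp i = \<one>} = sep_exp i"
    unfolding sep_exp_def by (rule someI_ex[OF exists_separable_exponent[OF assms]])
  then show "sep_exp i > 0" "sep_exp i dvd m i" "var_pow_minus_one i (sep_exp i) \<in> J"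
    "card {z \<in> carrier L. z [^] sep_exp i = \<one>} = sep_exp i" by simp_all
qed

section \<open>Representatives with bounded exponents, and the polynomials vanishing on the
  variety\<close>

definition reduced_monom :: "nat multiset \<Rightarrow> bool"
  where "reduced_monom w \<longleftrightarrow> set_mset w \<subseteq> {1..n} \<and> (\<forall>i\<in>{1..n}. count w i < sep_exp i)"

lemma monom_in_P: "k \<in> K \<Longrightarrow> set_mset w \<subseteq> {1..n} \<Longrightarrow> mpoly_monom L k w \<in> carrier P"
  by (simp add: P_carrier mpoly_monom_pset[OF K_subring])

lemma J_congruence_trans:
  assumes "f \<in> carrier P" "g \<in> carrier P" "h \<in> carrier P" "f \<ominus>\<^bsub>P\<^esub> g \<in> J" "g \<ominus>\<^bsub>P\<^esub> h \<in> J"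
  shows "f \<ominus>\<^bsub>P\<^esub> h \<in> J"
proof -
  have "f \<ominus>\<^bsub>P\<^esub> h = (f \<ominus>\<^bsub>P\<^esub> g) \<oplus>\<^bsub>P\<^esub> (g \<ominus>\<^bsub>P\<^esub> h)"
    using assms(1-3) by (simp add: a_minus_def P.a_assoc P.add.inv_solve_left P.r_neg1 P.r_neg2)
  then show ?thesis using J.a_closed[OF assms(4,5)] by simp
qed

text \<open>If the exponent of \<open>X_i\<close> is at least \<open>d = sep_exp i\<close>, lowering
  it by \<open>d\<close> changes the monomial by the smaller monomial times
  \<open>X_i^d - 1\<close>, which lies in \<open>J\<close>. The total degree drops, so this
  terminates.\<close>

lemma monom_reduction:
  assumes "k \<in> K" "set_mset w \<subseteq> {1..n}"
  shows "\<exists>r. reduced_monom r \<and> mpoly_monom L k w \<ominus>\<^bsub>P\<^esub> mpoly_monom L k r \<in> J"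
  using assms(2)
proof (induction w rule: measure_induct_rule[of size])
  case (less w)
  show ?case
  proof (cases "reduced_monom w")
    case True
    then show ?thesis
      using monom_in_P[OF assms(1) less.prems] J.zero_closed by (intro exI[of _ w]) (simp add: a_minus_def P.r_neg)
  next
    case False
    then obtain i where i: "i \<in> {1..n}" "sep_exp i \<le> count w i"
      using less.prems by (auto simp: reduced_monom_def not_less)
    define w' where "w' = w - replicate_mset (sep_exp i) i"
    have w: "w = w' + replicate_mset (sep_exp i) i"
      using i(2) by (simp add: w'_def count_le_replicate_mset_subset_eq)
    have "set_mset w' \<subseteq> set_mset w" unfolding w by simp
    then have w'_sub: "set_mset w' \<subseteq> {1..n}" using less.prems by (rule subset_trans)
    have "size w' < size w" using sep_exp(1)[OF i(1)] by (simp add: w)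
    then obtain r where r: "reduced_monom r" "mpoly_monom L k w' \<ominus>\<^bsub>P\<^esub> mpoly_monom L k r \<in> J"
      using less.IH w'_sub by blast
    have v: "indexed_var i \<in> carrier P" using var_in_P[OF i(1)] .
    have mw': "mpoly_monom L k w' \<in> carrier P" using monom_in_P[OF assms(1) w'_sub] .
    have "mpoly_monom L k w' \<otimes>\<^bsub>P\<^esub> var_pow_minus_one i (sep_exp i) \<in> J"
      using J.I_l_closed[OF sep_exp(3)[OF i(1)] mw'] .
    moreover have "mpoly_monom L k w' \<otimes>\<^bsub>P\<^esub> var_pow_minus_one i (sep_exp i)
        = mpoly_monom L k w \<ominus>\<^bsub>P\<^esub> mpoly_monom L k w'"
      using mpoly_monom_mult_var_pow[OF K_subring assms(1) w'_sub i(1), of "sep_exp i"] v mw'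
      by (simp add: a_minus_def P.r_distr P.r_minus w)
    ultimately have "mpoly_monom L k w \<ominus>\<^bsub>P\<^esub> mpoly_monom L k w' \<in> J" by simp
    then have "mpoly_monom L k w \<ominus>\<^bsub>P\<^esub> mpoly_monom L k r \<in> J"
      using J_congruence_trans[OF _ mw' _ _ r(2)] monom_in_P[OF assms(1)] less.prems r(1)
      by (auto simp: reduced_monom_def)
    then show ?thesis using r(1) by blast
  qed
qed

lemma reduction:
  assumes "f \<in> carrier P"
  shows "\<exists>g \<in> carrier P. (\<forall>w. g w \<noteq> \<zero> \<longrightarrow> reduced_monom w) \<and> f \<ominus>\<^bsub>P\<^esub> g \<in> J"
  using assms unfolding P_carrier
proof (induction f rule: indexed_pset_monom_induct[OF K_subring, consumes 1, case_names monom add])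
  case (monom k w)
  then obtain r where r: "reduced_monom r" "mpoly_monom L k w \<ominus>\<^bsub>P\<^esub> mpoly_monom L k r \<in> J"
    using monom_reduction by blast
  moreover have "mpoly_monom L k r \<in> carrier P" using monom_in_P[OF monom(1)] r(1) by (auto simp: reduced_monom_def)
  moreover have "reduced_monom u" if "mpoly_monom L k r u \<noteq> \<zero>" for u
    using that r(1) by (auto simp: mpoly_monom_def split: if_splits)
  ultimately show ?case unfolding P_carrier by blast
next
  case (add f f')
  obtain g where g: "g \<in> carrier P" "\<And>w. g w \<noteq> \<zero> \<Longrightarrow> reduced_monom w" "f \<ominus>\<^bsub>P\<^esub> g \<in> J"
    using add by (auto simp: P_carrier)
  obtain g' where g': "g' \<in> carrier P" "\<And>w. g' w \<noteq> \<zero> \<Longrightarrow> reduced_monom w" "f' \<ominus>\<^bsub>P\<^esub> g' \<in> J"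
    using add by (auto simp: P_carrier)
  have f: "f \<in> carrier P" "f' \<in> carrier P" using add by (auto simp: P_carrier)
  have "f \<oplus>\<^bsub>P\<^esub> f' \<ominus>\<^bsub>P\<^esub> (g \<oplus>\<^bsub>P\<^esub> g') = (f \<ominus>\<^bsub>P\<^esub> g) \<oplus>\<^bsub>P\<^esub> (f' \<ominus>\<^bsub>P\<^esub> g')"
    using f g(1) g'(1) by (simp add: a_minus_def P.minus_add P.a_ac)
  then have "f \<oplus>\<^bsub>P\<^esub> f' \<ominus>\<^bsub>P\<^esub> (g \<oplus>\<^bsub>P\<^esub> g') \<in> J" using J.a_closed[OF g(3) g'(3)] by simp
  moreover have "f \<oplus>\<^bsub>P\<^esub> f' = indexed_padd f f'" "g \<oplus>\<^bsub>P\<^esub> g' = indexed_padd g g'"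
    by (simp_all add: mpoly_ring_def)
  moreover have "reduced_monom w" if "indexed_padd g g' w \<noteq> \<zero>" for w
    using that g(2)[of w] g'(2)[of w]
    by (cases "g w = \<zero>"; cases "g' w = \<zero>") (auto simp: indexed_padd_def)
  moreover have "g \<oplus>\<^bsub>P\<^esub> g' \<in> carrier P" using g(1) g'(1) by simp
  ultimately show ?case unfolding P_carrier by (metis (no_types, lifting))
qed

text \<open>A point with a single nontrivial coordinate isolates one exponent of a monomial. Two
  different reduced monomials differ in some exponent below \<open>sep_exp i\<close>, and a suitable
  \<open>z\<close> then tells them apart.\<close>

lemma unity_point_in_V:
  assumes "i \<in> {1..n}" "z \<in> carrier L" "z [^] sep_exp i = \<one>"
  shows "(\<lambda>j\<in>{1..n}. if j = i then z else \<one>) \<in> V"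
proof -
  obtain q where "m i = sep_exp i * q" using sep_exp(2)[OF assms(1)] by blast
  then have "z [^] m i = \<one>" using assms(2,3) by (simp flip: nat_pow_pow)
  then show ?thesis using assms(1,2) by (auto simp: V_iff)
qed

lemma monom_eval_unity_point:
  assumes "i \<in> {1..n}" "z \<in> carrier L" "set_mset w \<subseteq> {1..n}"
  shows "monom_eval L w (\<lambda>j\<in>{1..n}. if j = i then z else \<one>) = z [^] count w i"
  using assms(3)
proof (induction w)
  case (add j w)
  define f where "f = (\<lambda>j\<in>{1..n}. if j = i then z else \<one>)"
  have f: "f k = (if k = i then z else \<one>)" if "k \<in> {1..n}" for k using that by (simp add: f_def)
  have j: "j \<in> {1..n}" and w: "set_mset w \<subseteq> {1..n}" using add.prems by simp_all
  have fc: "f k \<in> carrier L" if "k \<in> {1..n}" for k using f[OF that] assms(2) by simp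
  then have "f \<in> set_mset w \<rightarrow> carrier L" "f j \<in> carrier L" using w j by auto
  then have "monom_eval L (add_mset j w) f = f j \<otimes> z [^] count w i"
    using add.IH[OF w] by (simp add: monom_eval_add_mset flip: f_def)
  then show ?case using f[OF j] assms(2) by (simp add: m_comm flip: f_def)
qed simp

lemma vanishing_imp_in_J:
  assumes f: "f \<in> carrier P" and zero: "\<And>v. v \<in> V \<Longrightarrow> mpoly_eval L f v = \<zero>"
  shows "f \<in> J"
proof -
  obtain g where g: "g \<in> carrier P" "\<And>w. g w \<noteq> \<zero> \<Longrightarrow> reduced_monom w" "f \<ominus>\<^bsub>P\<^esub> g \<in> J"
    using reduction[OF f] by blast
  have g0: "mpoly_eval L g v = \<zero>" if v: "v \<in> V" for v
  proof -
    interpret ev: ring_hom_cring P L "\<lambda>f. mpoly_eval L f v" by (rule eval_hom[OF V_carrier[OF v]])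
    have "mpoly_eval L f v \<ominus> mpoly_eval L g v = \<zero>"
      using eval_J[OF g(3) v] f g(1) by (simp add: a_minus_def)
    then show ?thesis using zero[OF v] g(1) by simp
  qed
  note supp = indexed_pset_support[OF K_subring, of g "{1..n}"]
  have gK: "g \<in> indexed_pset {1..n} K" using g(1) by (simp add: P_carrier)
  have mul_V: "(\<lambda>i\<in>{1..n}. t i \<otimes> v i) \<in> V" if "t \<in> V" "v \<in> V" for t v
    using that unfolding V_iff by (auto simp: nat_pow_distrib PiE_iff)
  have V_nonzero: "v \<in> {1..n} \<rightarrow> carrier L - {\<zero>}" if "v \<in> V" for v
  proof
    fix i assume i: "i \<in> {1..n}"
    have "v i \<in> carrier L" "v i [^] m i = \<one>" using that i unfolding V_iff by auto
    then show "v i \<in> carrier L - {\<zero>}" using root_of_unity_nonzero pos[OF i] by blast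
  qed
  have ne: "V \<noteq> {}"
  proof -
    have "(\<lambda>i\<in>{1..n}. \<one>) \<in> V" by (auto simp: V_iff)
    then show ?thesis by blast
  qed
  have "g w = \<zero>" for w
  proof (rule ccontr)
    assume w: "g w \<noteq> \<zero>"
    have "g w = \<zero>"
    \<comment> \<open>The index set is the support of \<open>g\<close>, so independence contradicts
      the choice of \<open>w\<close>. Reducedness provides the pairwise separation of the
      characters.\<close>
    proof (rule characters_independent[of "{w. g w \<noteq> \<zero>}" V "\<lambda>t v. \<lambda>i\<in>{1..n}. t i \<otimes> v i" "monom_eval L"])
      show "finite {w. g w \<noteq> \<zero>}" using supp(1)[OF gK] .
    next
      fix w v assume "w \<in> {w. g w \<noteq> \<zero>}" "v \<in> V"
      then show "monom_eval L w v \<in> carrier L - {\<zero>}"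
        using monom_eval_nonzero[OF _ V_nonzero] supp(2)[OF gK] by blast
    next
      fix w t v assume "w \<in> {w. g w \<noteq> \<zero>}" "t \<in> V" "v \<in> V"
      then show "monom_eval L w (\<lambda>i\<in>{1..n}. t i \<otimes> v i) = monom_eval L w t \<otimes> monom_eval L w v"
        using monom_eval_mult[OF _ V_carrier V_carrier] supp(2)[OF gK] by blast
    next
      fix w u assume wu: "w \<in> {w. g w \<noteq> \<zero>}" "u \<in> {w. g w \<noteq> \<zero>}" "w \<noteq> u"
      then have red: "reduced_monom w" "reduced_monom u" using g(2) by auto
      obtain i where i: "count w i \<noteq> count u i" using wu(3) multiset_eq_iff by blast
      then have iI: "i \<in> {1..n}" using red unfolding reduced_monom_def
        by (metis count_eq_zero_iff subsetD)
      have lt: "count w i < sep_exp i" "count u i < sep_exp i" using red iI by (auto simp: reduced_monom_def)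
      obtain z where z: "z \<in> carrier L" "z [^] sep_exp i = \<one>" "z [^] count w i \<noteq> z [^] count u i"
        using exists_unity_root_separating[OF sep_exp(4)[OF iI]] lt i by (metis nat_neq_iff)
      then show "\<exists>t\<in>V. monom_eval L w t \<noteq> monom_eval L u t"
        using unity_point_in_V[OF iI z(1,2)] monom_eval_unity_point[OF iI z(1)] red
        by (metis reduced_monom_def)
    next
      fix v assume "v \<in> V"
      then show "(\<Oplus>w\<in>{w. g w \<noteq> \<zero>}. g w \<otimes> monom_eval L w v) = \<zero>"
        using g0 by (simp add: mpoly_eval_def monom_eval_def)
    qed (use w ne mul_V supp(3)[OF gK] K_subset_carrier in auto)
    with w show False by simp
  qed
  then have "g = \<zero>\<^bsub>P\<^esub>" by (auto simp: mpoly_ring_def indexed_zero_def)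
  then show ?thesis using g(3) f by (simp add: a_minus_def)
qed

text \<open>A common multiple of all exponents, so that all coordinates of all points lie in one
  finite group of roots of unity.\<close>

definition N :: nat where "N = (\<Prod>i\<in>{1..n}. m i)"

lemma N_pos: "N > 0"
  using pos by (auto simp: N_def)

lemma unity_root_pow_N:
  assumes "i \<in> {1..n}" "z \<in> carrier L" "z [^] m i = \<one>"
  shows "z [^] N = \<one>"
proof -
  have "m i dvd N" unfolding N_def by (rule dvd_prodI) (use assms(1) in auto)
  then obtain q where "N = m i * q" by blast
  then show ?thesis using assms(2,3) by (simp flip: nat_pow_pow)
qed

abbreviation unity_set :: "'a set"
  where "unity_set \<equiv> \<Union>i\<in>{1..n}. unity_roots L (m i)"

lemma unity_set_subset: "unity_set \<subseteq> {z \<in> carrier L. z [^] N = \<one>}"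
  using unity_root_pow_N by (auto simp: unity_roots_def)

lemma point_subset: "x \<in> V \<Longrightarrow> x ` {1..n} \<subseteq> unity_set"
  by (auto simp: V_iff unity_roots_def)

section \<open>The Galois action on the variety\<close>

lemma E_subfield: "subfield E L"
  unfolding adjoin_unity_roots_def
  by (rule generate_field_is_subfield) (use unity_set_subset K_subset_carrier in blast)

lemma E_subring: "subring E L"
  using subfieldE(1)[OF E_subfield] .

lemma K_subset_E: "K \<subseteq> E"
  unfolding adjoin_unity_roots_def by (blast intro: generate_field.incl)

lemma point_in_E:
  assumes "x \<in> V" "i \<in> {1..n}"
  shows "x i \<in> E"
proof -
  have "x i \<in> unity_set" using point_subset[OF assms(1)] assms(2) by blast
  then show ?thesis unfolding adjoin_unity_roots_def by (intro generate_field.incl UnI2)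
qed

lemma Gal_ring_hom: "s \<in> carrier G \<Longrightarrow> s \<in> ring_hom (L\<lparr>carrier := E\<rparr>) L"
  using Gal_carrierD(1)[OF _ E_subring] .

lemma Gal_fix: "s \<in> carrier G \<Longrightarrow> k \<in> K \<Longrightarrow> s k = k"
  using Gal_carrierD(3)[OF _ E_subring] .

lemma Gal_pow:
  assumes s: "s \<in> carrier G" and z: "z \<in> E"
  shows "s (z [^] (k::nat)) = s z [^] k"
proof -
  have "s (z [^] k) = s z [^] k \<and> z [^] k \<in> E"
  proof (induction k)
    case 0
    then show ?case using subringE(3)[OF E_subring] ring_hom_one[OF Gal_ring_hom[OF s]] by simp
  next
    case (Suc k)
    then show ?case
      using subringE(6)[OF E_subring] ring_hom_mult[OF Gal_ring_hom[OF s], of "z [^] k" z] z by simp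
  qed
  then show ?thesis by simp
qed

lemma act_apply: "x \<in> V \<Longrightarrow> act s x = (\<lambda>i\<in>{1..n}. s (x i))"
  by (simp add: geometric_action_def)

lemma act_in_V:
  assumes s: "s \<in> carrier G" and x: "x \<in> V"
  shows "act s x \<in> V"
proof -
  have "s (x i) \<in> carrier L" "s (x i) [^] m i = \<one>" if i: "i \<in> {1..n}" for i
  proof -
    note xE = point_in_E[OF x i]
    show "s (x i) \<in> carrier L" using ring_hom_closed[OF Gal_ring_hom[OF s], of "x i"] xE by simp
    have "x i [^] m i = \<one>" using x i by (simp add: V_iff)
    then show "s (x i) [^] m i = \<one>"
      using Gal_pow[OF s xE, of "m i"] ring_hom_one[OF Gal_ring_hom[OF s]] by simp
  qed
  then show ?thesis unfolding act_apply[OF x] by (simp add: V_iff PiE_iff)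
qed

lemma Gal_inj:
  assumes "s \<in> carrier G" "a \<in> E" "b \<in> E" "s a = s b"
  shows "a = b"
  using Gal_carrierD(4)[OF assms(1) E_subring] assms(2-4) by (auto simp: Bij_def bij_betw_def inj_on_def)

lemma act_Bij:
  assumes s: "s \<in> carrier G"
  shows "act s \<in> Bij V"
proof -
  have inj: "inj_on (act s) V"
  proof (rule inj_onI)
    fix x y assume xy: "x \<in> V" "y \<in> V" "act s x = act s y"
    show "x = y"
    proof (rule PiE_ext)
      show "x \<in> {1..n} \<rightarrow>\<^sub>E carrier L" "y \<in> {1..n} \<rightarrow>\<^sub>E carrier L" using xy by (simp_all add: V_iff)
      fix i assume i: "i \<in> {1..n}"
      have "s (x i) = s (y i)" using xy i act_apply by (metis restrict_apply')
      then show "x i = y i" using Gal_inj[OF s] point_in_E i xy by blast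
    qed
  qed
  have "act s ` V = V"
    by (rule endo_inj_surj[OF finite_V _ inj]) (use act_in_V[OF s] in blast)
  then show ?thesis using inj by (simp add: Bij_def bij_betw_def geometric_action_def)
qed

sublocale action: group_action G V act
proof (intro group_action.intro group_hom.intro group_hom_axioms.intro)
  show "Group.group G" by (rule Gal_group[OF E_subring K_subset_E])
  show "Group.group (BijGroup V)" by (rule group_BijGroup)
  show "act \<in> hom G (BijGroup V)"
  proof (rule homI)
    fix s assume "s \<in> carrier G"
    then show "act s \<in> carrier (BijGroup V)" using act_Bij by (simp add: BijGroup_def)
  next
    fix s t assume s: "s \<in> carrier G" and t: "t \<in> carrier G"
    have "act (compose E s t) = compose V (act s) (act t)"
    proof
      fix x
      show "act (compose E s t) x = compose V (act s) (act t) x"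
      proof (cases "x \<in> V")
        case True
        have "act (compose E s t) x = (\<lambda>i\<in>{1..n}. s (t (x i)))"
          unfolding act_apply[OF True] by (rule restrict_ext) (simp add: compose_def point_in_E[OF True])
        also have "\<dots> = act s (act t x)"
          unfolding act_apply[OF act_in_V[OF t True]] by (rule restrict_ext) (simp add: act_apply[OF True])
        finally show ?thesis using True by (simp add: compose_def)
      qed (simp add: geometric_action_def compose_def)
    qed
    then show "act (s \<otimes>\<^bsub>G\<^esub> t) = act s \<otimes>\<^bsub>BijGroup V\<^esub> act t"
      using act_Bij[OF s] act_Bij[OF t] by (simp add: Gal_mult[OF s t] BijGroup_def)
  qed
qed

section \<open>Fields of points and sizes of orbits\<close>

abbreviation point_field :: "(nat \<Rightarrow> 'a) \<Rightarrow> 'a set"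
  where "point_field x \<equiv> adjoin_point L K n x"

lemma point_field_subfield: "x \<in> V \<Longrightarrow> subfield (point_field x) L"
  unfolding adjoin_point_def
  by (rule generate_field_is_subfield) (use V_carrier K_subset_carrier in blast)

lemma K_subset_point_field: "K \<subseteq> point_field x"
  unfolding adjoin_point_def by (blast intro: generate_field.incl)

lemma point_in_point_field: "i \<in> {1..n} \<Longrightarrow> x i \<in> point_field x"
  unfolding adjoin_point_def by (blast intro: generate_field.incl)

lemma point_field_subset_E:
  assumes "x \<in> V"
  shows "point_field x \<subseteq> E"
  unfolding adjoin_point_def
proof (rule generate_field_min_subfield1[OF _ E_subfield])
  show "K \<union> x ` {1..n} \<subseteq> carrier L" using V_carrier[OF assms] K_subset_carrier by blast
  show "K \<union> x ` {1..n} \<subseteq> E" using K_subset_E point_in_E[OF assms] by blast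
qed

lemma E_simple:
  obtains z where "z \<in> carrier L" "z [^] N = \<one>" "E = simple_extension K z"
  using generate_field_unity_simple[OF subfield_axioms unity_set_subset N_pos]
  unfolding adjoin_unity_roots_def by blast

lemma point_field_simple:
  assumes "x \<in> V"
  obtains z where "z \<in> carrier L" "z [^] N = \<one>" "point_field x = simple_extension K z"
  using generate_field_unity_simple[OF subfield_axioms subset_trans[OF point_subset[OF assms] unity_set_subset] N_pos]
  unfolding adjoin_point_def by blast

lemma stabilizer_eq:
  assumes x: "x \<in> V"
  shows "stabilizer G act x = carrier (Gal L E (point_field x))"
proof (intro subset_antisym subsetI)
  fix s assume "s \<in> stabilizer G act x"
  then have s: "s \<in> carrier G" "act s x = x" by (auto simp: stabilizer_def)
  have sx: "s (x i) = x i" if "i \<in> {1..n}" for i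
    using s(2) that unfolding act_apply[OF x] by (metis restrict_apply')
  have "s a = a" if "a \<in> point_field x" for a
  proof (rule Gal_fixes_generate_field[OF E_subfield s(1)])
    show "a \<in> generate_field L (K \<union> x ` {1..n})" using that by (simp add: adjoin_point_def)
    show "K \<union> x ` {1..n} \<subseteq> E" using K_subset_E point_in_E[OF x] by blast
    show "\<And>a. a \<in> K \<union> x ` {1..n} \<Longrightarrow> s a = a" using Gal_fix[OF s(1)] sx by blast
  qed
  then show "s \<in> carrier (Gal L E (point_field x))" using s(1) by (simp add: Gal_def)
next
  fix s assume s: "s \<in> carrier (Gal L E (point_field x))"
  then have sG: "s \<in> carrier G" using K_subset_point_field by (auto simp: Gal_def)
  have "act s x = x"
    unfolding act_apply[OF x]
  proof (rule PiE_ext)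
    show "(\<lambda>i\<in>{1..n}. s (x i)) \<in> {1..n} \<rightarrow>\<^sub>E carrier L" using act_in_V[OF sG x] by (simp add: V_iff act_apply[OF x])
    show "x \<in> {1..n} \<rightarrow>\<^sub>E carrier L" using x by (simp add: V_iff)
    fix i assume i: "i \<in> {1..n}"
    then show "(\<lambda>i\<in>{1..n}. s (x i)) i = x i"
      using Gal_carrierD(3)[OF s E_subring point_in_point_field[OF i]] by simp
  qed
  then show "s \<in> stabilizer G act x" using sG by (simp add: stabilizer_def)
qed

lemma dimension_point_field:
  assumes x: "x \<in> V"
  shows "dimension (card (orbit G act x)) K (point_field x)"
proof -
  let ?F = "point_field x"
  note F = point_field_subfield[OF x]
  obtain z where z: "z \<in> carrier L" "z [^] N = \<one>" "E = simple_extension K z" by (rule E_simple)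
  have zE: "z \<in> E" unfolding z(3) by (rule simple_extension_mem[OF K_subring z(1)])
  \<comment> \<open>The same \<open>z\<close> generates \<open>E\<close> over \<open>K\<close> and
    over the intermediate field, so \<open>card_Gal_unity\<close> computes the order of the group
    and of the stabilizer alike.\<close>
  have EF: "E = simple_extension ?F z"
  proof
    show "E \<subseteq> simple_extension ?F z"
      unfolding z(3) by (rule mono_simple_extension[OF K_subset_point_field])
    show "simple_extension ?F z \<subseteq> E"
      by (rule simple_extension_subring_incl[OF E_subring point_field_subset_E[OF x] zE])
  qed
  have cG: "order G = (dim over K) E"
    using card_Gal_unity(1)[OF subfield_axioms z(1,2) N_pos]
      simple_extension_dim[OF subfield_axioms z(1) root_of_unity_algebraic[OF subfield_axioms z(1,2) N_pos]]
    unfolding order_def z(3)[symmetric] by simp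
  have algF: "(algebraic over ?F) z" using root_of_unity_algebraic[OF F z(1,2) N_pos] .
  have cS: "card (stabilizer G act x) = (dim over ?F) E"
    using card_Gal_unity(1)[OF F z(1,2) N_pos] simple_extension_dim[OF F z(1) algF]
    unfolding stabilizer_eq[OF x] EF[symmetric] by simp
  obtain y where y: "y \<in> carrier L" "y [^] N = \<one>" "?F = simple_extension K y" by (rule point_field_simple[OF x])
  have fdF: "finite_dimension K ?F"
    unfolding y(3) using finite_dimension_simple_extension[OF subfield_axioms y(1)]
      root_of_unity_algebraic[OF subfield_axioms y(1,2) N_pos] by blast
  have fdE: "finite_dimension ?F E"
    using finite_dimension_simple_extension[OF F z(1)] algF EF by simp
  have tower: "(dim over K) E = (dim over K) ?F * (dim over ?F) E"
    using telescopic_base_dim(2)[OF subfield_axioms F fdF fdE] .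
  have orb: "card (orbit G act x) * card (stabilizer G act x) = order G"
    using action.orbit_stabilizer_theorem[OF x] by (simp add: mult.commute)
  \<comment> \<open>The group is finite and contains the identity. Positivity is needed to cancel
    the stabilizer from the orbit-stabilizer formula.\<close>
  have "order G > 0"
    using card_Gal_unity[OF subfield_axioms z(1,2) N_pos] action.stabilizer_one_closed[OF x]
      action.stabilizer_subset
    unfolding order_def z(3)[symmetric] by (metis card_gt_0_iff empty_iff subsetD)
  then have "(dim over ?F) E > 0" using tower cG by (metis mult_0_right not_gr0)
  then have "card (orbit G act x) = (dim over K) ?F"
    using orb unfolding cG cS tower by simp
  then show ?thesis using finite_dimensionE[OF subfield_axioms fdF] by simp
qed

section \<open>Values at a point and their behaviour under the Galois group\<close>

lemma eval_in_point_field: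
  assumes "x \<in> V" "f \<in> carrier P"
  shows "mpoly_eval L f x \<in> point_field x"
  by (rule mpoly_eval_in_subring[OF K_subring subfieldE(1)[OF point_field_subfield[OF assms(1)]] K_subset_point_field])
     (use assms(2) point_in_point_field in \<open>auto simp: P_carrier\<close>)

lemma eval_act:
  assumes "s \<in> carrier G" "x \<in> V" "f \<in> carrier P"
  shows "mpoly_eval L f (act s x) = s (mpoly_eval L f x)"
  unfolding act_apply[OF assms(2)]
  by (rule mpoly_eval_hom_commute[OF K_subring E_subring K_subset_E _ Gal_ring_hom[OF assms(1)] Gal_fix[OF assms(1)]])
     (use assms(3) point_in_E[OF assms(2)] in \<open>auto simp: P_carrier\<close>)

lemma const_in_P: "k \<in> K \<Longrightarrow> indexed_const k \<in> carrier P"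
  by (simp add: P_carrier indexed_pset.indexed_const)

lemma eval_surj:
  assumes x: "x \<in> V" and a: "a \<in> point_field x"
  shows "\<exists>f \<in> carrier P. mpoly_eval L f x = a"
proof -
  interpret ev: ring_hom_cring P L "\<lambda>f. mpoly_eval L f x" by (rule eval_hom[OF V_carrier[OF x]])
  define A where "A = (\<lambda>f. mpoly_eval L f x) ` carrier P"
  have A: "subring A L"
    unfolding A_def by (rule ev.ring.img_is_subring[OF P.carrier_is_subring])
  have KA: "K \<subseteq> A"
  proof
    fix k assume k: "k \<in> K"
    show "k \<in> A" unfolding A_def
      by (rule image_eqI[OF _ const_in_P[OF k]]) (simp add: mpoly_eval_const[OF K_subring k])
  qed
  have "a \<in> A" using a unfolding adjoin_point_def
  proof induction
    case one
    then show ?case using subringE(3)[OF A] by simp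
  next
    case (incl h)
    then show ?case
    proof
      assume "h \<in> x ` {1..n}"
      then obtain i where i: "i \<in> {1..n}" "h = x i" by blast
      show ?thesis unfolding A_def i(2)
        by (rule image_eqI[OF _ var_in_P[OF i(1)]]) (simp add: mpoly_eval_var[OF K_subring V_carrier[OF x] i(1)])
    qed (use KA in blast)
  next
    case (a_inv h)
    then show ?case using subringE(5)[OF A] by simp
  next
    case (m_inv h)
    have hc: "h \<in> carrier L" using m_inv subringE(1)[OF A] by blast
    \<comment> \<open>As \<open>h\<close> is algebraic over \<open>K\<close>, the ring
      \<open>K[h]\<close> is already a field and contains the inverse. It lies in \<open>A\<close>,
      because \<open>A\<close> is a subring containing \<open>K\<close> and
      \<open>h\<close>.\<close>
    have S: "subfield (simple_extension K h) L"
      using simple_extension_is_subfield[OF subfield_axioms hc] algebraic_extension[OF hc] by blast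
    have "h \<in> simple_extension K h - {\<zero>}" using simple_extension_mem[OF K_subring hc] m_inv by blast
    then have "inv h \<in> simple_extension K h" using subfield_m_inv(1)[OF S] by blast
    then show ?case using simple_extension_subring_incl[OF A KA] m_inv.IH by blast
  next
    case (eng_add h1 h2)
    then show ?case using subringE(7)[OF A] by simp
  next
    case (eng_mult h1 h2)
    then show ?case using subringE(6)[OF A] by simp
  qed
  then show ?thesis unfolding A_def by blast
qed

text \<open>Plays the part of the substitution \<open>p(q)\<close>, described only by its values on
  \<open>V\<close>, which is how it is used.\<close>

lemma compose_univariate:
  assumes q: "q \<in> carrier P" and p: "set p \<subseteq> K"
  shows "\<exists>f \<in> carrier P. \<forall>v \<in> V. mpoly_eval L f v = eval p (mpoly_eval L q v)"
  using p
proof (induction p)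
  case Nil
  have "mpoly_eval L \<zero>\<^bsub>P\<^esub> v = \<zero>" if "v \<in> V" for v
  proof -
    interpret ev: ring_hom_cring P L "\<lambda>f. mpoly_eval L f v" by (rule eval_hom[OF V_carrier[OF that]])
    show ?thesis by simp
  qed
  then show ?case by (intro bexI[of _ "\<zero>\<^bsub>P\<^esub>"]) auto
next
  case (Cons a p)
  then obtain f where f: "f \<in> carrier P" "\<And>v. v \<in> V \<Longrightarrow> mpoly_eval L f v = eval p (mpoly_eval L q v)" by auto
  have a: "indexed_const a \<in> carrier P" "a \<in> K" using Cons.prems const_in_P by auto
  \<comment> \<open>Coefficient lists start with the leading coefficient, so \<open>a\<close>
    belongs to the power \<open>length p\<close>.\<close>
  let ?f = "indexed_const a \<otimes>\<^bsub>P\<^esub> q [^]\<^bsub>P\<^esub> length p \<oplus>\<^bsub>P\<^esub> f"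
  have "mpoly_eval L ?f v = eval (a # p) (mpoly_eval L q v)" if v: "v \<in> V" for v
  proof -
    interpret ev: ring_hom_cring P L "\<lambda>f. mpoly_eval L f v" by (rule eval_hom[OF V_carrier[OF v]])
    show ?thesis using a q f(1) by (simp add: ev.hom_pow f(2)[OF v] mpoly_eval_const[OF K_subring a(2)])
  qed
  then show ?case using a q f(1) by (intro bexI[of _ ?f]) auto
qed

section \<open>Separation of orbits and interpolation\<close>

lemma orbit_subset_V: "x \<in> V \<Longrightarrow> orbit G act x \<subseteq> V"
  using act_in_V by (auto simp: orbit_def)

text \<open>Take \<open>q\<close> with \<open>q(y) = z\<close> a generator of \<open>K(y)\<close>,
  and \<open>p i\<close> with \<open>y i = p i (z)\<close>. The relations
  \<open>Irr K z (q) = 0\<close> and \<open>X_i = p i (q)\<close> hold at \<open>y\<close>, hence at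
  its orbit and, by \<open>ker\<close>, at \<open>x\<close>. So these points are determined by the
  value of \<open>q\<close>, and this value is a root of \<open>Irr K z\<close>. Every root is the
  value at some point \<open>u\<close> of the orbit, and \<open>u\<close> must be \<open>x\<close>
  if \<open>q\<close> takes the same value there.\<close>

lemma orbit_if_kernel_subset:
  assumes x: "x \<in> V" and y: "y \<in> V"
    and ker: "\<And>h. h \<in> carrier P \<Longrightarrow> mpoly_eval L h y = \<zero> \<Longrightarrow> mpoly_eval L h x = \<zero>"
  shows "x \<in> orbit G act y"
proof -
  obtain z where z: "z \<in> carrier L" "z [^] N = \<one>" "point_field y = simple_extension K z"
    by (rule point_field_simple[OF y])
  note alg = root_of_unity_algebraic[OF subfield_axioms z(1,2) N_pos]
  note I = IrrE[OF subfield_axioms z(1) alg]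
  have set_K: "set p \<subseteq> K" if "p \<in> carrier (K[X])" for p
    using that polynomial_incl univ_poly_carrier by blast
  have zF: "z \<in> point_field y" unfolding z(3) by (rule simple_extension_mem[OF K_subring z(1)])
  obtain q where q: "q \<in> carrier P" "mpoly_eval L q y = z" using eval_surj[OF y zF] by blast
  have "\<exists>p \<in> carrier (K[X]). eval p z = y i" if "i \<in> {1..n}" for i
    using point_in_point_field[OF that, of y]
    unfolding z(3) simple_extension_as_eval_img[OF K_subset_carrier z(1)] by (metis imageE)
  then obtain p where p: "\<And>i. i \<in> {1..n} \<Longrightarrow> p i \<in> carrier (K[X])" "\<And>i. i \<in> {1..n} \<Longrightarrow> eval (p i) z = y i"
    by metis
  let ?rt = "{w \<in> carrier L. eval (Irr K z) w = \<zero>}" and ?q = "mpoly_eval L q"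
  have orb: "?q u \<in> ?rt" "\<And>i. i \<in> {1..n} \<Longrightarrow> u i = eval (p i) (?q u)" if u: "u \<in> orbit G act y" for u
  proof -
    obtain s where s: "s \<in> carrier G" "u = act s y" using u by (auto simp: orbit_def)
    have zE: "z \<in> E" using zF point_field_subset_E[OF y] by blast
    have qu: "?q u = s z" using eval_act[OF s(1) y q(1)] q(2) s(2) by simp
    have comm: "s (eval r z) = eval r (s z)" if "r \<in> carrier (K[X])" for r
      by (rule eval_hom_commute(2)[OF subfield_axioms E_subring K_subset_E Gal_ring_hom[OF s(1)] Gal_fix[OF s(1)] zE set_K[OF that]])
    have "s \<zero> = \<zero>" using Gal_fix[OF s(1) subringE(2)[OF K_subring]] .
    then show "?q u \<in> ?rt"
      using comm[OF I(1)] I(4) qu ring_hom_closed[OF Gal_ring_hom[OF s(1)], of z] zE by simp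
    fix i assume i: "i \<in> {1..n}"
    have "u i = s (y i)" unfolding s(2) act_apply[OF y] using i by simp
    then show "u i = eval (p i) (?q u)" using comm[OF p(1)[OF i]] p(2)[OF i] qu by simp
  qed
  have point_eqI: "u = v" if "u \<in> V" "v \<in> V" "\<And>i. i \<in> {1..n} \<Longrightarrow> u i = v i" for u v
    by (rule PiE_ext[of u "{1..n}" "\<lambda>_. carrier L"]) (use that in \<open>simp_all add: V_iff\<close>)
  have inj: "inj_on ?q (orbit G act y)"
  proof (rule inj_onI)
    fix u v assume uv: "u \<in> orbit G act y" "v \<in> orbit G act y" "?q u = ?q v"
    show "u = v"
    proof (rule point_eqI)
      show "u \<in> V" "v \<in> V" using uv(1,2) orbit_subset_V[OF y] by blast+
      show "u i = v i" if "i \<in> {1..n}" for i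
        using orb(2)[OF uv(1) that] orb(2)[OF uv(2) that] uv(3) by simp
    qed
  qed
  have "Irr K z \<noteq> []" using pirreducibleE(1)[OF K_subring I(1,2)] .
  then have fin: "finite ?rt"
    using card_eval_roots_le(1) carrier_polynomial_shell[OF K_subring I(1)] by blast
  \<comment> \<open>Both numbers are the degree of \<open>K(y)\<close> over \<open>K\<close>, once
    through \<open>dimension_point_field\<close> and once through the generator \<open>z\<close>.
    This makes the injection of the orbit into the roots surjective.\<close>
  have "card (orbit G act y) = degree (Irr K z)"
    using dimension_is_inj[OF subfield_axioms dimension_point_field[OF y]]
      dimension_simple_extension[OF subfield_axioms z(1) alg] z(3) by simp
  then have "card ?rt \<le> card (?q ` orbit G act y)"
    using card_roots_Irr_unity(1)[OF subfield_axioms z(1,2) N_pos] card_image[OF inj] by simp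
  then have onto: "?q ` orbit G act y = ?rt"
    by (intro card_seteq[OF fin]) (use orb(1) in blast)
  have xc: "?q x \<in> carrier L"
    using eval_in_point_field[OF x q(1)] subfieldE(3)[OF point_field_subfield[OF x]] by blast
  obtain f where f: "f \<in> carrier P" "\<And>v. v \<in> V \<Longrightarrow> mpoly_eval L f v = eval (Irr K z) (?q v)"
    using compose_univariate[OF q(1) set_K[OF I(1)]] by blast
  have "mpoly_eval L f x = \<zero>" by (rule ker[OF f(1)]) (use f(2)[OF y] q(2) I(4) in simp)
  then have "?q x \<in> ?rt" using f(2)[OF x] xc by simp
  then obtain u where u: "u \<in> orbit G act y" "?q x = ?q u" using onto by blast
  have xi: "x i = eval (p i) (?q x)" if i: "i \<in> {1..n}" for i
  proof -
    obtain g where g: "g \<in> carrier P" "\<And>v. v \<in> V \<Longrightarrow> mpoly_eval L g v = eval (p i) (?q v)"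
      using compose_univariate[OF q(1) set_K[OF p(1)[OF i]]] by blast
    \<comment> \<open>This difference expresses the relation \<open>X_i = p i (q)\<close> as a
      polynomial over \<open>K\<close> vanishing at \<open>y\<close>, so that \<open>ker\<close>
      transfers it to \<open>x\<close>.\<close>
    have ev: "mpoly_eval L (indexed_var i \<ominus>\<^bsub>P\<^esub> g) v = v i \<ominus> eval (p i) (?q v)" if v: "v \<in> V" for v
    proof -
      interpret ev: ring_hom_cring P L "\<lambda>f. mpoly_eval L f v" by (rule eval_hom[OF V_carrier[OF v]])
      show ?thesis
        using g(1) var_in_P[OF i] by (simp add: a_minus_def g(2)[OF v] mpoly_eval_var[OF K_subring V_carrier[OF v] i])
    qed
    have c: "v i \<in> carrier L" "eval (p i) (?q v) \<in> carrier L" if v: "v \<in> V" for v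
    proof -
      show "v i \<in> carrier L" using V_carrier[OF v] i by blast
      have "mpoly_eval L g v \<in> carrier L"
        using eval_in_point_field[OF v g(1)] subfieldE(3)[OF point_field_subfield[OF v]] by blast
      then show "eval (p i) (?q v) \<in> carrier L" using g(2)[OF v] by simp
    qed
    have "mpoly_eval L (indexed_var i \<ominus>\<^bsub>P\<^esub> g) y = \<zero>"
      unfolding ev[OF y] using p(2)[OF i] q(2) c[OF y] by simp
    then have "x i \<ominus> eval (p i) (?q x) = \<zero>"
      using ker[of "indexed_var i \<ominus>\<^bsub>P\<^esub> g"] g(1) var_in_P[OF i] ev[OF x] by simp
    then show ?thesis using c[OF x] by simp
  qed
  have "x = u"
    by (rule point_eqI[OF x]) (use orbit_subset_V[OF y] u xi orb(2)[OF u(1)] in auto)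
  with u(1) show ?thesis by simp
qed

text \<open>A polynomial \<open>h\<close> that vanishes at \<open>y\<close> but not at
  \<open>x\<close> is rescaled: the inverse of \<open>h(x)\<close> lies in \<open>K(x)\<close> and
  is therefore the value at \<open>x\<close> of some polynomial \<open>g\<close>.\<close>

lemma exists_separating:
  assumes x: "x \<in> V" and y: "y \<in> V" and "x \<notin> orbit G act y"
  shows "\<exists>e \<in> carrier P. mpoly_eval L e x = \<one> \<and> mpoly_eval L e y = \<zero>"
proof -
  obtain h where h: "h \<in> carrier P" "mpoly_eval L h y = \<zero>" "mpoly_eval L h x \<noteq> \<zero>"
    using orbit_if_kernel_subset[OF x y] assms(3) by blast
  note F = point_field_subfield[OF x]
  have hF: "mpoly_eval L h x \<in> point_field x - {\<zero>}" using eval_in_point_field[OF x h(1)] h(3) by blast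
  obtain g where g: "g \<in> carrier P" "mpoly_eval L g x = inv (mpoly_eval L h x)"
    using eval_surj[OF x] subfield_m_inv(1)[OF F hF] by blast
  interpret evx: ring_hom_cring P L "\<lambda>f. mpoly_eval L f x" by (rule eval_hom[OF V_carrier[OF x]])
  interpret evy: ring_hom_cring P L "\<lambda>f. mpoly_eval L f y" by (rule eval_hom[OF V_carrier[OF y]])
  show ?thesis
    using h g subfield_m_inv(2)[OF F hF] by (intro bexI[of _ "h \<otimes>\<^bsub>P\<^esub> g"]) auto
qed

lemma exists_separating_finite:
  assumes x: "x \<in> V" and "finite T" "T \<subseteq> V" "\<And>y. y \<in> T \<Longrightarrow> x \<notin> orbit G act y"
  shows "\<exists>e \<in> carrier P. mpoly_eval L e x = \<one> \<and> (\<forall>y\<in>T. mpoly_eval L e y = \<zero>)"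
  using assms(2-)
proof (induction T rule: finite_induct)
  case empty
  interpret evx: ring_hom_cring P L "\<lambda>f. mpoly_eval L f x" by (rule eval_hom[OF V_carrier[OF x]])
  show ?case by (intro bexI[of _ "\<one>\<^bsub>P\<^esub>"]) auto
next
  case (insert y T)
  obtain e where e: "e \<in> carrier P" "mpoly_eval L e x = \<one>" "\<And>y. y \<in> T \<Longrightarrow> mpoly_eval L e y = \<zero>"
    using insert.IH insert.prems by blast
  obtain e' where e': "e' \<in> carrier P" "mpoly_eval L e' x = \<one>" "mpoly_eval L e' y = \<zero>"
    using exists_separating[OF x] insert.prems by blast
  have mult: "mpoly_eval L (e \<otimes>\<^bsub>P\<^esub> e') v = mpoly_eval L e v \<otimes> mpoly_eval L e' v"
    "mpoly_eval L e v \<in> carrier L" "mpoly_eval L e' v \<in> carrier L" if v: "v \<in> V" for v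
  proof -
    interpret ev: ring_hom_cring P L "\<lambda>f. mpoly_eval L f v" by (rule eval_hom[OF V_carrier[OF v]])
    show "mpoly_eval L (e \<otimes>\<^bsub>P\<^esub> e') v = mpoly_eval L e v \<otimes> mpoly_eval L e' v"
      "mpoly_eval L e v \<in> carrier L" "mpoly_eval L e' v \<in> carrier L" using e(1) e'(1) by simp_all
  qed
  have "mpoly_eval L (e \<otimes>\<^bsub>P\<^esub> e') v = \<zero>" if "v \<in> insert y T" for v
  proof -
    have v: "v \<in> V" using that insert.prems(1) by blast
    show ?thesis using that mult[OF v] e(3) e'(3) by auto
  qed
  moreover have "mpoly_eval L (e \<otimes>\<^bsub>P\<^esub> e') x = \<one>" using mult(1)[OF x] e(2) e'(2) by simp
  ultimately show ?case using e(1) e'(1) by (intro bexI[of _ "e \<otimes>\<^bsub>P\<^esub> e'"]) auto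
qed

lemma interpolation:
  assumes "finite T" "T \<subseteq> V" "\<And>x y. x \<in> T \<Longrightarrow> y \<in> T \<Longrightarrow> x \<noteq> y \<Longrightarrow> x \<notin> orbit G act y"
    "\<And>x. x \<in> T \<Longrightarrow> a x \<in> point_field x"
  shows "\<exists>f \<in> carrier P. \<forall>x\<in>T. mpoly_eval L f x = a x"
  using assms
proof (induction T rule: finite_induct)
  case empty
  show ?case by (intro bexI[of _ "\<zero>\<^bsub>P\<^esub>"]) auto
next
  case (insert x T)
  have x: "x \<in> V" using insert.prems by blast
  obtain f where f: "f \<in> carrier P" "\<And>y. y \<in> T \<Longrightarrow> mpoly_eval L f y = a y"
    using insert.IH insert.prems by blast
  have "T \<subseteq> V" "\<And>y. y \<in> T \<Longrightarrow> x \<notin> orbit G act y"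
    using insert.prems(1,2) insert.hyps(2) by blast+
  then obtain e where e: "e \<in> carrier P" "mpoly_eval L e x = \<one>" "\<And>y. y \<in> T \<Longrightarrow> mpoly_eval L e y = \<zero>"
    using exists_separating_finite[OF x insert.hyps(1)] by blast
  obtain g where g: "g \<in> carrier P" "mpoly_eval L g x = a x"
    using eval_surj[OF x] insert.prems(3) by blast
  \<comment> \<open>The correction is multiplied by \<open>e\<close>, which is one at
    \<open>x\<close> and zero on \<open>T\<close>: the value at \<open>x\<close> becomes that of
    \<open>g\<close>, and the values on \<open>T\<close> are kept.\<close>
  let ?f = "f \<oplus>\<^bsub>P\<^esub> e \<otimes>\<^bsub>P\<^esub> (g \<ominus>\<^bsub>P\<^esub> f)"
  have ev: "mpoly_eval L ?f v = mpoly_eval L f v \<oplus> mpoly_eval L e v \<otimes> (mpoly_eval L g v \<ominus> mpoly_eval L f v)"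
    "mpoly_eval L f v \<in> carrier L" "mpoly_eval L g v \<in> carrier L" if v: "v \<in> V" for v
  proof -
    interpret ev: ring_hom_cring P L "\<lambda>f. mpoly_eval L f v" by (rule eval_hom[OF V_carrier[OF v]])
    show "mpoly_eval L ?f v = mpoly_eval L f v \<oplus> mpoly_eval L e v \<otimes> (mpoly_eval L g v \<ominus> mpoly_eval L f v)"
      "mpoly_eval L f v \<in> carrier L" "mpoly_eval L g v \<in> carrier L"
      using f(1) e(1) g(1) by (simp_all add: a_minus_def)
  qed
  have "mpoly_eval L f x \<oplus> \<one> \<otimes> (mpoly_eval L g x \<ominus> mpoly_eval L f x) = mpoly_eval L g x"
    using ev(2,3)[OF x] by algebra
  then have "mpoly_eval L ?f x = a x" using ev(1)[OF x] e(2) g(2) by simp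
  moreover have "mpoly_eval L ?f y = a y" if "y \<in> T" for y
  proof -
    have y: "y \<in> V" using that insert.prems(1) by blast
    show ?thesis using ev[OF y] e(3)[OF that] f(2)[OF that] by simp
  qed
  ultimately show ?case using f(1) e(1) g(1) by (intro bexI[of _ ?f]) auto
qed

section \<open>The evaluation map on residue classes\<close>

lemma class_eval_eq:
  assumes f: "f \<in> carrier P" and x: "x \<in> V"
  shows "class_eval L (J +>\<^bsub>P\<^esub> f) x = mpoly_eval L f x"
proof -
  interpret ev: ring_hom_cring P L "\<lambda>f. mpoly_eval L f x" by (rule eval_hom[OF V_carrier[OF x]])
  have "mpoly_eval L g x = mpoly_eval L f x" if g: "g \<in> J +>\<^bsub>P\<^esub> f" for g
  proof -
    obtain j where "j \<in> J" "g = j \<oplus>\<^bsub>P\<^esub> f" using g unfolding a_r_coset_def' by blast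
    then show ?thesis using eval_J[of j x] x f J.Icarr[of j] by simp
  qed
  moreover have "f \<in> J +>\<^bsub>P\<^esub> f" by (rule J.a_rcos_self[OF f])
  \<comment> \<open>Members of the class differ from \<open>f\<close> by elements of
    \<open>J\<close>, which vanish at \<open>x\<close>. The image is a singleton, so
    \<open>the_elem\<close> returns its member.\<close>
  ultimately have "(\<lambda>f. mpoly_eval L f x) ` (J +>\<^bsub>P\<^esub> f) = {mpoly_eval L f x}" by blast
  then show ?thesis by (simp add: class_eval_def)
qed

theorem evaluation_ring_iso:
  assumes S: "S \<subseteq> V" and reps: "\<And>B. B \<in> orbits G V act \<Longrightarrow> \<exists>!x. x \<in> S \<and> x \<in> B"
  shows "(\<lambda>A. \<lambda>x\<in>S. class_eval L A x)
    \<in> ring_iso (circulant_ring L K n m) (product_ring S (\<lambda>x. L\<lparr>carrier := point_field x\<rparr>))"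
proof -
  let ?h = "\<lambda>A. \<lambda>x\<in>S. class_eval L A x" and ?C = "circulant_ring L K n m"
    and ?D = "product_ring S (\<lambda>x. L\<lparr>carrier := point_field x\<rparr>)"
  have SV: "x \<in> V" if "x \<in> S" for x using S that by blast
  have hf: "?h (J +>\<^bsub>P\<^esub> f) = (\<lambda>x\<in>S. mpoly_eval L f x)" if "f \<in> carrier P" for f
    using class_eval_eq[OF that SV] by (intro restrict_ext) simp
  have C: "carrier ?C = (\<lambda>f. J +>\<^bsub>P\<^esub> f) ` carrier P"
    by (auto simp: circulant_ring_def FactRing_def A_RCOSETS_def')
  have D: "carrier ?D = (\<Pi>\<^sub>E x\<in>S. point_field x)" by (simp add: product_ring_def)
  interpret q: ring_hom_ring P ?C "(+>\<^bsub>P\<^esub>) J"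
    unfolding circulant_ring_def by (rule J.rcos_ring_hom_ring)
  have ev: "mpoly_eval L (f \<oplus>\<^bsub>P\<^esub> g) x = mpoly_eval L f x \<oplus> mpoly_eval L g x"
    "mpoly_eval L (f \<otimes>\<^bsub>P\<^esub> g) x = mpoly_eval L f x \<otimes> mpoly_eval L g x"
    "mpoly_eval L \<one>\<^bsub>P\<^esub> x = \<one>" "mpoly_eval L (f \<ominus>\<^bsub>P\<^esub> g) x = mpoly_eval L f x \<ominus> mpoly_eval L g x"
    "mpoly_eval L f x \<in> carrier L"
    if "x \<in> V" "f \<in> carrier P" "g \<in> carrier P" for f g x
  proof -
    interpret ev: ring_hom_cring P L "\<lambda>f. mpoly_eval L f x" by (rule eval_hom[OF V_carrier[OF that(1)]])
    show "mpoly_eval L (f \<oplus>\<^bsub>P\<^esub> g) x = mpoly_eval L f x \<oplus> mpoly_eval L g x"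
      "mpoly_eval L (f \<otimes>\<^bsub>P\<^esub> g) x = mpoly_eval L f x \<otimes> mpoly_eval L g x"
      "mpoly_eval L \<one>\<^bsub>P\<^esub> x = \<one>" "mpoly_eval L (f \<ominus>\<^bsub>P\<^esub> g) x = mpoly_eval L f x \<ominus> mpoly_eval L g x"
      "mpoly_eval L f x \<in> carrier L" using that by (simp_all add: a_minus_def)
  qed
  have "?h \<in> ring_hom ?C ?D"
  proof (rule ring_hom_memI)
    fix A assume "A \<in> carrier ?C"
    then obtain f where f: "f \<in> carrier P" "A = J +>\<^bsub>P\<^esub> f" unfolding C by blast
    show "?h A \<in> carrier ?D"
      unfolding f(2) hf[OF f(1)] D using eval_in_point_field[OF SV f(1)] by simp
  next
    fix A B assume "A \<in> carrier ?C" "B \<in> carrier ?C"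
    then obtain f g where f: "f \<in> carrier P" "A = J +>\<^bsub>P\<^esub> f" and g: "g \<in> carrier P" "B = J +>\<^bsub>P\<^esub> g"
      unfolding C by blast
    have e: "A \<otimes>\<^bsub>?C\<^esub> B = J +>\<^bsub>P\<^esub> (f \<otimes>\<^bsub>P\<^esub> g)" "A \<oplus>\<^bsub>?C\<^esub> B = J +>\<^bsub>P\<^esub> (f \<oplus>\<^bsub>P\<^esub> g)"
      using f g by simp_all
    have fg: "f \<otimes>\<^bsub>P\<^esub> g \<in> carrier P" "f \<oplus>\<^bsub>P\<^esub> g \<in> carrier P" using f g by simp_all
    show "?h (A \<otimes>\<^bsub>?C\<^esub> B) = ?h A \<otimes>\<^bsub>?D\<^esub> ?h B"
      unfolding e hf[OF fg(1)] unfolding f(2) g(2) hf[OF f(1)] hf[OF g(1)]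
      using ev(2)[OF SV f(1) g(1)] by (simp add: product_ring_def cong: restrict_cong)
    show "?h (A \<oplus>\<^bsub>?C\<^esub> B) = ?h A \<oplus>\<^bsub>?D\<^esub> ?h B"
      unfolding e hf[OF fg(2)] unfolding f(2) g(2) hf[OF f(1)] hf[OF g(1)]
      using ev(1)[OF SV f(1) g(1)] by (simp add: product_ring_def cong: restrict_cong)
  next
    have "\<one>\<^bsub>?C\<^esub> = J +>\<^bsub>P\<^esub> \<one>\<^bsub>P\<^esub>" by simp
    then show "?h \<one>\<^bsub>?C\<^esub> = \<one>\<^bsub>?D\<^esub>"
      using ev(3)[OF SV P.one_closed P.one_closed]
      by (simp only: hf[OF P.one_closed]) (simp add: product_ring_def cong: restrict_cong)
  qed
  moreover have "inj_on ?h (carrier ?C)"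
  proof (rule inj_onI)
    fix A B assume AB: "A \<in> carrier ?C" "B \<in> carrier ?C" "?h A = ?h B"
    then obtain f g where f: "f \<in> carrier P" "A = J +>\<^bsub>P\<^esub> f" and g: "g \<in> carrier P" "B = J +>\<^bsub>P\<^esub> g"
      unfolding C by blast
    have eq: "mpoly_eval L f x = mpoly_eval L g x" if "x \<in> S" for x
      using AB(3) that unfolding f(2) g(2) hf[OF f(1)] hf[OF g(1)] by (metis restrict_apply')
    have fg: "f \<ominus>\<^bsub>P\<^esub> g \<in> carrier P" using f(1) g(1) by simp
    have "f \<ominus>\<^bsub>P\<^esub> g \<in> J"
    proof (rule vanishing_imp_in_J[OF fg])
      fix v assume v: "v \<in> V"
      \<comment> \<open>The value at \<open>v\<close> is the image, under an automorphism fixing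
        zero, of the value at the representative of its orbit, where \<open>f\<close> and
        \<open>g\<close> agree.\<close>
      have "orbit G act v \<in> orbits G V act" using v by (auto simp: orbits_def)
      then obtain x where x: "x \<in> S" "x \<in> orbit G act v" using reps by blast
      then have "v \<in> orbit G act x" using action.orbit_sym[OF v SV] by blast
      then obtain s where s: "s \<in> carrier G" "v = act s x" by (auto simp: orbit_def)
      have "mpoly_eval L (f \<ominus>\<^bsub>P\<^esub> g) x = \<zero>"
        using ev(4)[OF SV[OF x(1)] f(1) g(1)] eq[OF x(1)] ev(5)[OF SV[OF x(1)] g(1) g(1)] by simp
      then show "mpoly_eval L (f \<ominus>\<^bsub>P\<^esub> g) v = \<zero>"
        using eval_act[OF s(1) SV[OF x(1)] fg] s(2) Gal_fix[OF s(1) subringE(2)[OF K_subring]] by simp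
    qed
    then have "f \<in> J +>\<^bsub>P\<^esub> g"
      using J.a_rcos_module_minus[OF P.ring_axioms g(1) f(1)] by simp
    then show "A = B"
      unfolding f(2) g(2) by (rule J.a_repr_independence'[OF _ g(1), symmetric])
  qed
  moreover have "?h ` carrier ?C = carrier ?D"
  proof
    show "?h ` carrier ?C \<subseteq> carrier ?D"
      using ring_hom_closed[OF \<open>?h \<in> ring_hom ?C ?D\<close>] by blast
    show "carrier ?D \<subseteq> ?h ` carrier ?C"
    proof
      fix a assume a: "a \<in> carrier ?D"
      \<comment> \<open>Uniqueness of representatives is used here; existence was used for
        injectivity.\<close>
      have "x \<notin> orbit G act y" if "x \<in> S" "y \<in> S" "x \<noteq> y" for x y
      proof
        assume "x \<in> orbit G act y"
        moreover have "y \<in> orbit G act y" by (rule action.orbit_refl[OF SV[OF that(2)]])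
        moreover have "orbit G act y \<in> orbits G V act" using SV[OF that(2)] by (auto simp: orbits_def)
        ultimately show False using reps that by blast
      qed
      moreover have "a x \<in> point_field x" if "x \<in> S" for x using a that unfolding D by blast
      ultimately obtain f where f: "f \<in> carrier P" "\<And>x. x \<in> S \<Longrightarrow> mpoly_eval L f x = a x"
        using interpolation[OF finite_subset[OF S finite_V] S, of a] by blast
      have "?h (J +>\<^bsub>P\<^esub> f) = a"
        unfolding hf[OF f(1)]
      proof (rule extensionalityI)
        show "a \<in> extensional S" using a unfolding D by (simp add: PiE_iff)
      qed (use f(2) in simp_all)
      then show "a \<in> ?h ` carrier ?C" using f(1) unfolding C by blast
    qed
  qed
  ultimately show ?thesis by (simp add: ring_iso_def bij_betw_def)
qed

end

text \<open>The first conjunct is well-definedness: it excludes that \<open>the_elem\<close> inside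
  \<open>class_eval\<close> yields an unspecified value. The last one uses the relation
  \<open>dimension\<close>, which asserts finiteness of the extension together with its
  degree.\<close>

theorem theorem3p17:
  fixes L :: "('a, 'b) ring_scheme" and K :: "'a set"
    and n :: nat and m :: "nat \<Rightarrow> nat" and S :: "(nat \<Rightarrow> 'a) set"
  assumes closure: "algebraic_closure L K"
    and pos: "\<forall>i\<in>{1..n}. m i > 0"
    and semisimple: "semisimple_ring (circulant_ring L K n m)"
    and S_subset: "S \<subseteq> circulant_variety L K n m"
    and S_reps: "\<forall>B\<in>orbits (circulant_Gal L K n m) (circulant_variety L K n m) (geometric_action L K n m).
                   \<exists>!x. x \<in> S \<and> x \<in> B"
  shows "(\<forall>f\<in>carrier (mpoly_ring L K {1..n}). \<forall>x\<in>S.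
            class_eval L (circulant_ideal L K n m +>\<^bsub>mpoly_ring L K {1..n}\<^esub> f) x = mpoly_eval L f x)
       \<and> (\<lambda>A. \<lambda>x\<in>S. class_eval L A x)
            \<in> ring_iso (circulant_ring L K n m)
                       (product_ring S (\<lambda>x. L\<lparr>carrier := adjoin_point L K n x\<rparr>))
       \<and> (\<forall>x\<in>S. ring.dimension L
                  (card (orbit (circulant_Gal L K n m) (geometric_action L K n m) x))
                  K (adjoin_point L K n x))"
proof -
  interpret circulant L K n m
    using closure pos semisimple by (simp add: circulant_def circulant_axioms_def)
  have point: "x \<in> V" if "x \<in> S" for x using S_subset that by blast
  show ?thesis
  proof (intro conjI ballI)
    fix f x assume "f \<in> carrier P" "x \<in> S"
    then show "class_eval L (J +>\<^bsub>P\<^esub> f) x = mpoly_eval L f x"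
      by (intro class_eval_eq point)
  next
    show "(\<lambda>A. \<lambda>x\<in>S. class_eval L A x)
      \<in> ring_iso (circulant_ring L K n m) (product_ring S (\<lambda>x. L\<lparr>carrier := point_field x\<rparr>))"
      by (rule evaluation_ring_iso[OF S_subset]) (use S_reps in blast)
  next
    fix x assume "x \<in> S"
    then show "dimension (card (orbit G act x)) K (point_field x)"
      by (intro dimension_point_field point)
  qed
qed

end
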